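(* There exists $n_0$ such that for every $n\ge n_0$ and every integer $s$ with $1\le s\le (n-2)/3$ we have $$\mu_3(n,s)=\max\Big\{\binom n3-\binom{n-s}3\,,\ \binom{3s+2}3\Big\}.$$ Furthermore, for such $n$ and $s$, $\mathcal{M}_3(n,s)\subseteq \mathrm{Cov}_3(n,s)\cup \mathrm{Cl}_3(n,s)$.
   Context: A $k$-uniform hypergraph ($k$-graph) $G=(V,E)$ consists of a finite vertex set $V\subseteq\mathbb{N}$ and a family $E$ of $k$-element subsets of $V$ (edges). A matching is a family of pairwise disjoint edges; $\mu(G)$ is the size of a largest matching in $G$. Let $\mathcal{H}_k(n,s)$ be the set of all $k$-graphs $G=(V,E)$ with $|V|=n$ and $\mu(G)=s$; let $\mu_k(n,s)=\max\{|E(G)|: G\in\mathcal{H}_k(n,s)\}$ and $\mathcal{M}_k(n,s)=\{G\in\mathcal{H}_k(n,s): |E(G)|=\mu_k(n,s)\}$. $\mathrm{Cov}_k(n,s)$ is the family of $k$-graphs $G=(V,E)$ with $|V|=n$ such that for some $S\subseteq V$ with $|S|=s$, $E=\{e\subseteq V: |e|=k,\ e\cap S\neq\emptyset\}$. $\mathrm{Cl}_k(n,s)$ is the family of $k$-graphs $G=(V,E)$ with $|V|=n$ such that for some $T\subseteq V$ with $|T|=ks+k-1$, $E=\{e\subseteq T: |e|=k\}$ (a complete $k$-graph on $ks+k-1$ vertices plus isolated vertices). *)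

theory Defs
  imports Main
begin

definition is_kgraph :: "nat \<Rightarrow> nat set \<times> nat set set \<Rightarrow> bool" where
  "is_kgraph k G \<longleftrightarrow> finite (fst G) \<and> (\<forall>e\<in>snd G. e \<subseteq> fst G \<and> card e = k)"

definition is_matching :: "nat set set \<Rightarrow> nat set set \<Rightarrow> bool" where
  "is_matching E M \<longleftrightarrow> M \<subseteq> E \<and> (\<forall>e\<in>M. \<forall>f\<in>M. e \<noteq> f \<longrightarrow> e \<inter> f = {})"

definition matching_number :: "nat set \<times> nat set set \<Rightarrow> nat" where
  "matching_number G = Max {card M | M. is_matching (snd G) M}"

definition H_fam :: "nat \<Rightarrow> nat \<Rightarrow> nat \<Rightarrow> (nat set \<times> nat set set) set" where
  "H_fam k n s = {G. is_kgraph k G \<and> card (fst G) = n \<and> matching_number G = s}"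

definition mu_max :: "nat \<Rightarrow> nat \<Rightarrow> nat \<Rightarrow> nat" where
  "mu_max k n s = Max {card (snd G) | G. G \<in> H_fam k n s}"

definition M_fam :: "nat \<Rightarrow> nat \<Rightarrow> nat \<Rightarrow> (nat set \<times> nat set set) set" where
  "M_fam k n s = {G \<in> H_fam k n s. card (snd G) = mu_max k n s}"

definition Cov_fam :: "nat \<Rightarrow> nat \<Rightarrow> nat \<Rightarrow> (nat set \<times> nat set set) set" where
  "Cov_fam k n s = {(V, E). finite V \<and> card V = n \<and>
     (\<exists>S. S \<subseteq> V \<and> card S = s \<and> E = {e. e \<subseteq> V \<and> card e = k \<and> e \<inter> S \<noteq> {}})}"

definition Cl_fam :: "nat \<Rightarrow> nat \<Rightarrow> nat \<Rightarrow> (nat set \<times> nat set set) set" where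
  "Cl_fam k n s = {(V, E). finite V \<and> card V = n \<and>
     (\<exists>T. T \<subseteq> V \<and> card T = k * s + k - 1 \<and> E = {e. e \<subseteq> T \<and> card e = k})}"

end

theory Submission
  imports Defs "HOL-Analysis.Analysis" "HOL-Library.Numeral_Type"
begin

text \<open>
  Shifting reduces the problem to stable families on \<open>{..<n}\<close>. If \<open>n \<ge> 30 s\<close>, deleting the first
  vertex and induction on \<open>s\<close> suffice. Otherwise \<open>s\<close> is large, and we cut \<open>{..<n}\<close> into a huge but
  fixed number of cells of equal length. The triples of cells lying entirely in the family have a
  fractional matching number that is essentially at most \<open>s\<close>; linear programming duality provides
  an optimal fractional matching and vertex weights \<open>w\<close> such that every matched triple (a block)
  has total weight exactly 1 and uncovered cells have weight 0. Counting edges by the blocks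
  that they meet, three blocks at a time, becomes a finite inequality on triples of nonnegative
  reals with sum 1: apart from three blocks of weights \<open>(1, 0, 0)\<close> (the covering family) and
  three blocks all of whose 27 transversals are edges (the clique), every triple of blocks loses
  a constant. Hence a stable family at least as large as both candidates is close to one of them,
  and in either neighbourhood the exact bound follows by direct arguments.
\<close>

section \<open>Matchings and stable families\<close>

text \<open>The two candidates are asymptotically equal when n/s is about 3.486, so near that ratio
  neither can be dismissed: the approximate argument must end in one of two neighbourhoods, and the
  exact bound is needed in both. The clique case comes with n <= 3.52 s, the star case with n >=
  3.43 s; these ranges overlap around the crossing. Stability makes closeness cheap, since a single
  high edge fills everything below it. Close to the clique means one edge with all vertices above
  about 0.99 (3 s + 2); close to the covering family means one edge with a vertex above about 0.99 s
  and two above about 0.99 n. The constants form a chain. A loss of 1/10 per defective triple of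
  blocks against a counting error of relative size 10^-9 leaves defects of relative mass 10^-8,
  which is below (1/200)^3. With 10^18 cells the partly filled boxes stay below that error, and s >=
  10^69 absorbs the rounding loss of at most one edge for each of the 10^54 triples of cells.
  Equality is tracked in every exact bound, because shifting destroys information: the extremal
  family has to be recovered from its shifted form.\<close>

definition triples :: "nat set \<Rightarrow> nat set set" where
  "triples V = {e. e \<subseteq> V \<and> card e = 3}"

definition star :: "nat set \<Rightarrow> nat set \<Rightarrow> nat set set" where
  "star V S = {e \<in> triples V. e \<inter> S \<noteq> {}}"

definition nu_le :: "nat set set \<Rightarrow> nat \<Rightarrow> bool" where
  "nu_le E s \<longleftrightarrow> (\<forall>M. is_matching E M \<longrightarrow> card M \<le> s)"

definition stable :: "nat set \<Rightarrow> nat set set \<Rightarrow> bool" where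
  "stable V E \<longleftrightarrow> (\<forall>e\<in>E. \<forall>j\<in>e. \<forall>i\<in>V. i \<notin> e \<longrightarrow> i < j \<longrightarrow> insert i (e - {j}) \<in> E)"

definition cov :: "nat \<Rightarrow> nat \<Rightarrow> nat" where
  "cov n s = (n choose 3) - ((n - s) choose 3)"

definition cl :: "nat \<Rightarrow> nat" where
  "cl s = (3 * s + 2) choose 3"

lemma finite_triples [simp]: "finite V \<Longrightarrow> finite (triples V)"
  unfolding triples_def by (rule finite_subset[of _ "Pow V"]) auto

lemma card_triples: "finite V \<Longrightarrow> card (triples V) = card V choose 3"
  unfolding triples_def by (rule n_subsets)

lemma triples_mono: "V \<subseteq> W \<Longrightarrow> triples V \<subseteq> triples W"
  by (auto simp: triples_def)

lemma triplesD: "e \<in> triples V \<Longrightarrow> finite e" "e \<in> triples V \<Longrightarrow> e \<noteq> {}"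
  "e \<in> triples V \<Longrightarrow> e \<subseteq> V" "e \<in> triples V \<Longrightarrow> card e = 3"
  by (auto simp: triples_def intro: card_ge_0_finite)

lemma card_star:
  assumes "finite V" "S \<subseteq> V"
  shows "card (star V S) = cov (card V) (card S)"
proof -
  have "star V S = triples V - triples (V - S)"
    by (auto simp: star_def triples_def)
  moreover have "triples (V - S) \<subseteq> triples V" by (auto simp: triples_def)
  ultimately show ?thesis
    using assms by (simp add: card_Diff_subset card_triples cov_def finite_subset card_Diff_subset[of S V])
qed

lemma is_matching_mono: "is_matching E M \<Longrightarrow> E \<subseteq> E' \<Longrightarrow> is_matching E' M"
  by (auto simp: is_matching_def)

lemma is_matching_subset: "is_matching E M \<Longrightarrow> N \<subseteq> M \<Longrightarrow> is_matching E N"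
  unfolding is_matching_def by (meson subset_iff)

lemma is_matching_Un:
  assumes "is_matching E M" "is_matching E N" "\<Union>M \<inter> \<Union>N = {}"
  shows "is_matching E (M \<union> N)"
proof -
  have "e \<inter> f = {}" if "e \<in> M" "f \<in> N" for e f
    using assms(3) that by blast
  then show ?thesis using assms(1,2) by (simp add: is_matching_def ball_Un) (metis Int_commute)
qed

lemma card_Un_matching:
  assumes "finite M" "finite N" "\<Union>M \<inter> \<Union>N = {}" "{} \<notin> M"
  shows "card (M \<union> N) = card M + card N"
proof (rule card_Un_disjoint)
  show "M \<inter> N = {}"
  proof (rule ccontr)
    assume "M \<inter> N \<noteq> {}"
    then obtain e where "e \<in> M" "e \<in> N" by blast
    moreover from this have "e \<noteq> {}" using assms(4) by metis
    ultimately show False using assms(3) by blast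
  qed
qed (use assms in auto)

lemma card_Union_matching:
  assumes "is_matching E M" "E \<subseteq> triples V" "finite V"
  shows "card (\<Union>M) = 3 * card M" "finite M" "\<Union>M \<subseteq> V" "{} \<notin> M"
proof -
  have M: "M \<subseteq> triples V" using assms by (auto simp: is_matching_def)
  then show f: "finite M" using assms(3) finite_subset finite_triples by blast
  have "card (\<Union>M) = (\<Sum>e\<in>M. card e)"
  proof (rule card_Union_disjoint)
    show "pairwise disjnt M" using assms(1) by (auto simp: is_matching_def pairwise_def disjnt_def)
  qed (use M triplesD in auto)
  also have "\<dots> = (\<Sum>e\<in>M. 3)" using M by (intro sum.cong) (auto simp: triples_def)
  finally show "card (\<Union>M) = 3 * card M" by simp
  show "\<Union>M \<subseteq> V" using M by (auto simp: triples_def)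
  show "{} \<notin> M" using M triplesD(2) by blast
qed

lemma nu_leD: "nu_le E s \<Longrightarrow> is_matching E M \<Longrightarrow> card M \<le> s"
  by (auto simp: nu_le_def)

lemma not_nu_le:
  assumes "\<not> nu_le E s"
  obtains M where "is_matching E M" "card M = Suc s" "finite M"
proof -
  obtain M where M: "is_matching E M" "Suc s \<le> card M" using assms by (auto simp: nu_le_def)
  then obtain N where "N \<subseteq> M" "card N = Suc s" by (meson obtain_subset_with_card_n)
  then show ?thesis using that is_matching_subset[OF M(1)] by (metis card.infinite nat.distinct(1))
qed

lemma complete_matching:
  assumes "finite A" "card A = 3 * k"
  shows "\<exists>M. is_matching (triples A) M \<and> card M = k \<and> finite M"
  using assms
proof (induction k arbitrary: A)
  case 0
  then show ?case by (intro exI[of _ "{}"]) (auto simp: is_matching_def)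
next
  case (Suc k)
  have "3 \<le> card A" using Suc.prems by simp
  then obtain e where e: "e \<subseteq> A" "card e = 3" by (meson obtain_subset_with_card_n)
  then have "card (A - e) = 3 * k" using Suc.prems
    by (simp add: card_Diff_subset finite_subset)
  then obtain M where M: "is_matching (triples (A - e)) M" "card M = k" "finite M"
    using Suc.IH[of "A - e"] Suc.prems by auto
  have eM: "e \<inter> \<Union>M = {}" using M(1) by (fastforce simp: is_matching_def triples_def)
  have ne: "e \<noteq> {}" using e by auto
  have "is_matching (triples A) ({e} \<union> M)"
  proof (rule is_matching_Un)
    show "is_matching (triples A) M" using M(1) by (rule is_matching_mono) (auto simp: triples_def)
  qed (use e eM in \<open>auto simp: is_matching_def triples_def\<close>)
  moreover have "card ({e} \<union> M) = Suc k"
    using card_Un_matching[of "{e}" M] eM ne M by auto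
  ultimately show ?case using M(3) by (metis finite.emptyI finite_insert insert_is_Un)
qed

lemma star_matching:
  assumes "finite S" "finite Y" "S \<inter> Y = {}" "2 * card S \<le> card Y"
  shows "\<exists>M. is_matching (star (S \<union> Y) S) M \<and> card M = card S \<and> finite M"
  using assms
proof (induction S arbitrary: Y rule: finite_induct)
  case empty
  then show ?case by (intro exI[of _ "{}"]) (auto simp: is_matching_def)
next
  case (insert x S)
  have "2 \<le> card Y" using insert by simp
  then obtain p where p: "p \<subseteq> Y" "card p = 2" by (meson obtain_subset_with_card_n)
  have fp: "finite p" using p insert.prems finite_subset by blast
  have "card (Y - p) = card Y - 2" using p fp by (simp add: card_Diff_subset)
  then have "2 * card S \<le> card (Y - p)" using insert.prems insert.hyps by simp
  then obtain M where M: "is_matching (star (S \<union> (Y - p)) S) M" "card M = card S" "finite M"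
    using insert.IH[of "Y - p"] insert.prems insert.hyps by blast
  let ?e = "insert x p"
  have e3: "card ?e = 3" using p fp insert.prems by (auto simp: card_insert_if)
  have eM: "?e \<inter> \<Union>M = {}" using M(1) insert.hyps insert.prems p
    by (fastforce simp: is_matching_def triples_def star_def)
  have "is_matching (star (insert x S \<union> Y) (insert x S)) ({?e} \<union> M)"
  proof (rule is_matching_Un)
    show "is_matching (star (insert x S \<union> Y) (insert x S)) M"
      using M(1) by (rule is_matching_mono) (auto simp: triples_def star_def)
  qed (use p e3 eM in \<open>auto simp: is_matching_def triples_def star_def\<close>)
  moreover have "card ({?e} \<union> M) = Suc (card S)"
    using card_Un_matching[of "{?e}" M] eM M by auto
  ultimately show ?case using M(3) insert.hyps
    by (metis card_insert_disjoint finite.emptyI finite_insert insert_is_Un)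
qed

section \<open>Degrees and counting for the sparse range\<close>

lemma cov_step:
  assumes "s \<le> m"
  shows "cov (Suc m) (Suc s) = (m choose 2) + cov m s"
proof -
  have "(m - s choose 3) \<le> (m choose 3)" by (intro binomial_right_mono) simp
  then show ?thesis using assms
    by (simp add: cov_def numeral_3_eq_3 numeral_2_eq_2)
qed

text \<open>The left side counts only the triples with exactly one vertex in a fixed
  \<open>s\<close>-set.\<close>

lemma cov_ge: "s \<le> n \<Longrightarrow> s * ((n - s) choose 2) \<le> cov n s"
proof (induction s arbitrary: n)
  case (Suc s)
  then obtain m where m: "n = Suc m" by (cases n) auto
  have "s * ((m - s) choose 2) \<le> cov m s" using Suc m by auto
  moreover have "((m - s) choose 2) \<le> (m choose 2)" by (intro binomial_right_mono) simp
  ultimately show ?case using Suc.prems m by (simp add: cov_step)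
qed simp

lemma card_edges_two:
  assumes "finite V" "a \<noteq> v"
  shows "card {e \<in> triples V. a \<in> e \<and> v \<in> e} \<le> card V"
proof -
  have "{e \<in> triples V. a \<in> e \<and> v \<in> e} \<subseteq> (\<lambda>x. {a, v, x}) ` V"
  proof
    fix e assume "e \<in> {e \<in> triples V. a \<in> e \<and> v \<in> e}"
    then have e: "e \<subseteq> V" "card e = 3" "a \<in> e" "v \<in> e" "finite e"
      using assms by (auto simp: triples_def intro: finite_subset)
    then have "card (e - {a, v}) = 1" using assms by (simp add: card_Diff_subset)
    then obtain x where "e - {a, v} = {x}" by (rule card_1_singletonE)
    then have "e = {a, v, x}" "x \<in> V" using e by auto
    then show "e \<in> (\<lambda>x. {a, v, x}) ` V" by blast
  qed
  then show ?thesis using assms by (meson card_image_le card_mono finite_imageI le_trans)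
qed

text \<open>Exchanging \<open>v\<close> for \<open>a\<close> in the edges that lack \<open>a\<close>
  is injective, and by stability the results are edges.\<close>

lemma degree_min:
  assumes "finite E" "stable V E" "a \<in> V" "a \<le> v"
  shows "card {e \<in> E. v \<in> e} \<le> card {e \<in> E. a \<in> e}"
proof (cases "a = v")
  case False
  let ?f = "\<lambda>e. if a \<in> e then e else insert a (e - {v})"
  show ?thesis
  proof (rule card_inj_on_le[of ?f])
    show "inj_on ?f {e \<in> E. v \<in> e}"
      using False by (auto simp: inj_on_def set_eq_iff split: if_splits)
    show "?f ` {e \<in> E. v \<in> e} \<subseteq> {e \<in> E. a \<in> e}"
      using assms False by (auto simp: stable_def)
  qed (use assms in auto)
qed auto

lemma card_meeting_le:
  assumes "finite U" "finite E" "\<And>v. v \<in> U \<Longrightarrow> card {e \<in> E. v \<in> e} \<le> d"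
  shows "card {e \<in> E. e \<inter> U \<noteq> {}} \<le> card U * d"
proof -
  have "{e \<in> E. e \<inter> U \<noteq> {}} = (\<Union>v\<in>U. {e \<in> E. v \<in> e})" by auto
  also have "card \<dots> \<le> (\<Sum>v\<in>U. card {e \<in> E. v \<in> e})" by (rule card_UN_le) fact
  also have "\<dots> \<le> (\<Sum>v\<in>U. d)" by (intro sum_mono assms)
  finally show ?thesis by simp
qed

lemma two_times_choose_two: "2 * (m choose 2) = m * (m - 1)"
proof -
  have "even (m * (m - 1))" by (cases "even m") auto
  then show ?thesis by (simp add: choose_two)
qed

text \<open>The left side is the edge bound that arises in \<open>erdos_sparse\<close>. By
  \<open>cov_ge\<close> it is enough that 18 k n < (n - k)(n - k - 1); for n >= 30 k the left side
  is at most 0.6 n^2, the right side about 0.93 n^2 or more.\<close>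

lemma sparse_numeric:
  assumes "30 * k \<le> n" "1 \<le> k"
  shows "3 * k * (3 * k * n) < cov n k"
proof -
  \<comment> \<open>Writing n = 30 k + r with r >= 0 gives a polynomial in which the quadratic terms
    dominate the two negative linear ones.\<close>
  obtain r where r: "n = 30 * k + r" using assms le_Suc_ex by blast
  define x where "x = real k"
  define z where "z = real r"
  have xz: "x \<ge> 1" "z \<ge> 0" using assms by (auto simp: x_def z_def)
  have a: "real (n - k) = 29 * x + z" "real (n - k - 1) = 29 * x + z - 1"
    using r assms by (auto simp: x_def z_def)
  have "(29 * x + z) * (29 * x + z - 1) - 18 * (x * (30 * x + z))
      = 301 * (x * x) - 29 * x + 40 * (x * z) + z * z - z"
    by (simp add: algebra_simps)
  moreover have "x * x \<ge> x" "x * z \<ge> z" "z * z \<ge> 0"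
    using xz by (auto simp: mult_le_cancel_right1)
  ultimately have "18 * (x * (30 * x + z)) < (29 * x + z) * (29 * x + z - 1)"
    using xz by linarith
  then have "real (18 * (k * n)) < real ((n - k) * (n - k - 1))"
    unfolding of_nat_mult a using r by (simp add: x_def z_def)
  then have "18 * (k * n) < (n - k) * (n - k - 1)" by linarith
  moreover have "2 * ((n - k) choose 2) = (n - k) * (n - k - 1)"
    by (rule two_times_choose_two)
  ultimately have "9 * (k * n) < (n - k) choose 2" by linarith
  then have "k * (9 * (k * n)) < k * ((n - k) choose 2)" using assms by simp
  also have "\<dots> \<le> cov n k" using assms by (intro cov_ge) simp
  finally show ?thesis by (simp add: mult.left_commute mult.assoc)
qed

lemma stable_restrict:
  "stable V E \<Longrightarrow> V' \<subseteq> V \<Longrightarrow> (\<And>v. v \<in> V' \<Longrightarrow> v \<notin> D) \<Longrightarrow> stable V' {e \<in> E. e \<inter> D = {}}"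
  unfolding stable_def by fastforce

text \<open>If the edges avoiding the least vertex \<open>a\<close> still contain a matching of size \<open>s\<close>, every edge
  meets its \<open>3 s\<close> vertices, so the degree of \<open>a\<close>, hence by stability every degree, is at most \<open>3 s n\<close>,
  and there are at most \<open>9 s\<^sup>2 n\<close> edges.\<close>

lemma erdos_sparse:
  assumes "stable {a..<a+n} E" "E \<subseteq> triples {a..<a+n}" "nu_le E s" "30 * s \<le> n"
  shows "card E \<le> cov n s \<and> (card E = cov n s \<longrightarrow> E = star {a..<a+n} {a..<a+s})"
  using assms
proof (induction s arbitrary: a n E)
  case 0
  have "E = {}"
  proof (rule ccontr)
    assume "E \<noteq> {}"
    then obtain e where "e \<in> E" by auto
    then have "is_matching E {e}" by (auto simp: is_matching_def)
    then show False using 0 nu_leD by fastforce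
  qed
  then show ?case by (auto simp: cov_def star_def)
next
  case (Suc s)
  then obtain m where n: "n = Suc m" by (cases n) auto
  \<comment> \<open>The interval has an arbitrary left end so that deleting the least vertex leaves
    an instance of the same form.\<close>
  define V where "V = {a..<a+n}"
  have V: "V = insert a {Suc a..<Suc a + m}" by (auto simp: V_def n)
  have fV: "finite V" "card V = n" by (auto simp: V_def)
  note ES = Suc.prems[folded V_def]
  have fE: "finite E" using ES(2) fV(1) finite_subset finite_triples by blast
  define E0 where "E0 = {e \<in> E. e \<inter> {a} = {}}"
  define E1 where "E1 = {e \<in> E. a \<in> e}"
  have E01: "E = E1 \<union> E0" "E1 \<inter> E0 = {}" by (auto simp: E0_def E1_def)
  have cE: "card E = card E1 + card E0" using E01 fE by (metis card_Un_disjoint finite_Un)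
  have st0: "stable {Suc a..<Suc a + m} E0" unfolding E0_def
    using ES(1) by (rule stable_restrict) (auto simp: V)
  have E0V: "E0 \<subseteq> triples {Suc a..<Suc a + m}"
    using ES(2) V by (auto simp: E0_def triples_def)
  show ?case
  proof (cases "nu_le E0 s")
    case True
    \<comment> \<open>The edges through \<open>a\<close> lie in a full star, the others fall under
      the induction hypothesis. \<open>cov_step\<close> adds the two bounds exactly, so equality in
      the sum forces equality in both.\<close>
    have IH: "card E0 \<le> cov m s \<and> (card E0 = cov m s \<longrightarrow> E0 = star {Suc a..<Suc a + m} {Suc a..<Suc a + s})"
      using Suc.IH[OF st0 E0V True] Suc.prems(4) n by auto
    have "E1 \<subseteq> star V {a}" using ES(2) by (auto simp: E1_def star_def)
    moreover have cs: "card (star V {a}) = m choose 2"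
      using cov_step[of 0 m] V fV n by (simp add: card_star cov_def[of _ 0])
    moreover have "finite (star V {a})" using fV by (simp add: star_def)
    ultimately have c1: "card E1 \<le> m choose 2" "card E1 = m choose 2 \<longrightarrow> E1 = star V {a}"
      by (metis card_mono, metis card_subset_eq)
    have sm: "s \<le> m" using Suc.prems n by simp
    have "E = star V {a..<a + Suc s}" if "card E = cov n (Suc s)"
    proof -
      have "card E1 = m choose 2" "card E0 = cov m s" using that c1 IH cE cov_step[OF sm] n by auto
      then have "E = star V {a} \<union> star {Suc a..<Suc a + m} {Suc a..<Suc a + s}"
        using c1 IH E01 by simp
      also have "\<dots> = star V {a..<a + Suc s}"
      proof -
        have "{a..<a + Suc s} = insert a {Suc a..<Suc a + s}" by auto
        then show ?thesis by (auto simp: V star_def triples_def)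
      qed
      finally show ?thesis .
    qed
    then show ?thesis using c1 IH cE cov_step[OF sm] n V_def by auto
  next
    case False
    then obtain M where M: "is_matching E0 M" "card M = Suc s" "finite M" by (rule not_nu_le)
    have ME: "is_matching E M" using M(1) by (rule is_matching_mono) (auto simp: E0_def)
    note U = card_Union_matching[OF ME ES(2) fV(1)]
    have fU: "finite (\<Union>M)" by (rule finite_subset[OF U(3) fV(1)])
    have aU: "a \<notin> \<Union>M" using M(1) by (auto simp: is_matching_def E0_def)
    have meet: "e \<inter> \<Union>M \<noteq> {}" if "e \<in> E" for e
    proof
      assume d: "e \<inter> \<Union>M = {}"
      have "is_matching E ({e} \<union> M)"
        using that d ME by (intro is_matching_Un) (auto simp: is_matching_def)
      moreover have "card ({e} \<union> M) = Suc (Suc s)"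
        using card_Un_matching[of "{e}" M] d M(2,3) that ES(2) triplesD(2) by fastforce
      ultimately show False using nu_leD[OF ES(3)] by fastforce
    qed
    have "E1 = {e \<in> E1. e \<inter> \<Union>M \<noteq> {}}" using meet by (auto simp: E1_def)
    also have "card \<dots> \<le> card (\<Union>M) * n"
    proof (rule card_meeting_le[OF fU])
      fix v assume "v \<in> \<Union>M"
      then have "a \<noteq> v" using aU by auto
      have "{e \<in> E1. v \<in> e} \<subseteq> {e \<in> triples V. a \<in> e \<and> v \<in> e}" using ES(2) by (auto simp: E1_def)
      then have "card {e \<in> E1. v \<in> e} \<le> card {e \<in> triples V. a \<in> e \<and> v \<in> e}"
        using fV by (intro card_mono) auto
      also have "\<dots> \<le> n" using card_edges_two[OF fV(1) \<open>a \<noteq> v\<close>] fV by simp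
      finally show "card {e \<in> E1. v \<in> e} \<le> n" .
    qed (use fE in \<open>auto simp: E1_def\<close>)
    finally have d1: "card E1 \<le> 3 * Suc s * n" using U(1) M(2) by simp
    have "E = {e \<in> E. e \<inter> \<Union>M \<noteq> {}}" using meet by auto
    also have "card \<dots> \<le> card (\<Union>M) * (3 * Suc s * n)"
    proof (rule card_meeting_le[OF fU fE])
      fix v assume "v \<in> \<Union>M"
      then have "v \<in> V" using U(3) by auto
      then have "a \<le> v" "a \<in> V" by (auto simp: V)
      then show "card {e \<in> E. v \<in> e} \<le> 3 * Suc s * n"
        using degree_min[OF fE ES(1), of a v] d1 unfolding E1_def by linarith
    qed
    finally have "card E \<le> 3 * Suc s * (3 * Suc s * n)" using U(1) M(2) by simp
    then show ?thesis using sparse_numeric[OF Suc.prems(4)] by simp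
  qed
qed

section \<open>Families close to the extremal ones\<close>

lemma stableD:
  "stable V E \<Longrightarrow> e \<in> E \<Longrightarrow> j \<in> e \<Longrightarrow> i \<in> V \<Longrightarrow> i \<notin> e \<Longrightarrow> i < j \<Longrightarrow> insert i (e - {j}) \<in> E"
  by (auto simp: stable_def)

text \<open>The working form of stability: one edge forces every triple below it. The coordinates
  need not be sorted, so any pairing of the vertices may be used.\<close>

lemma stable_dominated:
  assumes st: "stable {..<n} E" and E: "E \<subseteq> triples {..<n}"
  shows "\<lbrakk>{x, y, z} \<in> E; card {x, y, z} = 3; x' \<le> x; y' \<le> y; z' \<le> z; card {x', y', z'} = 3\<rbrakk> \<Longrightarrow> {x', y', z'} \<in> E"
proof (induction "x + y + z" arbitrary: x y z rule: less_induct)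
  case less
  have d: "x \<noteq> y" "x \<noteq> z" "y \<noteq> z" using less.prems(2) by (auto simp: card_insert_if split: if_splits)
  have d': "x' \<noteq> y'" "x' \<noteq> z'" "y' \<noteq> z'" using less.prems(6) by (auto simp: card_insert_if split: if_splits)
  have n: "x < n" "y < n" "z < n" using less.prems(1) E by (auto simp: triples_def)
  \<comment> \<open>Among the coordinates still to be lowered take the one with the least target. If
    that target were occupied by another coordinate, the latter would have to be lowered to an even
    smaller target.\<close>
  consider "x' = x" "y' = y" "z' = z" | "x' < x" "x' \<noteq> y" "x' \<noteq> z" | "y' < y" "y' \<noteq> x" "y' \<noteq> z" | "z' < z" "z' \<noteq> x" "z' \<noteq> y"
    using less.prems(3-5) d d' by (metis le_neq_implies_less less_le_not_le less_trans)
  then show ?case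
  proof cases
    case 2
    have "insert x' ({x, y, z} - {x}) \<in> E"
      using 2 n by (intro stableD[OF st less.prems(1)]) auto
    moreover have "{x, y, z} - {x} = {y, z}" using d by auto
    ultimately have "{x', y, z} \<in> E" by simp
    moreover have "card {x', y, z} = 3" using 2 d by simp
    ultimately show ?thesis using less.hyps[of x' y z] 2 less.prems by simp
  next
    case 3
    have "insert y' ({x, y, z} - {y}) \<in> E"
      using 3 n by (intro stableD[OF st less.prems(1)]) auto
    moreover have "insert y' ({x, y, z} - {y}) = {x, y', z}" using d by auto
    ultimately have "{x, y', z} \<in> E" by simp
    moreover have "card {x, y', z} = 3" using 3 d by simp
    ultimately show ?thesis using less.hyps[of x y' z] 3 less.prems by simp
  next
    case 4
    have "insert z' ({x, y, z} - {z}) \<in> E"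
      using 4 n by (intro stableD[OF st less.prems(1)]) auto
    moreover have "insert z' ({x, y, z} - {z}) = {x, y, z'}" using d by auto
    ultimately have "{x, y, z'} \<in> E" by simp
    moreover have "card {x, y, z'} = 3" using 4 d by simp
    ultimately show ?thesis using less.hyps[of x y z'] 4 less.prems by simp
  qed (use less.prems in simp)
qed

lemma card_3_sorted:
  fixes e :: "nat set"
  assumes "card e = 3"
  obtains u v x where "e = {u, v, x}" "u < v" "v < x"
proof -
  obtain a b c where abc: "e = {a, b, c}" "a \<noteq> b" "a \<noteq> c" "b \<noteq> c"
    using assms by (auto simp: card_3_iff)
  consider "a < b" "b < c" | "a < c" "c < b" | "b < a" "a < c" | "b < c" "c < a" | "c < a" "a < b" | "c < b" "b < a"
    using abc by linarith
  then show ?thesis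
    by cases (use abc that in \<open>simp_all add: insert_commute\<close>; metis insert_commute)+
qed

text \<open>Removing the first \<open>t\<close> vertices leaves an instance with parameters
  \<open>n - t\<close> and \<open>s - t\<close>. The covering bounds add up without loss, which lets
  \<open>near_star\<close> trace the equality case.\<close>

lemma card_star_split:
  assumes "E \<subseteq> triples {..<n}" "t \<le> s" "s \<le> n"
  shows "card E \<le> cov n t + card {e \<in> E. e \<inter> {..<t} = {}}"
    and "cov n t + cov (n - t) (s - t) = cov n s"
    and "card E = cov n t + card {e \<in> E. e \<inter> {..<t} = {}} \<Longrightarrow> star {..<n} {..<t} \<subseteq> E"
proof -
  have fE: "finite E" using assms finite_subset by (metis finite_lessThan finite_triples)
  let ?A = "{e \<in> E. e \<inter> {..<t} \<noteq> {}}" and ?B = "{e \<in> E. e \<inter> {..<t} = {}}"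
  have "E = ?A \<union> ?B" by auto
  then have c: "card E = card ?A + card ?B"
    using fE by (metis (no_types, lifting) card_Un_disjoint disjoint_iff finite_Un mem_Collect_eq)
  have sub: "?A \<subseteq> star {..<n} {..<t}" using assms by (auto simp: star_def)
  have cs: "card (star {..<n} {..<t}) = cov n t" using assms by (simp add: card_star)
  have fs: "finite (star {..<n} {..<t})" by (simp add: star_def)
  show "card E \<le> cov n t + card ?B" using c card_mono[OF fs sub] cs by simp
  have "(n - s choose 3) \<le> (n - t choose 3)" "(n - t choose 3) \<le> (n choose 3)"
    using assms by (auto intro!: binomial_right_mono)
  moreover have "n - t - (s - t) = n - s" using assms by auto
  ultimately show "cov n t + cov (n - t) (s - t) = cov n s" by (simp add: cov_def)
  assume "card E = cov n t + card ?B"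
  then have "?A = star {..<n} {..<t}" using c cs card_subset_eq[OF fs sub] by simp
  then show "star {..<n} {..<t} \<subseteq> E" by auto
qed

text \<open>The full stars at the vertices below \<open>t\<close> extend any matching of the remaining edges by \<open>t\<close>
  edges, which reduces the claim to the sparse case with parameter \<open>s - t\<close>.\<close>

lemma near_star:
  assumes st: "stable {..<n} E" and EV: "E \<subseteq> triples {..<n}" and nu: "nu_le E s"
    and ts: "t \<le> s" and mn: "m \<le> n" and m: "3 * s + 3 \<le> m" and sp: "30 * (s - t) \<le> n - t"
    and full: "\<And>i x y. \<lbrakk>i < t; x < m; y < m; card {i, x, y} = 3\<rbrakk> \<Longrightarrow> {i, x, y} \<in> E"
  shows "card E \<le> cov n s \<and> (card E = cov n s \<longrightarrow> E = star {..<n} {..<s})"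
proof -
  define F where "F = {e \<in> E. e \<inter> {..<t} = {}}"
  have FE: "F \<subseteq> E" by (auto simp: F_def)
  have FV: "F \<subseteq> triples {t..<t + (n - t)}"
  proof
    fix e assume "e \<in> F"
    then have "e \<subseteq> {..<n}" "card e = 3" "e \<inter> {..<t} = {}" using EV by (auto simp: F_def triples_def)
    moreover from this have "e \<subseteq> {t..<t + (n - t)}" by (force simp: disjoint_iff subset_iff)
    ultimately show "e \<in> triples {t..<t + (n - t)}" by (simp add: triples_def)
  qed
  have stF: "stable {t..<t + (n - t)} F" unfolding F_def
    by (rule stable_restrict[OF st]) auto
  have nuF: "nu_le F (s - t)"
  proof (rule ccontr)
    assume "\<not> nu_le F (s - t)"
    then obtain M where M: "is_matching F M" "card M = Suc (s - t)" "finite M" by (rule not_nu_le)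
    note U = card_Union_matching[OF M(1) FV]
    \<comment> \<open>\<open>M\<close> uses 3 (s - t + 1) vertices, so at least m - t - 3 (s - t +
      1) >= 2 t remain in \<open>Y\<close>: two for each vertex below \<open>t\<close>. This is
      where m >= 3 s + 3 enters.\<close>
    define Y where "Y = {t..<m} - \<Union>M"
    have "card {t..<m} - card (\<Union>M) \<le> card Y" unfolding Y_def
      using U(3) by (intro diff_card_le_card_Diff) (auto intro: finite_subset)
    then have "2 * card {..<t} \<le> card Y" using U(1) M(2) m ts by simp
    then obtain N where N: "is_matching (star ({..<t} \<union> Y) {..<t}) N" "card N = t" "finite N"
      using star_matching[of "{..<t}" Y] by (force simp: Y_def)
    have "star ({..<t} \<union> Y) {..<t} \<subseteq> E"
    proof
      fix e assume e: "e \<in> star ({..<t} \<union> Y) {..<t}"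
      then obtain u v x where uvx: "e = {u, v, x}" "u < v" "v < x"
        by (metis (no_types, lifting) card_3_sorted mem_Collect_eq star_def triplesD(4))
      have "{..<t} \<union> Y \<subseteq> {..<m}" using m ts by (auto simp: Y_def)
      then have "v < m" "x < m" using e uvx by (auto simp: star_def triples_def)
      moreover have "u < t" using e uvx by (auto simp: star_def)
      moreover have "card {u, v, x} = 3" using uvx by auto
      ultimately show "e \<in> E" using full uvx by blast
    qed
    then have N': "is_matching E N" using N(1) is_matching_mono by blast
    have "\<Union>N \<subseteq> {..<t} \<union> Y" using N(1) by (auto simp: is_matching_def star_def triples_def)
    moreover have "\<Union>M \<inter> ({..<t} \<union> Y) = {}" using U(3) by (auto simp: Y_def)
    ultimately have d: "\<Union>M \<inter> \<Union>N = {}" by blast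
    have "is_matching E (M \<union> N)" using is_matching_mono[OF M(1) FE] N' d by (rule is_matching_Un)
    moreover have "card (M \<union> N) = Suc (s - t) + t"
      using card_Un_matching[OF M(3) N(3) d] U(4) M(2) N(2) by simp
    ultimately show False using nu_leD[OF nu] ts by fastforce
  qed
  have sF: "card F \<le> cov (n - t) (s - t) \<and> (card F = cov (n - t) (s - t) \<longrightarrow> F = star {t..<t + (n - t)} {t..<t + (s - t)})"
    by (rule erdos_sparse[OF stF FV nuF sp])
  have sn: "s \<le> n" using m mn by simp
  note split = card_star_split[OF EV ts sn, folded F_def]
  show ?thesis
  proof (intro conjI impI)
    show "card E \<le> cov n s" using split(1,2) sF by linarith
    assume eq: "card E = cov n s"
    then have "card F = cov (n - t) (s - t)" "card E = cov n t + card F" using split(1,2) sF by linarith+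
    then have F: "F = star {t..<t + (n - t)} {t..<t + (s - t)}" and full: "star {..<n} {..<t} \<subseteq> E"
      using sF split(3) by auto
    have "E \<subseteq> star {..<n} {..<s}"
    proof
      fix e assume e: "e \<in> E"
      show "e \<in> star {..<n} {..<s}"
      proof (cases "e \<in> F")
        case True
        then show ?thesis using F e EV ts by (force simp: star_def)
      next
        case False
        then show ?thesis using e EV ts by (auto simp: star_def F_def)
      qed
    qed
    moreover have "card (star {..<n} {..<s}) = cov n s" using sn by (simp add: card_star)
    ultimately show "E = star {..<n} {..<s}"
      using eq by (intro card_subset_eq) (simp_all add: star_def)
  qed
qed

text \<open>Choose \<open>m\<close> such that the first \<open>m\<close>, but not the first \<open>m + 1\<close>, of the vertices \<open>3 s + 2, 3 s + 1, \<dots>\<close>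
  can be matched with disjoint pairs in \<open>{..<w}\<close>, and let \<open>U\<close> be the union of these pairs. Every edge leaving
  \<open>{..<3 s + 2}\<close> meets \<open>U\<close>, whereas \<open>m\<close> vertices below \<open>3 s + 2\<close> form no edge with a pair disjoint
  from \<open>U\<close>. So fewer edges are gained outside the clique than are lost inside.\<close>

lemma near_complete:
  assumes st: "stable {..<n} E" and EV: "E \<subseteq> triples {..<n}" and nu: "nu_le E s"
    and W: "triples {..<w} \<subseteq> E" and wd: "w + d = 3 * s + 2" and dw: "2 * d + 2 \<le> w"
    and sn: "3 * s + 2 \<le> n" and num: "2 * ((n - (3 * s + 2)) * n) < (w - 2 * d) choose 2"
  shows "card E \<le> cl s \<and> (card E = cl s \<longrightarrow> E = triples {..<3 * s + 2})"
proof -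
  define q where "q = 3 * s + 2"
  define R where "R = (\<lambda>m. \<exists>M U. is_matching E M \<and> finite M \<and> card M = m \<and>
    \<Union>M = U \<union> {Suc q - m..<Suc q} \<and> U \<subseteq> {..<w} \<and> card U = 2 * m)"
  have fE: "finite E" using EV finite_subset by (metis finite_lessThan finite_triples)
  have R0: "R 0" unfolding R_def by (intro exI[of _ "{}"]) (auto simp: is_matching_def)
  \<comment> \<open>After d + 1 such edges the complete part still has w - 2 (d + 1) = 3 (s - d)
    vertices, which hold s - d further disjoint edges: s + 1 in total.\<close>
  have nR: "\<not> R (Suc d)"
  proof
    assume "R (Suc d)"
    then obtain M U where M: "is_matching E M" "finite M" "card M = Suc d"
      and UM: "\<Union>M = U \<union> {Suc q - Suc d..<Suc q}" and U: "U \<subseteq> {..<w}" "card U = 2 * Suc d"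
      unfolding R_def by (elim exE conjE) (rule that)
    have "card ({..<w} - U) = 3 * (s - d)" using U wd dw
      by (simp add: card_Diff_subset finite_subset)
    then obtain N where N: "is_matching (triples ({..<w} - U)) N" "card N = s - d" "finite N"
      using complete_matching[of "{..<w} - U"] by auto
    have N': "is_matching E N" using N(1) W triples_mono[of "{..<w} - U" "{..<w}"] is_matching_mono by blast
    have "\<Union>N \<subseteq> {..<w} - U" using N(1) by (auto simp: is_matching_def triples_def)
    then have d: "\<Union>M \<inter> \<Union>N = {}" using UM wd by (auto simp: q_def)
    have "is_matching E (M \<union> N)" using M(1) N' d by (rule is_matching_Un)
    moreover have "{} \<notin> M" using M(1) EV triplesD(2) by (auto simp: is_matching_def)
    then have "card (M \<union> N) = Suc d + (s - d)"
      using card_Un_matching[OF M(2) N(3) d] M(3) N(2) by simp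
    ultimately show False using nu_leD[OF nu] wd dw by fastforce
  qed
  obtain m where m: "R m" "\<not> R (Suc m)" "m \<le> d"
  proof -
    have "\<exists>m\<le>d. R m \<and> \<not> R (Suc m)"
    proof (rule ccontr)
      assume "\<not> ?thesis"
      then have "R k" if "k \<le> Suc d" for k using that by (induction k) (use R0 in auto)
      then show False using nR by blast
    qed
    then show ?thesis using that by blast
  qed
  obtain M U where M: "is_matching E M" "finite M" "card M = m"
      and UM: "\<Union>M = U \<union> {Suc q - m..<Suc q}" and U: "U \<subseteq> {..<w}" "card U = 2 * m"
    using m(1) unfolding R_def by (elim exE conjE) (rule that)
  have fU: "finite U" using U finite_subset by blast
  have wq: "w \<le> q - m" "w \<le> q" using m wd by (auto simp: q_def)
  have no: "insert (q - m) p \<notin> E" if p: "p \<subseteq> {..<w} - U" "card p = 2" for p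
  proof
    assume e: "insert (q - m) p \<in> E"
    let ?e = "insert (q - m) p"
    have d: "\<Union>{?e} \<inter> \<Union>M = {}" using UM p U(1) wq by (auto dest: subsetD)
    have fp: "finite p" using p card_ge_0_finite by force
    have "is_matching E ({?e} \<union> M)" using e M d by (intro is_matching_Un) (auto simp: is_matching_def)
    moreover have "card ({?e} \<union> M) = Suc m" using card_Un_matching[OF _ M(2) d] M(3) by simp
    moreover have "\<Union>({?e} \<union> M) = (U \<union> p) \<union> {Suc q - Suc m..<Suc q}"
    proof -
      have "{Suc q - Suc m..<Suc q} = insert (q - m) {Suc q - m..<Suc q}" using m(3) wd dw by (auto simp: q_def)
      then show ?thesis using UM by auto
    qed
    moreover have "card (U \<union> p) = 2 * Suc m"
      using p U fU fp by (subst card_Un_disjoint) auto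
    moreover have "U \<union> p \<subseteq> {..<w}" using U p by auto
    ultimately have "R (Suc m)" unfolding R_def using M(2) by (metis finite.emptyI finite_insert finite_Un)
    then show False using m by blast
  qed
  have no': "insert r p \<notin> E" if p: "p \<subseteq> {..<w} - U" "card p = 2" and r: "q - m \<le> r" for p r
  proof (cases "r = q - m")
    case False
    show ?thesis
    proof
      assume e: "insert r p \<in> E"
      then have "r < n" using EV by (auto simp: triples_def)
      have "r \<notin> p" "q - m \<notin> insert r p" using p wq r False by auto
      then have "insert (q - m) (insert r p - {r}) \<in> E"
        using stableD[OF st e, of r "q - m"] r False \<open>r < n\<close> by auto
      then show False using no[OF p] \<open>r \<notin> p\<close> by simp
    qed
  qed (use no p in blast)
  have WU: "card ({..<w} - U) = w - 2 * m" using U fU by (simp add: card_Diff_subset)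
  define G where "G = {e \<in> E. \<not> e \<subseteq> {..<q}}"
  have GU: "e \<inter> U \<noteq> {}" if "e \<in> G" for e
  proof
    assume eU: "e \<inter> U = {}"
    have e: "e \<in> E" "\<not> e \<subseteq> {..<q}" "e \<subseteq> {..<n}" using that EV by (auto simp: G_def triples_def)
    obtain u v x where uvx: "e = {u, v, x}" "u < v" "v < x"
      using e EV card_3_sorted by (metis subsetD triplesD(4))
    have x: "q \<le> x" using e uvx by auto
    \<comment> \<open>The two smaller vertices of the edge are lowered into
      \<open>{..<w} - U\<close>. A vertex below \<open>w\<close> is already there, since the edge
      avoids \<open>U\<close>; a vertex from \<open>w\<close> on lies above every element of that
      set. The result contradicts \<open>no'\<close>.\<close>
    have c2: "2 \<le> card ({..<w} - U)" using WU m(3) dw by simp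
    then have "{..<w} - U \<noteq> {}" by (metis card.empty not_numeral_le_zero)
    then obtain u' where u': "u' \<in> {..<w} - U" "u' \<le> u" "u < w \<Longrightarrow> u' = u"
      using uvx eU by (cases "u < w") force+
    have "1 \<le> card ({..<w} - U - {u'})" using c2 u'(1) by simp
    then have "{..<w} - U - {u'} \<noteq> {}" by (metis card.empty not_one_le_zero)
    then obtain v' where v': "v' \<in> {..<w} - U" "v' \<noteq> u'" "v' \<le> v"
      using uvx eU u'(3) by (cases "v < w") force+
    have "u' \<noteq> x" "v' \<noteq> x" using u'(1) v'(1) x wq by auto
    then have "card {u', v', x} = 3" using v'(2) by auto
    then have "{u', v', x} \<in> E"
      using stable_dominated[OF st EV, of u v x u' v' x] u'(2) v'(3) e(1) uvx by auto
    moreover have "insert x {u', v'} \<notin> E" using u'(1) v'(1,2) x by (intro no') auto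
    ultimately show False by (simp add: insert_commute)
  qed
  have "G \<subseteq> (\<Union>u\<in>U. \<Union>x\<in>{q..<n}. {e \<in> triples {..<n}. u \<in> e \<and> x \<in> e})"
  proof
    fix e assume e: "e \<in> G"
    then obtain x where "x \<in> e" "q \<le> x" by (force simp: G_def)
    moreover have "e \<in> triples {..<n}" using e EV by (auto simp: G_def)
    moreover from this have "x < n" using \<open>x \<in> e\<close> by (auto simp: triples_def)
    ultimately show "e \<in> (\<Union>u\<in>U. \<Union>x\<in>{q..<n}. {e \<in> triples {..<n}. u \<in> e \<and> x \<in> e})"
      using GU[OF e] by auto
  qed
  then have "card G \<le> card (\<Union>u\<in>U. \<Union>x\<in>{q..<n}. {e \<in> triples {..<n}. u \<in> e \<and> x \<in> e})"
    by (intro card_mono) (use fU in auto)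
  also have "\<dots> \<le> (\<Sum>u\<in>U. card (\<Union>x\<in>{q..<n}. {e \<in> triples {..<n}. u \<in> e \<and> x \<in> e}))"
    using fU by (rule card_UN_le)
  also have "\<dots> \<le> (\<Sum>u\<in>U. \<Sum>x\<in>{q..<n}. card {e \<in> triples {..<n}. u \<in> e \<and> x \<in> e})"
    by (intro sum_mono card_UN_le) simp
  also have "\<dots> \<le> (\<Sum>u\<in>U. \<Sum>x\<in>{q..<n}. n)"
  proof (intro sum_mono)
    fix u x assume "u \<in> U" "x \<in> {q..<n}"
    then have "u \<noteq> x" using U(1) wq by auto
    then show "card {e \<in> triples {..<n}. u \<in> e \<and> x \<in> e} \<le> n"
      using card_edges_two[of "{..<n}" u x] by simp
  qed
  also have "\<dots> = 2 * m * ((n - q) * n)" using U by simp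
  finally have cG: "card G \<le> 2 * m * ((n - q) * n)" .
  have "E = (E - G) \<union> G" by (auto simp: G_def)
  then have cE: "card E = card (E - G) + card G" using fE
    by (metis Diff_disjoint card_Un_disjoint finite_Un inf_commute)
  define X where "X = (\<lambda>(p, r). insert r p) ` ({p. p \<subseteq> {..<w} - U \<and> card p = 2} \<times> {q - m..<q})"
  have inj: "inj_on (\<lambda>(p, r). insert r p) ({p. p \<subseteq> {..<w} - U \<and> card p = 2} \<times> {q - m..<q})"
  proof (rule inj_onI, clarsimp)
    fix p r p' r'
    assume a: "insert r p = insert r' p'" "p \<subseteq> {..<w} - U" "p' \<subseteq> {..<w} - U" "q - m \<le> r" "q - m \<le> r'"
    have "r \<notin> p'" "r' \<notin> p" "r \<notin> p" "r' \<notin> p'" using a wq by auto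
    then show "p = p' \<and> r = r'" using a(1) by (metis insert_ident insert_iff)
  qed
  have "card X = card {p. p \<subseteq> {..<w} - U \<and> card p = 2} * card {q - m..<q}"
    unfolding X_def using card_image[OF inj] by (simp add: card_cartesian_product)
  also have "\<dots> = ((w - 2 * m) choose 2) * m"
    using WU m(3) wd dw by (simp add: n_subsets q_def)
  finally have cX: "card X = ((w - 2 * m) choose 2) * m" .
  have XE: "X \<inter> E = {}" unfolding X_def using no' by auto
  have Xq: "X \<subseteq> triples {..<q}"
  proof
    fix e assume "e \<in> X"
    then obtain p r where e: "e = insert r p" "p \<subseteq> {..<w} - U" "card p = 2" "q - m \<le> r" "r < q"
      by (auto simp: X_def)
    have "r \<notin> p" using e wq by auto
    moreover have "finite p" using e(3) card_ge_0_finite by force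
    ultimately have "card e = 3" using e by simp
    moreover have "e \<subseteq> {..<q}" using e wq by auto
    ultimately show "e \<in> triples {..<q}" by (simp add: triples_def)
  qed
  have EG: "E - G \<subseteq> triples {..<q}" using EV by (auto simp: G_def triples_def)
  have "card (E - G) + card X = card ((E - G) \<union> X)"
    using XE fE Xq by (intro card_Un_disjoint[symmetric]) (auto intro: finite_subset)
  also have "\<dots> \<le> card (triples {..<q})" using EG Xq by (intro card_mono) auto
  finally have tot: "card (E - G) + card X \<le> cl s" by (simp add: card_triples cl_def q_def)
  show ?thesis
  proof (cases "m = 0")
    case True
    then have "G = {}" using cG fE by (simp add: G_def)
    then have "E \<subseteq> triples {..<q}" using EG by simp
    moreover have "card (triples {..<q}) = cl s" by (simp add: card_triples cl_def q_def)
    ultimately show ?thesis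
      using card_mono[of "triples {..<q}" E] card_subset_eq[of "triples {..<q}" E] by (auto simp: q_def)
  next
    case False
    have "(w - 2 * d choose 2) \<le> (w - 2 * m choose 2)" using m(3) by (intro binomial_right_mono) simp
    then have "2 * ((n - q) * n) < (w - 2 * m choose 2)" using num by (simp add: q_def)
    then have "(2 * ((n - q) * n)) * m < (w - 2 * m choose 2) * m" using False by simp
    moreover have "card G \<le> (2 * ((n - q) * n)) * m" using cG by (simp add: mult.commute mult.left_commute)
    ultimately have "card G < card X" unfolding cX by linarith
    then show ?thesis using tot cE by linarith
  qed
qed

section \<open>Shifting\<close>

text \<open>The Erdos-Ko-Rado compression of one edge. An edge stays in place when its target is
  already present, so no two edges are merged.\<close>

definition move :: "nat \<Rightarrow> nat \<Rightarrow> nat set set \<Rightarrow> nat set \<Rightarrow> nat set" where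
  "move i j E e = (if j \<in> e \<and> i \<notin> e \<and> insert i (e - {j}) \<notin> E then insert i (e - {j}) else e)"

definition shift :: "nat \<Rightarrow> nat \<Rightarrow> nat set set \<Rightarrow> nat set set" where
  "shift i j E = move i j E ` E"

text \<open>A moved edge lands outside \<open>E\<close> while an unmoved one stays inside, and a
  move can be undone by exchanging \<open>i\<close> and \<open>j\<close> again.\<close>

lemma inj_on_move:
  assumes "i \<noteq> j"
  shows "inj_on (move i j E) E"
proof (rule inj_onI)
  fix e f assume ef: "e \<in> E" "f \<in> E" "move i j E e = move i j E f"
  have undo: "insert j (insert i (g - {j}) - {i}) = g" if "j \<in> g" "i \<notin> g" for g
    using that assms by auto
  have mv: "move i j E g = g \<or> (move i j E g = insert i (g - {j}) \<and> j \<in> g \<and> i \<notin> g \<and> insert i (g - {j}) \<notin> E)" for g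
    by (simp add: move_def)
  show "e = f"
  proof (cases "move i j E e = e \<and> move i j E f = f")
    case False
    have "e = f" if "move i j E a \<noteq> a" "a = e \<and> b = f \<or> a = f \<and> b = e" for a b
    proof -
      have a: "move i j E a = insert i (a - {j})" "j \<in> a" "i \<notin> a" "insert i (a - {j}) \<notin> E"
        using mv[of a] that(1) by auto
      have "move i j E b = insert i (a - {j})" "b \<in> E" using that(2) ef a(1) by auto
      then have "move i j E b \<noteq> b" using a(4) by metis
      then have b: "move i j E b = insert i (b - {j})" "j \<in> b" "i \<notin> b" using mv[of b] by auto
      have "a = b" using undo[of a] undo[of b] a b \<open>move i j E b = insert i (a - {j})\<close> by metis
      then show ?thesis using that(2) by auto
    qed
    then show ?thesis using False by blast
  qed (use ef in metis)
qed

lemma card_shift: "i \<noteq> j \<Longrightarrow> card (shift i j E) = card E"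
  unfolding shift_def by (intro card_image inj_on_move)

text \<open>With the next two criteria: shifting acts separately on each pair
  \<open>insert i f\<close>, \<open>insert j f\<close>, keeps the number of members of the pair, and
  prefers the one with \<open>i\<close>.\<close>

lemma mem_shift_neutral:
  assumes "i \<noteq> j" "i \<in> e \<longleftrightarrow> j \<in> e"
  shows "e \<in> shift i j E \<longleftrightarrow> e \<in> E"
  using assms unfolding shift_def move_def image_iff by (auto split: if_splits)

lemma mem_shift_low:
  assumes "i \<noteq> j" "i \<in> e" "j \<notin> e"
  shows "e \<in> shift i j E \<longleftrightarrow> e \<in> E \<or> insert j (e - {i}) \<in> E"
proof
  assume "e \<in> shift i j E"
  then obtain f where f: "f \<in> E" "e = move i j E f" by (auto simp: shift_def)
  show "e \<in> E \<or> insert j (e - {i}) \<in> E"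
  proof (cases "e = f")
    case False
    then have "e = insert i (f - {j})" "j \<in> f" "i \<notin> f" using f by (auto simp: move_def split: if_splits)
    then have "insert j (e - {i}) = f" using assms by auto
    then show ?thesis using f by simp
  qed (use f in simp)
next
  let ?f = "insert j (e - {i})"
  assume a: "e \<in> E \<or> ?f \<in> E"
  show "e \<in> shift i j E"
  proof (cases "e \<in> E")
    case True
    then have "move i j E e = e" using assms by (simp add: move_def)
    then show ?thesis using True unfolding shift_def by (metis imageI)
  next
    case False
    have "insert i (?f - {j}) = e" "i \<notin> ?f" "j \<in> ?f" using assms by auto
    then have "move i j E ?f = e" using False by (simp add: move_def)
    moreover have "?f \<in> E" using a False by simp
    ultimately show ?thesis unfolding shift_def by (metis imageI)
  qed
qed

lemma mem_shift_high:
  assumes "i \<noteq> j" "i \<notin> e" "j \<in> e"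
  shows "e \<in> shift i j E \<longleftrightarrow> e \<in> E \<and> insert i (e - {j}) \<in> E"
proof
  assume "e \<in> shift i j E"
  then obtain f where f: "f \<in> E" "e = move i j E f" by (auto simp: shift_def)
  then have "e = f" using assms by (auto simp: move_def split: if_splits)
  then show "e \<in> E \<and> insert i (e - {j}) \<in> E"
    using f assms by (auto simp: move_def split: if_splits)
next
  assume a: "e \<in> E \<and> insert i (e - {j}) \<in> E"
  then have "move i j E e = e" by (simp add: move_def)
  then show "e \<in> shift i j E" using a unfolding shift_def by (metis imageI)
qed

lemma card_swap_element:
  "j \<in> e \<Longrightarrow> i \<notin> e \<Longrightarrow> finite e \<Longrightarrow> card (insert i (e - {j})) = card e"
  by (metis DiffD1 card.remove card_insert_disjoint finite_Diff)

lemma shift_triples: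
  assumes "E \<subseteq> triples V" "i \<in> V"
  shows "shift i j E \<subseteq> triples V"
proof
  fix e assume "e \<in> shift i j E"
  then obtain f where f: "f \<in> E" "e = move i j E f" by (auto simp: shift_def)
  then have "f \<in> triples V" using assms by auto
  then show "e \<in> triples V" using f assms card_swap_element[of j f i] triplesD(1)[of f V]
    by (auto simp: move_def triples_def)
qed

text \<open>At most one edge \<open>e\<close> of a matching in the shifted family is missing from
  \<open>E\<close>, because it contains \<open>i\<close>. Replace \<open>i\<close> by
  \<open>j\<close> in it. If \<open>j\<close> is already used by another matching edge
  \<open>g\<close>, then \<open>g\<close> survived the shift because its version with
  \<open>i\<close> is in \<open>E\<close>, so the two edges can exchange \<open>i\<close> and
  \<open>j\<close>.\<close>

lemma nu_le_shift:
  assumes nu: "nu_le E s" and ij: "i \<noteq> j" and EV: "E \<subseteq> triples V" and V: "finite V" "i \<in> V"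
  shows "nu_le (shift i j E) s"
  unfolding nu_le_def
proof (intro allI impI)
  fix M assume M: "is_matching (shift i j E) M"
  note U = card_Union_matching[OF M shift_triples[OF EV V(2)] V(1)]
  have MD: "e \<inter> f = {}" if "e \<in> M" "f \<in> M" "e \<noteq> f" for e f
    using M that by (auto simp: is_matching_def)
  have Msh: "M \<subseteq> shift i j E" using M by (simp add: is_matching_def)
  show "card M \<le> s"
  proof (cases "M \<subseteq> E")
    case True
    then have "is_matching E M" using M by (simp add: is_matching_def)
    then show ?thesis using nu nu_leD by blast
  next
    case False
    then obtain e where e: "e \<in> M" "e \<notin> E" by auto
    have eh: "i \<in> e" "j \<notin> e"
      using e Msh mem_shift_neutral[OF ij, of e E] mem_shift_high[OF ij, of e E] by blast+
    define f where "f = insert j (e - {i})"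
    have fE: "f \<in> E" using e Msh mem_shift_low[OF ij eh] by (auto simp: f_def)
    have iM: "i \<notin> g" if "g \<in> M" "g \<noteq> e" for g using MD[of g e] that e eh by auto
    have ME: "M - {e} \<subseteq> E"
      using Msh iM mem_shift_neutral[OF ij, of _ E] mem_shift_high[OF ij, of _ E] by blast
    show ?thesis
    proof (cases "\<exists>g\<in>M. j \<in> g")
      case False
      have "is_matching E (insert f (M - {e}))" unfolding is_matching_def
      proof (intro conjI ballI impI)
        show "insert f (M - {e}) \<subseteq> E" using fE ME by auto
        fix g h assume gh: "g \<in> insert f (M - {e})" "h \<in> insert f (M - {e})" "g \<noteq> h"
        have "f \<inter> h = {}" if "h \<in> M - {e}" for h
          using MD[of e h] that e False by (auto simp: f_def)
        then show "g \<inter> h = {}" using gh MD by (metis Diff_iff Int_commute insert_iff)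
      qed
      moreover have "f \<notin> M" using False by (auto simp: f_def)
      then have "card (insert f (M - {e})) = card M" using U(2) e(1)
        by (metis card_swap_element)
      ultimately show ?thesis using nu nu_leD by metis
    next
      case True
      then obtain g where g: "g \<in> M" "j \<in> g" by auto
      have ge: "g \<noteq> e" using g eh by auto
      have ig: "i \<notin> g" using iM g ge by auto
      define g' where "g' = insert i (g - {j})"
      have g'E: "g' \<in> E" using mem_shift_high[OF ij ig g(2), of E] Msh g by (auto simp: g'_def)
      have eg: "e \<inter> g = {}" using MD e g ge by auto
      let ?N = "M - {e, g}"
      have dis: "h \<inter> f = {}" "h \<inter> g' = {}" if "h \<in> ?N" for h
      proof -
        have "h \<inter> e = {}" "h \<inter> g = {}" using MD[of h e] MD[of h g] that e g by auto
        moreover have "j \<notin> h" "i \<notin> h" using calculation g(2) eh(1) by auto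
        ultimately show "h \<inter> f = {}" "h \<inter> g' = {}" by (auto simp: f_def g'_def)
      qed
      have fg: "f \<inter> g' = {}" using eg ij eh ig by (auto simp: f_def g'_def)
      have "is_matching E (insert f (insert g' ?N))" unfolding is_matching_def
      proof (intro conjI ballI impI)
        show "insert f (insert g' ?N) \<subseteq> E" using fE g'E ME by auto
        fix x y assume xy: "x \<in> insert f (insert g' ?N)" "y \<in> insert f (insert g' ?N)" "x \<noteq> y"
        have "x \<inter> y = {}" if "x \<in> ?N" "y \<in> ?N" using MD that xy(3) by auto
        then show "x \<inter> y = {}" using xy dis fg by (auto simp del: Diff_iff)
      qed
      moreover have "card (insert f (insert g' ?N)) = card M"
      proof -
        have "f \<notin> ?N" "g' \<notin> ?N" using dis(1)[of f] dis(2)[of g'] by (auto simp: f_def g'_def)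
        moreover have "f \<noteq> g'" using fg by (auto simp: f_def)
        moreover have "card ?N = card M - 2" using U(2) e g ge by (simp add: card_Diff_subset)
        moreover have "card {e, g} \<le> card M" using U(2) e g by (intro card_mono) auto
        ultimately show ?thesis using U(2) ge by simp
      qed
      ultimately show ?thesis using nu nu_leD by metis
    qed
  qed
qed

lemma sum_move_less:
  fixes i j :: nat
  assumes "i < j" "j \<in> e" "i \<notin> e" "finite e"
  shows "\<Sum>(insert i (e - {j})) < \<Sum>e"
proof -
  have "\<Sum>e = j + \<Sum>(e - {j})" using assms by (simp add: sum.remove)
  moreover have "\<Sum>(insert i (e - {j})) = i + \<Sum>(e - {j})" using assms by simp
  ultimately show ?thesis using assms by simp
qed

text \<open>Each shift that changes the family lowers the sum of all vertices over all edges, so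
  repeated shifting reaches a stable family. The property is then pulled back through the shifts,
  which is how equality cases survive.\<close>

lemma shift_induct [consumes 3, case_names stable shift]:
  assumes V: "finite V" and E: "E \<subseteq> triples V" "nu_le E s"
    and st: "\<And>E. \<lbrakk>E \<subseteq> triples V; nu_le E s; stable V E\<rbrakk> \<Longrightarrow> Q E"
    and sh: "\<And>E i j. \<lbrakk>E \<subseteq> triples V; nu_le E s; i \<in> V; j \<in> V; i < j; Q (shift i j E)\<rbrakk> \<Longrightarrow> Q E"
  shows "Q E"
  using E
proof (induction "\<Sum>e\<in>E. \<Sum>e" arbitrary: E rule: less_induct)
  case less
  have fE: "finite E" using less.prems V finite_subset finite_triples by blast
  show ?case
  proof (cases "stable V E")
    case False
    then obtain e i j where e: "e \<in> E" "j \<in> e" "i \<in> V" "i \<notin> e" "i < j" "insert i (e - {j}) \<notin> E"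
      by (auto simp: stable_def)
    have jV: "j \<in> V" using e less.prems by (auto simp: triples_def)
    have fin: "finite f" if "f \<in> E" for f using less.prems that triplesD(1) by blast
    have le: "\<Sum>(move i j E f) \<le> \<Sum>f" if "f \<in> E" for f
      using sum_move_less[OF e(5), of f] fin[OF that] by (auto simp: move_def)
    have "(\<Sum>f\<in>shift i j E. \<Sum>f) = (\<Sum>f\<in>E. \<Sum>(move i j E f))"
      unfolding shift_def using inj_on_move[of i j E] e by (simp add: sum.reindex)
    also have "\<dots> < (\<Sum>f\<in>E. \<Sum>f)"
    proof (rule sum_strict_mono_ex1[OF fE])
      show "\<exists>f\<in>E. \<Sum>(move i j E f) < \<Sum>f"
        using e sum_move_less[OF e(5), of e] fin by (intro bexI[of _ e]) (auto simp: move_def)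
    qed (use le in auto)
    finally have "Q (shift i j E)"
      using less.hyps[of "shift i j E"] shift_triples[OF less.prems(1) e(3)]
        nu_le_shift[OF less.prems(2) _ less.prems(1) V e(3)] e by auto
    then show ?thesis using sh[OF less.prems e(3) jV e(5)] by blast
  qed (use st less.prems in blast)
qed

text \<open>Equivalently, the Kneser graph of the pairs of at least five points is connected.\<close>

lemma disjoint_pairs_two_colours:
  assumes X: "finite X" "5 \<le> card X"
    and p: "p \<subseteq> X" "card p = 2" "Q p" and q: "q \<subseteq> X" "card q = 2" "\<not> Q q"
  obtains p' q' where "p' \<subseteq> X" "card p' = 2" "Q p'" "q' \<subseteq> X" "card q' = 2" "\<not> Q q'" "p' \<inter> q' = {}"
proof (cases "p \<inter> q = {}")
  case False
  have fin: "finite p" "finite q" using p q X finite_subset by auto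
  have "1 \<le> card (p \<inter> q)" using False fin by (metis One_nat_def Suc_leI card_gt_0_iff finite_Int)
  then have "card (p \<union> q) \<le> 3" using card_Un_Int[OF fin] p q by linarith
  moreover have "card X - card (p \<union> q) \<le> card (X - (p \<union> q))" using fin by (intro diff_card_le_card_Diff) simp
  ultimately have "2 \<le> card (X - (p \<union> q))" using X by linarith
  then obtain r where r: "r \<subseteq> X - (p \<union> q)" "card r = 2" by (meson obtain_subset_with_card_n)
  show ?thesis
  proof (cases "Q r")
    case True
    then show ?thesis using that[of r q] r q by blast
  next
    case False
    then show ?thesis using that[of p r] r p by blast
  qed
qed (use that[of p q] p q in blast)

text \<open>The clique is only admitted for \<open>s \<ge> 2\<close>: for \<open>s = 1\<close> it never wins when \<open>n\<close> is large, and it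
  could not be recovered from its shift, since the pairs of four points have a disconnected Kneser graph.\<close>

definition extremal :: "nat set \<Rightarrow> nat \<Rightarrow> nat set set \<Rightarrow> bool" where
  "extremal V s E \<longleftrightarrow> (\<exists>S. S \<subseteq> V \<and> card S = s \<and> E = star V S) \<or>
     (2 \<le> s \<and> (\<exists>T. T \<subseteq> V \<and> card T = 3 * s + 2 \<and> E = triples T))"

section \<open>Recovering an extremal family from its shift\<close>

lemma triples_insert_iff:
  "x \<notin> f \<Longrightarrow> insert x f \<in> triples V \<longleftrightarrow> x \<in> V \<and> f \<subseteq> V \<and> card f = 2"
  by (cases "finite f") (auto simp: triples_def)

text \<open>If the result is symmetric in \<open>i\<close> and \<open>j\<close>, each pair exchanged
  by the shift is present entirely or not at all, so nothing can have moved.\<close>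

lemma shift_eq_imp_eq:
  assumes "i \<noteq> j" "shift i j E = H"
    and sym: "\<And>e. i \<in> e \<Longrightarrow> j \<notin> e \<Longrightarrow> e \<in> H \<longleftrightarrow> insert j (e - {i}) \<in> H"
  shows "E = H"
proof (rule set_eqI)
  fix e
  consider "i \<in> e \<longleftrightarrow> j \<in> e" | "i \<in> e" "j \<notin> e" | "i \<notin> e" "j \<in> e" by blast
  then show "e \<in> E \<longleftrightarrow> e \<in> H"
  proof cases
    case 1
    then show ?thesis using mem_shift_neutral[OF assms(1)] assms(2) by blast
  next
    case 2
    let ?f = "insert j (e - {i})"
    have f: "i \<notin> ?f" "j \<in> ?f" "insert i (?f - {j}) = e" using 2 assms(1) by auto
    show ?thesis
      using mem_shift_low[OF assms(1) 2, of E] mem_shift_high[OF assms(1) f(1,2), of E] sym[OF 2] f(3) assms(2) by auto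
  next
    case 3
    let ?f = "insert i (e - {j})"
    have f: "i \<in> ?f" "j \<notin> ?f" "insert j (?f - {i}) = e" using 3 assms(1) by auto
    show ?thesis
      using mem_shift_low[OF assms(1) f(1,2), of E] mem_shift_high[OF assms(1) 3, of E] sym[OF f(1,2)] f(3) assms(2) by auto
  qed
qed

text \<open>Rules out a shifted star or clique whose defining set contains \<open>j\<close> but not
  \<open>i\<close>.\<close>

lemma shift_high_low:
  assumes "insert j f \<in> shift i j E" "i \<noteq> j" "i \<notin> f" "j \<notin> f"
  shows "insert i f \<in> shift i j E"
proof -
  have "insert i (insert j f - {j}) \<in> E"
    using assms mem_shift_high[of i j "insert j f" E] by auto
  then have "insert i f \<in> E" using assms(4) by simp
  then show ?thesis using assms mem_shift_low[of i j "insert i f" E] by auto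
qed

lemma image_swap:
  assumes "i \<noteq> j"
  shows "i \<in> e \<longleftrightarrow> j \<in> e \<Longrightarrow> id(i := j, j := i) ` e = e"
    and "i \<in> e \<Longrightarrow> j \<notin> e \<Longrightarrow> id(i := j, j := i) ` e = insert j (e - {i})"
    and "i \<notin> e \<Longrightarrow> j \<in> e \<Longrightarrow> id(i := j, j := i) ` e = insert i (e - {j})"
  using assms by (auto simp: image_iff split: if_splits)

text \<open>For each pair \<open>f\<close> inside \<open>X\<close>, \<open>E\<close> contains
  exactly one of \<open>insert i f\<close> and \<open>insert j f\<close>. By \<open>cross\<close>,
  disjoint pairs make the same choice, and \<open>disjoint_pairs_two_colours\<close> then makes the
  choice constant. Choosing \<open>i\<close> throughout gives \<open>H\<close>, choosing
  \<open>j\<close> throughout gives its image under the transposition.\<close>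

lemma unshift_dichotomy:
  assumes ij: "i \<noteq> j" and H: "shift i j E = H" and X: "finite X" "5 \<le> card X" "i \<notin> X" "j \<notin> X"
    and asym: "\<And>f. f \<subseteq> X \<Longrightarrow> card f = 2 \<Longrightarrow> insert i f \<in> H \<and> insert j f \<notin> H"
    and sym: "\<And>f. \<lbrakk>i \<notin> f; j \<notin> f; \<not> (f \<subseteq> X \<and> card f = 2)\<rbrakk> \<Longrightarrow> insert i f \<in> H \<longleftrightarrow> insert j f \<in> H"
    and cross: "\<And>p q. \<lbrakk>p \<subseteq> X; card p = 2; q \<subseteq> X; card q = 2; p \<inter> q = {}; insert i p \<in> E; insert j q \<in> E\<rbrakk> \<Longrightarrow> False"
  shows "E = H \<or> E = {e. id(i := j, j := i) ` e \<in> H}"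
proof -
  have low: "insert i f \<in> H \<longleftrightarrow> insert i f \<in> E \<or> insert j f \<in> E" if "i \<notin> f" "j \<notin> f" for f
    using mem_shift_low[of i j "insert i f" E] H ij that by auto
  have high: "insert j f \<in> H \<longleftrightarrow> insert j f \<in> E \<and> insert i f \<in> E" if "i \<notin> f" "j \<notin> f" for f
    using mem_shift_high[of i j "insert j f" E] H ij that by auto
  have neutral: "e \<in> H \<longleftrightarrow> e \<in> E" if "i \<in> e \<longleftrightarrow> j \<in> e" for e
    using mem_shift_neutral[OF ij that, of E] H by simp
  have iX: "i \<notin> f" "j \<notin> f" if "f \<subseteq> X" for f using that X by auto
  have one: "insert i f \<in> E \<longleftrightarrow> insert j f \<notin> E" if "f \<subseteq> X" "card f = 2" for f
    using asym[OF that] low[OF iX[OF that(1)]] high[OF iX[OF that(1)]] by blast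
  have eq: "E = F" if "\<And>e. (i \<in> e \<longleftrightarrow> j \<in> e) \<Longrightarrow> e \<in> F \<longleftrightarrow> e \<in> H"
    and "\<And>f. \<lbrakk>i \<notin> f; j \<notin> f\<rbrakk> \<Longrightarrow> (insert i f \<in> E \<longleftrightarrow> insert i f \<in> F) \<and> (insert j f \<in> E \<longleftrightarrow> insert j f \<in> F)" for F
  proof (rule set_eqI)
    fix e
    consider "i \<in> e \<longleftrightarrow> j \<in> e" | "i \<in> e" "j \<notin> e" | "i \<notin> e" "j \<in> e" by blast
    then show "e \<in> E \<longleftrightarrow> e \<in> F"
    proof cases
      case 2
      then show ?thesis using that(2)[of "e - {i}"] by (simp add: insert_absorb)
    next
      case 3
      then show ?thesis using that(2)[of "e - {j}"] by (simp add: insert_absorb)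
    qed (use that(1) neutral in blast)
  qed
  have out: "(insert i f \<in> E \<longleftrightarrow> insert i f \<in> H) \<and> (insert j f \<in> E \<longleftrightarrow> insert i f \<in> H) \<and> (insert j f \<in> H \<longleftrightarrow> insert i f \<in> H)"
    if "i \<notin> f" "j \<notin> f" "\<not> (f \<subseteq> X \<and> card f = 2)" for f
    using low high sym that by blast
  have swap: "id(i := j, j := i) ` insert i f = insert j f" "id(i := j, j := i) ` insert j f = insert i f"
    if "i \<notin> f" "j \<notin> f" for f
    using image_swap(2)[OF ij, of "insert i f"] image_swap(3)[OF ij, of "insert j f"] that ij by auto
  show ?thesis
  proof (cases "\<exists>f. f \<subseteq> X \<and> card f = 2 \<and> insert i f \<notin> E")
    case False
    have "E = H"
    proof (rule eq)
      fix f assume f: "i \<notin> f" "j \<notin> f"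
      show "(insert i f \<in> E \<longleftrightarrow> insert i f \<in> H) \<and> (insert j f \<in> E \<longleftrightarrow> insert j f \<in> H)"
        using out[OF f] asym[of f] one[of f] False by blast
    qed simp
    then show ?thesis ..
  next
    case True
    then obtain q where q: "q \<subseteq> X" "card q = 2" "insert i q \<notin> E" by blast
    have none: "insert i f \<notin> E" if f: "f \<subseteq> X" "card f = 2" for f
    proof
      assume "insert i f \<in> E"
      then obtain p' q' where "p' \<subseteq> X" "card p' = 2" "insert i p' \<in> E" "q' \<subseteq> X" "card q' = 2" "insert i q' \<notin> E" "p' \<inter> q' = {}"
        using disjoint_pairs_two_colours[OF X(1,2) f, of "\<lambda>f. insert i f \<in> E" q] q by metis
      then show False using cross one by blast
    qed
    have "E = {e. id(i := j, j := i) ` e \<in> H}"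
    proof (rule eq)
      fix f assume f: "i \<notin> f" "j \<notin> f"
      show "(insert i f \<in> E \<longleftrightarrow> insert i f \<in> {e. id(i := j, j := i) ` e \<in> H}) \<and>
        (insert j f \<in> E \<longleftrightarrow> insert j f \<in> {e. id(i := j, j := i) ` e \<in> H})"
        unfolding mem_Collect_eq swap[OF f] using out[OF f] asym[of f] one[of f] none[of f] by blast
    qed (simp only: mem_Collect_eq image_swap(1)[OF ij])
    then show ?thesis ..
  qed
qed

lemma swap_triples:
  assumes "i \<in> V" "j \<in> V"
  shows "id(i := j, j := i) ` e \<in> triples T \<longleftrightarrow> e \<in> triples (id(i := j, j := i) ` T)"
    and "id(i := j, j := i) ` e \<in> star V S \<longleftrightarrow> e \<in> star V (id(i := j, j := i) ` S)"
    and "card (id(i := j, j := i) ` S) = card S" "S \<subseteq> V \<Longrightarrow> id(i := j, j := i) ` S \<subseteq> V"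
proof -
  let ?g = "id(i := j, j := i)"
  have inv: "?g (?g x) = x" for x by simp
  then have gg: "?g ` ?g ` X = X" for X by (simp only: image_image image_ident)
  have inj: "inj ?g" using inv by (rule inj_on_inverseI)
  have c: "card (?g ` e) = card e" for e using inj by (intro card_image) (rule inj_on_subset, auto)
  have sub: "?g ` e \<subseteq> A \<longleftrightarrow> e \<subseteq> ?g ` A" for e A using image_mono gg by metis
  have V: "?g ` V = V" using image_swap(1)[of i j V] assms by (cases "i = j") auto
  have "?g ` (e \<inter> ?g ` S) = ?g ` e \<inter> S" unfolding image_Int[OF inj] gg ..
  then have int: "?g ` e \<inter> S \<noteq> {} \<longleftrightarrow> e \<inter> ?g ` S \<noteq> {}" by (metis image_is_empty)
  show "?g ` e \<in> triples T \<longleftrightarrow> e \<in> triples (?g ` T)" unfolding triples_def mem_Collect_eq c sub ..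
  show "?g ` e \<in> star V S \<longleftrightarrow> e \<in> star V (?g ` S)"
    unfolding star_def triples_def mem_Collect_eq c sub int V ..
  show "card (?g ` S) = card S" by (rule c)
  show "S \<subseteq> V \<Longrightarrow> ?g ` S \<subseteq> V" using V by blast
qed

text \<open>Two disjoint edges, one through \<open>i\<close> and one through \<open>j\<close>, would
  extend to a matching of size s + 1: the other s - 1 edges are taken from the shifted family away
  from \<open>i\<close> and \<open>j\<close>, where shifting changes nothing. This supplies the
  hypothesis \<open>cross\<close> of \<open>unshift_dichotomy\<close>.\<close>

lemma extremal_unshift:
  assumes ext: "extremal V s (shift i j E)" and EV: "E \<subseteq> triples V" and nu: "nu_le E s"
    and V: "finite V" "3 * s + 3 \<le> card V" "10 \<le> card V" "1 \<le> s" and ij: "i \<in> V" "j \<in> V" "i \<noteq> j"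
  shows "extremal V s E"
proof -
  have cross: False
    if X: "i \<notin> X" "j \<notin> X" "finite X"
      and pq: "p \<subseteq> X" "card p = 2" "q \<subseteq> X" "card q = 2" "p \<inter> q = {}" "insert i p \<in> E" "insert j q \<in> E"
      and N: "is_matching E N" "card N = s - 1" "finite N" "\<Union>N \<inter> (p \<union> q \<union> {i, j}) = {}" for X p q N
  proof -
    let ?P = "{insert i p, insert j q}"
    have ne: "insert i p \<inter> insert j q = {}" using pq X ij by auto
    have P: "is_matching E ?P" using pq ne unfolding is_matching_def by auto
    have d: "\<Union>?P \<inter> \<Union>N = {}" using N(4) by auto
    have "is_matching E (?P \<union> N)" using P N(1) d by (rule is_matching_Un)
    moreover have "insert i p \<noteq> insert j q" using ne by auto
    then have "card ?P = 2" by simp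
    then have "card (?P \<union> N) = 2 + (s - 1)" using card_Un_matching[OF _ N(3) d] N(2) by simp
    ultimately have "2 + (s - 1) \<le> s" using nu_leD[OF nu] by metis
    then show False using V by simp
  qed
  have neutral: "e \<in> E" if "e \<in> shift i j E" "i \<notin> e" "j \<notin> e" for e
    using that mem_shift_neutral[OF ij(3), of e E] by simp
  have swap_card: "card (insert j (e - {i})) = card e" if e: "i \<in> e" "j \<notin> e" for e
    using card_swap_element[OF e] by (cases "finite e") auto
  show ?thesis using ext unfolding extremal_def[of V s "shift i j E"]
  proof (elim disjE conjE exE)
    fix S assume S: "S \<subseteq> V" "card S = s" and H: "shift i j E = star V S"
    have fS: "finite S" using S V finite_subset by blast
    consider "i \<in> S \<longleftrightarrow> j \<in> S" | "i \<notin> S" "j \<in> S" | "i \<in> S" "j \<notin> S" by blast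
    then show ?thesis
    proof cases
      case 1
      have "E = star V S"
      proof (rule shift_eq_imp_eq[OF ij(3) H])
        fix e assume e: "i \<in> e" "j \<notin> e"
        then show "e \<in> star V S \<longleftrightarrow> insert j (e - {i}) \<in> star V S"
          using 1 swap_card[OF e] ij by (auto simp: star_def triples_def)
      qed
      then show ?thesis using S by (auto simp: extremal_def)
    next
      case 2
      have "card (V - S - {i, j}) \<ge> card V - s - 2"
        using diff_card_le_card_Diff[of "{i, j}" "V - S"] ij S V fS by (simp add: card_Diff_subset)
      then have "2 \<le> card (V - S - {i, j})" using V by linarith
      then obtain f where f: "f \<subseteq> V - S - {i, j}" "card f = 2" by (meson obtain_subset_with_card_n)
      have jf: "j \<notin> f" "i \<notin> f" using f by auto
      have "insert j f \<in> star V S" using f jf 2 ij by (auto simp: star_def triples_insert_iff)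
      then have "insert i f \<in> star V S" using shift_high_low[of j f i E] H jf ij by simp
      then show ?thesis using f 2 by (auto simp: star_def)
    next
      case 3
      define X where "X = V - S - {j}"
      have fX: "finite X" using V by (simp add: X_def)
      have "card X = card V - s - 1" using ij S V fS 3 by (simp add: X_def card_Diff_subset)
      \<comment> \<open>Five points are required for the two-colour argument. Of the 2 (s - 1) + 4
        points, four serve the disjoint pairs and two go to each of the other s - 1 vertices of
        \<open>S\<close>.\<close>
      then have cX: "5 \<le> card X" "2 * (s - 1) + 4 \<le> card X" using V by linarith+
      have iX: "i \<notin> X" "j \<notin> X" using 3 by (auto simp: X_def)
      have "E = star V S \<or> E = {e. id(i := j, j := i) ` e \<in> star V S}"
      proof (rule unshift_dichotomy[OF ij(3) H fX cX(1) iX])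
        fix f assume f: "f \<subseteq> X" "card f = 2"
        then have "i \<notin> f" "f \<subseteq> V" "f \<inter> S = {}" using iX by (auto simp: X_def)
        then show "insert i f \<in> star V S \<and> insert j f \<notin> star V S"
          using f(2) 3 ij by (auto simp: star_def triples_insert_iff)
      next
        fix f assume f: "i \<notin> f" "j \<notin> f" "\<not> (f \<subseteq> X \<and> card f = 2)"
        then show "insert i f \<in> star V S \<longleftrightarrow> insert j f \<in> star V S"
          using 3 ij unfolding star_def X_def by (auto simp: triples_insert_iff)
      next
        fix p q assume pq: "p \<subseteq> X" "card p = 2" "q \<subseteq> X" "card q = 2" "p \<inter> q = {}" "insert i p \<in> E" "insert j q \<in> E"
        have fin: "finite p" "finite q" using pq fX finite_subset by auto
        have "card (p \<union> q) = 4" using pq fin by (simp add: card_Un_disjoint)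
        then have cY: "2 * (s - 1) \<le> card (X - (p \<union> q))"
          using pq fin cX by (simp add: card_Diff_subset)
        have "card (S - {i}) = s - 1" using 3 S fS by simp
        then obtain N where N: "is_matching (star (S - {i} \<union> (X - (p \<union> q))) (S - {i})) N" "card N = s - 1" "finite N"
          using star_matching[of "S - {i}" "X - (p \<union> q)"] cY fS fX by (force simp: X_def)
        have "star (S - {i} \<union> (X - (p \<union> q))) (S - {i}) \<subseteq> E"
        proof
          fix e assume "e \<in> star (S - {i} \<union> (X - (p \<union> q))) (S - {i})"
          then have "e \<in> star V S" "i \<notin> e" "j \<notin> e" using S 3 by (auto simp: star_def triples_def X_def)
          then show "e \<in> E" using neutral H by simp
        qed
        then have N': "is_matching E N" using N(1) is_matching_mono by blast
        have UN: "\<Union>N \<subseteq> S - {i} \<union> (X - (p \<union> q))" using N(1) by (auto simp: is_matching_def star_def triples_def)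
        have "\<Union>N \<inter> (p \<union> q \<union> {i, j}) = {}" using UN pq(1,3) 3 by (auto simp: X_def)
        then show False using cross[OF iX fX pq N' N(2,3)] by simp
      qed
      then show ?thesis
      proof
        assume "E = star V S"
        then show ?thesis using S by (auto simp: extremal_def)
      next
        assume "E = {e. id(i := j, j := i) ` e \<in> star V S}"
        then have "E = star V (id(i := j, j := i) ` S)" using swap_triples(2)[OF ij(1,2)] by blast
        then show ?thesis using swap_triples(3,4)[OF ij(1,2), of S] S unfolding extremal_def by blast
      qed
    qed
  next
    fix T assume s2: "2 \<le> s" and T: "T \<subseteq> V" "card T = 3 * s + 2" and H: "shift i j E = triples T"
    have fT: "finite T" using T V finite_subset by blast
    consider "i \<in> T \<longleftrightarrow> j \<in> T" | "i \<notin> T" "j \<in> T" | "i \<in> T" "j \<notin> T" by blast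
    then show ?thesis
    proof cases
      case 1
      have "E = triples T"
      proof (rule shift_eq_imp_eq[OF ij(3) H])
        fix e assume e: "i \<in> e" "j \<notin> e"
        then show "e \<in> triples T \<longleftrightarrow> insert j (e - {i}) \<in> triples T"
          using 1 swap_card[OF e] ij by (auto simp: triples_def)
      qed
      then show ?thesis using s2 T by (auto simp: extremal_def)
    next
      case 2
      have "2 \<le> card (T - {j})" using T fT 2 s2 by simp
      then obtain f where f: "f \<subseteq> T - {j}" "card f = 2" by (meson obtain_subset_with_card_n)
      have jf: "j \<notin> f" "i \<notin> f" using f 2 by auto
      have "insert j f \<in> triples T" using f 2 jf by (subst triples_insert_iff) auto
      then have "insert i f \<in> triples T" using shift_high_low[of j f i E] H jf ij by simp
      then show ?thesis using 2 by (auto simp: triples_def)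
    next
      case 3
      define X where "X = T - {i}"
      have fX: "finite X" using fT by (simp add: X_def)
      have cX: "card X = 3 * s + 1" using T fT 3 by (simp add: X_def)
      then have c5: "5 \<le> card X" using s2 by simp
      have iX: "i \<notin> X" "j \<notin> X" using 3 by (auto simp: X_def)
      have "E = triples T \<or> E = {e. id(i := j, j := i) ` e \<in> triples T}"
      proof (rule unshift_dichotomy[OF ij(3) H fX c5 iX])
        fix f assume f: "f \<subseteq> X" "card f = 2"
        then have "i \<notin> f" "j \<notin> f" "f \<subseteq> T" using iX by (auto simp: X_def)
        then show "insert i f \<in> triples T \<and> insert j f \<notin> triples T"
          using f(2) 3 by (simp add: triples_insert_iff)
      next
        fix f assume f: "i \<notin> f" "j \<notin> f" "\<not> (f \<subseteq> X \<and> card f = 2)"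
        then show "insert i f \<in> triples T \<longleftrightarrow> insert j f \<in> triples T"
          using 3 unfolding X_def by (auto simp: triples_insert_iff)
      next
        fix p q assume pq: "p \<subseteq> X" "card p = 2" "q \<subseteq> X" "card q = 2" "p \<inter> q = {}" "insert i p \<in> E" "insert j q \<in> E"
        have fin: "finite p" "finite q" using pq fX finite_subset by auto
        have "card (p \<union> q) = 4" using pq fin by (simp add: card_Un_disjoint)
        then have "card (X - (p \<union> q)) = 3 * (s - 1)"
          using pq fin cX s2 by (simp add: card_Diff_subset)
        then obtain N where N: "is_matching (triples (X - (p \<union> q))) N" "card N = s - 1" "finite N"
          using complete_matching[of "X - (p \<union> q)"] fX by auto
        have "triples (X - (p \<union> q)) \<subseteq> E"
        proof
          fix e assume "e \<in> triples (X - (p \<union> q))"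
          then have "i \<notin> e" "j \<notin> e" "e \<in> triples T" using iX by (auto simp: triples_def X_def)
          then show "e \<in> E" using neutral H by simp
        qed
        then have N': "is_matching E N" using N(1) is_matching_mono by blast
        have "\<Union>N \<subseteq> X - (p \<union> q)" using N(1) by (auto simp: is_matching_def triples_def)
        then have "\<Union>N \<inter> (p \<union> q \<union> {i, j}) = {}" using iX by blast
        then show False using cross[OF iX fX pq N' N(2,3)] by simp
      qed
      then show ?thesis
      proof
        assume "E = triples T"
        then show ?thesis using s2 T by (auto simp: extremal_def)
      next
        assume "E = {e. id(i := j, j := i) ` e \<in> triples T}"
        then have "E = triples (id(i := j, j := i) ` T)" using swap_triples(1)[OF ij(1,2)] by blast
        then show ?thesis using swap_triples(3,4)[OF ij(1,2), of T] s2 T unfolding extremal_def by metis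
      qed
    qed
  qed
qed

section \<open>Reduction to stable families\<close>

lemma finite_matching_cards: "finite E \<Longrightarrow> finite {card M | M. is_matching E M}"
  by (rule finite_subset[of _ "card ` Pow E"]) (auto simp: is_matching_def)

lemma matching_number_nu_le:
  assumes "finite E" "matching_number (V, E) = s"
  shows "nu_le E s"
  unfolding nu_le_def
proof (intro allI impI)
  fix M assume "is_matching E M"
  then have "card M \<in> {card M | M. is_matching E M}" by blast
  then show "card M \<le> s"
    using Max_ge[OF finite_matching_cards[OF assms(1)]] assms(2) by (simp add: matching_number_def)
qed

lemma matching_number_eqI:
  assumes "finite E" "nu_le E s" "is_matching E M" "card M = s"
  shows "matching_number (V, E) = s"
  unfolding matching_number_def snd_conv
  by (rule Max_eqI[OF finite_matching_cards[OF assms(1)]]) (use assms nu_leD in auto)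

lemma nu_le_star:
  assumes "finite S"
  shows "nu_le (star V S) (card S)"
  unfolding nu_le_def
proof (intro allI impI)
  fix M assume M: "is_matching (star V S) M"
  define f where "f = (\<lambda>e. SOME x. x \<in> e \<inter> S)"
  have f: "f e \<in> e \<inter> S" if "e \<in> M" for e
  proof -
    have "\<exists>x. x \<in> e \<inter> S" using M that by (auto simp: is_matching_def star_def)
    then show ?thesis unfolding f_def by (rule someI_ex)
  qed
  show "card M \<le> card S"
  proof (rule card_inj_on_le[of f])
    show "inj_on f M"
    proof (rule inj_onI)
      fix e e' assume "e \<in> M" "e' \<in> M" "f e = f e'"
      then have "f e \<in> e \<inter> e'" using f by (metis Int_iff)
      then show "e = e'" using M \<open>e \<in> M\<close> \<open>e' \<in> M\<close> by (auto simp: is_matching_def)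
    qed
  qed (use f assms in auto)
qed

lemma nu_le_triples:
  assumes "finite T" "card T < 3 * Suc s"
  shows "nu_le (triples T) s"
  unfolding nu_le_def
proof (intro allI impI)
  fix M assume M: "is_matching (triples T) M"
  note U = card_Union_matching[OF M order_refl assms(1)]
  have "card (\<Union>M) \<le> card T" using U(3) assms(1) by (simp add: card_mono)
  then show "card M \<le> s" using U(1) assms(2) by simp
qed

lemma star_in_H_fam:
  assumes "finite V" "S \<subseteq> V" "3 * card S \<le> card V"
  shows "(V, star V S) \<in> H_fam 3 (card V) (card S)"
proof -
  have fS: "finite S" using assms finite_subset by blast
  have "2 * card S \<le> card (V - S)" using assms fS by (simp add: card_Diff_subset)
  then obtain M where M: "is_matching (star (S \<union> (V - S)) S) M" "card M = card S"
    using star_matching[of S "V - S"] assms fS by auto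
  have "S \<union> (V - S) = V" using assms by auto
  then have "matching_number (V, star V S) = card S"
    using M nu_le_star[OF fS] assms by (intro matching_number_eqI) (auto simp: star_def)
  then show ?thesis using assms by (auto simp: H_fam_def is_kgraph_def star_def triples_def)
qed

lemma triples_in_H_fam:
  assumes "finite V" "T \<subseteq> V" "card T = 3 * s + 2"
  shows "(V, triples T) \<in> H_fam 3 (card V) s"
proof -
  have fT: "finite T" using assms finite_subset by blast
  obtain A where A: "A \<subseteq> T" "card A = 3 * s" using assms(3) by (metis le_add1 obtain_subset_with_card_n)
  then obtain M where M: "is_matching (triples A) M" "card M = s"
    using complete_matching[of A s] fT finite_subset by metis
  have "is_matching (triples T) M" using M(1) triples_mono[OF A(1)] by (rule is_matching_mono)
  then have "matching_number (V, triples T) = s"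
    using M nu_le_triples[of T s] assms fT by (intro matching_number_eqI) auto
  then show ?thesis using assms by (auto simp: H_fam_def is_kgraph_def triples_def)
qed

text \<open>Stability and cells refer to the order on an initial segment, so an arbitrary vertex set
  is carried there by a bijection, together with matchings, stars and cliques.\<close>

lemma relabel:
  assumes V: "finite V" "card V = n" and E: "E \<subseteq> triples V" "nu_le E s"
    and bound: "\<And>E'. E' \<subseteq> triples {..<n} \<Longrightarrow> nu_le E' s \<Longrightarrow>
      card E' \<le> B \<and> (card E' = B \<longrightarrow> extremal {..<n} s E')"
  shows "card E \<le> B \<and> (card E = B \<longrightarrow> extremal V s E)"
proof -
  obtain h where h: "bij_betw h V {..<n}"
    using V ex_bij_betw_finite_nat[of V] by (auto simp: atLeast0LessThan)
  then have inj: "inj_on h V" and im: "h ` V = {..<n}" by (auto simp: bij_betw_def)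
  have EP: "E \<subseteq> Pow V" using E by (auto simp: triples_def)
  define E' where "E' = (image h) ` E"
  have injP: "inj_on (image h) (Pow V)" using inj by (rule inj_on_image_Pow)
  have injE: "inj_on (image h) E" using injP EP inj_on_subset by blast
  have trans: "image h ` triples A = triples (h ` A)" if A: "A \<subseteq> V" for A
  proof (intro equalityI subsetI)
    fix e assume "e \<in> image h ` triples A"
    then obtain f where f: "f \<subseteq> A" "card f = 3" "e = h ` f" by (auto simp: triples_def)
    moreover have "inj_on h f" using f A inj inj_on_subset by blast
    ultimately show "e \<in> triples (h ` A)" by (auto simp: triples_def card_image)
  next
    fix e assume e: "e \<in> triples (h ` A)"
    then obtain f where f: "f \<subseteq> A" "e = h ` f" by (auto simp: triples_def subset_image_iff)
    moreover have "inj_on h f" using f A inj inj_on_subset by blast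
    ultimately show "e \<in> image h ` triples A" using e by (auto simp: triples_def card_image)
  qed
  have "E' \<subseteq> triples {..<n}" unfolding E'_def using trans[OF order_refl] im image_mono[OF E(1), of "image h"] by simp
  moreover have "nu_le E' s" unfolding nu_le_def
  proof (intro allI impI)
    fix M' assume M': "is_matching E' M'"
    then have "M' \<subseteq> image h ` E" by (simp add: is_matching_def E'_def)
    then obtain M where M: "M \<subseteq> E" "M' = image h ` M" unfolding subset_image_iff by blast
    have "is_matching E M" unfolding is_matching_def
    proof (intro conjI ballI impI)
      fix e f assume ef: "e \<in> M" "f \<in> M" "e \<noteq> f"
      then have "h ` e \<noteq> h ` f" using injE M by (metis inj_onD subsetD)
      then have "h ` e \<inter> h ` f = {}" using M' M ef by (auto simp: is_matching_def)
      then show "e \<inter> f = {}" by blast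
    qed (use M in auto)
    then have "card M \<le> s" using E(2) nu_leD by blast
    moreover have "card M' = card M" unfolding M(2) using injE M by (intro card_image) (rule inj_on_subset)
    ultimately show "card M' \<le> s" by simp
  qed
  ultimately have b: "card E' \<le> B" "card E' = B \<longrightarrow> extremal {..<n} s E'" using bound by auto
  have c: "card E' = card E" unfolding E'_def using injE by (rule card_image)
  have "extremal V s E" if ext: "extremal {..<n} s E'"
  proof -
    have pull: "\<exists>S0. S0 \<subseteq> V \<and> S = h ` S0 \<and> card S0 = card S" if "S \<subseteq> {..<n}" for S
    proof -
      have "S \<subseteq> h ` V" using that im by simp
      then obtain S0 where "S0 \<subseteq> V" "S = h ` S0" unfolding subset_image_iff by blast
      moreover have "inj_on h S0" using calculation inj inj_on_subset by blast
      ultimately show ?thesis using card_image[of h S0] by (intro exI[of _ S0]) simp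
    qed
    have eqI: "E = F" if "F \<subseteq> Pow V" "E' = image h ` F" for F
      using inj_on_image_eq_iff[OF injP EP that(1)] that(2) by (simp add: E'_def)
    consider S where "S \<subseteq> {..<n}" "card S = s" "E' = star {..<n} S"
      | T where "2 \<le> s" "T \<subseteq> {..<n}" "card T = 3 * s + 2" "E' = triples T"
      using ext unfolding extremal_def by blast
    then show ?thesis
    proof cases
      case 1
      then obtain S0 where S0: "S0 \<subseteq> V" "S = h ` S0" "card S0 = s" using pull[OF 1(1)] 1(2) by auto
      have "image h ` star V S0 = star {..<n} S"
      proof (intro equalityI subsetI)
        fix e assume "e \<in> image h ` star V S0"
        then obtain f where f: "f \<in> triples V" "f \<inter> S0 \<noteq> {}" "e = h ` f" by (auto simp: star_def)
        then show "e \<in> star {..<n} S" using trans[of V] im S0 by (auto simp: star_def)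
      next
        fix e assume "e \<in> star {..<n} S"
        then have e: "e \<in> image h ` triples V" "e \<inter> h ` S0 \<noteq> {}"
          using trans[of V] im S0 by (simp_all add: star_def)
        then obtain f where f: "f \<in> triples V" "e = h ` f" "h ` f \<inter> h ` S0 \<noteq> {}" by blast
        have "f \<inter> S0 \<noteq> {}"
          using f(3) inj_on_image_Int[OF inj triplesD(3)[OF f(1)] S0(1)] by (metis image_empty)
        then show "e \<in> image h ` star V S0" using f by (auto simp: star_def)
      qed
      then have "E' = image h ` star V S0" using 1(3) by simp
      moreover have "star V S0 \<subseteq> Pow V" by (auto simp: star_def triples_def)
      ultimately have "E = star V S0" by (intro eqI)
      then show ?thesis using S0 unfolding extremal_def by blast
    next
      case 2
      then obtain T0 where T0: "T0 \<subseteq> V" "T = h ` T0" "card T0 = 3 * s + 2" using pull[OF 2(2)] 2(3) by auto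
      have "E' = image h ` triples T0" using 2(4) trans[OF T0(1)] T0(2) by simp
      moreover have "triples T0 \<subseteq> Pow V" using T0(1) by (auto simp: triples_def)
      ultimately have "E = triples T0" by (intro eqI)
      then show ?thesis using 2 T0 unfolding extremal_def by blast
    qed
  qed
  then show ?thesis using b c by auto
qed

lemma theorem_from_bound:
  assumes sn: "3 * s + 2 \<le> n" and s1: "1 \<le> s" and n: "10 \<le> n"
    and stab: "\<And>E. \<lbrakk>3 * s + 3 \<le> n; E \<subseteq> triples {..<n}; nu_le E s; stable {..<n} E\<rbrakk> \<Longrightarrow>
      card E \<le> max (cov n s) (cl s) \<and> (card E = max (cov n s) (cl s) \<longrightarrow> extremal {..<n} s E)"
  shows "mu_max 3 n s = max (cov n s) (cl s) \<and> M_fam 3 n s \<subseteq> Cov_fam 3 n s \<union> Cl_fam 3 n s"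
proof -
  define B where "B = max (cov n s) (cl s)"
  have ub: "card E \<le> B \<and> (card E = B \<longrightarrow> (V, E) \<in> Cov_fam 3 n s \<union> Cl_fam 3 n s)"
    if V: "finite V" "card V = n" and E: "E \<subseteq> triples V" "nu_le E s" for V E
  \<comment> \<open>Here the clique consists of all triples and the bound is trivial.
    \<open>extremal_unshift\<close> needs one more vertex.\<close>
  proof (cases "n = 3 * s + 2")
    case True
    have "card (triples V) = cl s" using V True by (simp add: card_triples cl_def)
    moreover have "cov n s \<le> cl s" using True by (simp add: cov_def cl_def)
    ultimately have B: "B = card (triples V)" by (simp add: B_def)
    have "card E \<le> B" using E V B by (simp add: card_mono)
    moreover have "(V, E) \<in> Cl_fam 3 n s" if "card E = B"
    proof -
      have "E = triples V" using that B E V by (intro card_subset_eq) auto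
      then show ?thesis using V True unfolding Cl_fam_def
        by (auto simp: triples_def intro!: exI[of _ V])
    qed
    ultimately show ?thesis by blast
  next
    case False
    then have sn3: "3 * s + 3 \<le> n" using sn by simp
    have "card E \<le> B \<and> (card E = B \<longrightarrow> extremal V s E)"
    proof (rule relabel[OF V E])
      fix E' assume E': "E' \<subseteq> triples {..<n}" "nu_le E' s"
      show "card E' \<le> B \<and> (card E' = B \<longrightarrow> extremal {..<n} s E')"
      proof (rule shift_induct[OF _ E'])
        fix E i j assume a: "E \<subseteq> triples {..<n}" "nu_le E s" "i \<in> {..<n}" "j \<in> {..<n}" "i < j"
          "card (shift i j E) \<le> B \<and> (card (shift i j E) = B \<longrightarrow> extremal {..<n} s (shift i j E))"
        have "card (shift i j E) = card E" using a by (intro card_shift) simp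
        moreover have "extremal {..<n} s (shift i j E) \<Longrightarrow> extremal {..<n} s E"
          using a sn3 n s1 by (intro extremal_unshift[of "{..<n}" s i j E]) auto
        ultimately show "card E \<le> B \<and> (card E = B \<longrightarrow> extremal {..<n} s E)" using a by auto
      qed (use stab[OF sn3] B_def in auto)
    qed
    moreover have "(V, E) \<in> Cov_fam 3 n s \<union> Cl_fam 3 n s" if "extremal V s E"
      using that V unfolding extremal_def Cov_fam_def Cl_fam_def star_def triples_def
      by (auto simp: numeral_eq_Suc)
    ultimately show ?thesis by blast
  qed
  have H: "finite (fst G) \<and> card (fst G) = n \<and> snd G \<subseteq> triples (fst G) \<and> nu_le (snd G) s"
    if "G \<in> H_fam 3 n s" for G
  proof -
    have G: "finite (fst G)" "card (fst G) = n" "snd G \<subseteq> triples (fst G)" "matching_number (fst G, snd G) = s"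
      using that by (auto simp: H_fam_def is_kgraph_def triples_def)
    then have "finite (snd G)" using finite_subset finite_triples by blast
    then show ?thesis using G matching_number_nu_le by blast
  qed
  have le: "card (snd G) \<le> B" if "G \<in> H_fam 3 n s" for G using ub H[OF that] by blast
  have "\<exists>G\<in>H_fam 3 n s. card (snd G) = cov n s"
    using star_in_H_fam[of "{..<n}" "{..<s}"] sn by (intro bexI[of _ "({..<n}, star {..<n} {..<s})"]) (auto simp: card_star)
  moreover have "\<exists>G\<in>H_fam 3 n s. card (snd G) = cl s"
    using triples_in_H_fam[of "{..<n}" "{..<3 * s + 2}" s] sn
    by (intro bexI[of _ "({..<n}, triples {..<3 * s + 2})"]) (auto simp: card_triples cl_def)
  ultimately obtain G where G: "G \<in> H_fam 3 n s" "card (snd G) = B"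
    unfolding B_def max_def by (metis (full_types))
  have mu: "mu_max 3 n s = B" unfolding mu_max_def
  proof (rule Max_eqI)
    show "finite {card (snd G) |G. G \<in> H_fam 3 n s}"
      by (rule finite_subset[of _ "{..B}"]) (use le in auto)
    show "B \<in> {card (snd G) |G. G \<in> H_fam 3 n s}" using G by blast
  qed (use le in blast)
  moreover have "M_fam 3 n s \<subseteq> Cov_fam 3 n s \<union> Cl_fam 3 n s"
  proof
    fix G assume "G \<in> M_fam 3 n s"
    then have "G \<in> H_fam 3 n s" "card (snd G) = B" using mu by (auto simp: M_fam_def)
    then show "G \<in> Cov_fam 3 n s \<union> Cl_fam 3 n s" using ub[of "fst G" "snd G"] H[of G] by auto
  qed
  ultimately show ?thesis by (simp add: B_def)
qed

section \<open>Three blocks of weight one\<close>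

type_synonym block = "real \<times> real \<times> real"

definition sum3 :: "('a \<Rightarrow> real) \<Rightarrow> 'a \<times> 'a \<times> 'a \<Rightarrow> real" where
  "sum3 h A = (case A of (a, b, c) \<Rightarrow> h a + h b + h c)"

definition unit_block :: "block \<Rightarrow> bool" where
  "unit_block A \<longleftrightarrow> (case A of (a, b, c) \<Rightarrow> 0 \<le> a \<and> 0 \<le> b \<and> 0 \<le> c \<and> a + b + c = 1)"

text \<open>Uncovered cells weigh 0, so an edge with one or two coordinates in blocks and the rest
  uncovered must collect weight 1 from the block coordinates alone. Hence counts for one and two
  blocks appear beside \<open>count3\<close>.\<close>

definition count1 :: "block \<Rightarrow> real" where
  "count1 A = sum3 (\<lambda>x. of_bool (1 \<le> x)) A"

definition count2 :: "block \<Rightarrow> block \<Rightarrow> real" where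
  "count2 A B = sum3 (\<lambda>x. sum3 (\<lambda>y. of_bool (1 \<le> x + y)) B) A"

definition count3 :: "block \<Rightarrow> block \<Rightarrow> block \<Rightarrow> real" where
  "count3 A B C = sum3 (\<lambda>x. sum3 (\<lambda>y. sum3 (\<lambda>z. of_bool (1 \<le> x + y + z)) C) B) A"

text \<open>Blocks are only ever used through \<open>sum3\<close>, so the last clause expresses that
  \<open>(a, b, c)\<close> is a rearrangement of the block.\<close>

definition sorted_as :: "block \<Rightarrow> real \<Rightarrow> real \<Rightarrow> real \<Rightarrow> bool" where
  "sorted_as A a b c \<longleftrightarrow> 0 \<le> c \<and> c \<le> b \<and> b \<le> a \<and> a + b + c = 1 \<and> (\<forall>h. sum3 h A = h a + h b + h c)"

lemma sort_block:
  assumes "unit_block A"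
  shows "\<exists>a b c. sorted_as A a b c"
proof -
  obtain x y z where A: "A = (x, y, z)" by (cases A)
  consider "x \<le> y" "y \<le> z" | "x \<le> z" "z \<le> y" | "y \<le> x" "x \<le> z" | "y \<le> z" "z \<le> x" | "z \<le> x" "x \<le> y" | "z \<le> y" "y \<le> x"
    by linarith
  then have "sorted_as A z y x \<or> sorted_as A y z x \<or> sorted_as A z x y \<or> sorted_as A x z y \<or> sorted_as A y x z \<or> sorted_as A x y z"
    using assms unfolding A by cases (simp_all add: unit_block_def sum3_def sorted_as_def)
  then show ?thesis by blast
qed

definition hit :: "real \<Rightarrow> real" where
  "hit x = of_bool (1 \<le> x)"

lemma hit_le: "hit x \<le> 1" "0 \<le> hit x"
  by (auto simp: hit_def)

lemma hit_pair: "x + y < 2 \<Longrightarrow> hit x + hit y \<le> 1"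
  by (auto simp: hit_def)

lemma hit_0: "x < 1 \<Longrightarrow> hit x = 0"
  by (simp add: hit_def)

text \<open>The middle entries are at most 1/2. If \<open>b1 + b2\<close> reaches 1, both blocks are
  (1/2, 1/2, 0) and exactly four sums survive. Otherwise four low sums fail, and four of the others
  form two pairs of total below 2, so at most three sums survive.\<close>

lemma count2_light_le:
  fixes a1 b1 c1 a2 b2 c2 :: real
  assumes 1: "0 \<le> c1" "c1 \<le> b1" "b1 \<le> a1" "a1 < 1" "a1 + b1 + c1 = 1"
    and 2: "0 \<le> c2" "c2 \<le> b2" "b2 \<le> a2" "a2 < 1" "a2 + b2 + c2 = 1"
  shows "hit (a1 + a2) + hit (a1 + b2) + hit (a1 + c2) + (hit (b1 + a2) + hit (b1 + b2) + hit (b1 + c2))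
     + (hit (c1 + a2) + hit (c1 + b2) + hit (c1 + c2)) \<le> 4"
proof (cases "b1 + b2 < 1")
  case True
  then have "hit (b1 + b2) = 0" "hit (b1 + c2) = 0" "hit (c1 + b2) = 0" "hit (c1 + c2) = 0"
    using assms by (auto intro!: hit_0)
  moreover have "hit (a1 + c2) + hit (b1 + a2) \<le> 1" "hit (c1 + a2) + hit (a1 + b2) \<le> 1"
    using assms by (auto intro!: hit_pair)
  ultimately show ?thesis using hit_le[of "a1 + a2"] by linarith
next
  case False
  then have "hit (a1 + c2) = 0" "hit (b1 + c2) = 0" "hit (c1 + c2) = 0" "hit (c1 + a2) = 0" "hit (c1 + b2) = 0"
    using assms by (auto intro!: hit_0)
  then show ?thesis
    using hit_le[of "a1 + a2"] hit_le[of "a1 + b2"] hit_le[of "b1 + a2"] hit_le[of "b1 + b2"] by linarith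
qed

text \<open>Six of the 27 sums are lost. They are found in pairs: complementary choices
  from \<open>{b1, c1} \<times> {b2, c2}\<close> have total weight at most 1, so adding two numbers from the third block
  whose sum is less than 1 leaves at least one of the two sums below 1.\<close>

lemma count3_light_aux:
  fixes a1 b1 c1 a2 b2 c2 a3 b3 c3 :: real
  assumes 1: "0 \<le> c1" "c1 \<le> b1" "b1 \<le> a1" "a1 < 1" "a1 + b1 + c1 = 1"
    and 2: "0 \<le> c2" "c2 \<le> b2" "b2 \<le> a2" "a2 < 1" "a2 + b2 + c2 = 1"
    and 3: "0 \<le> c3" "c3 \<le> b3" "b3 \<le> a3" "a3 < 1" "a3 + b3 + c3 = 1"
    and a: "1 \<le> a1 + a2"
  shows "sum3 (\<lambda>x. sum3 (\<lambda>y. sum3 (\<lambda>z. hit (x + y + z)) (a3, b3, c3)) (a2, b2, c2)) (a1, b1, c1) \<le> 21"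
proof -
  note ub = hit_le(1)[of "a1 + a2 + a3"] hit_le(1)[of "a1 + a2 + b3"] hit_le(1)[of "a1 + a2 + c3"]
    hit_le(1)[of "a1 + b2 + a3"] hit_le(1)[of "a1 + b2 + b3"] hit_le(1)[of "a1 + b2 + c3"]
    hit_le(1)[of "a1 + c2 + a3"] hit_le(1)[of "a1 + c2 + b3"] hit_le(1)[of "a1 + c2 + c3"]
    hit_le(1)[of "b1 + a2 + a3"] hit_le(1)[of "b1 + a2 + b3"] hit_le(1)[of "b1 + a2 + c3"]
    hit_le(1)[of "b1 + b2 + a3"] hit_le(1)[of "b1 + b2 + b3"] hit_le(1)[of "b1 + b2 + c3"]
    hit_le(1)[of "b1 + c2 + a3"] hit_le(1)[of "b1 + c2 + b3"] hit_le(1)[of "b1 + c2 + c3"]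
    hit_le(1)[of "c1 + a2 + a3"] hit_le(1)[of "c1 + a2 + b3"] hit_le(1)[of "c1 + a2 + c3"]
    hit_le(1)[of "c1 + b2 + a3"] hit_le(1)[of "c1 + b2 + b3"] hit_le(1)[of "c1 + b2 + c3"]
    hit_le(1)[of "c1 + c2 + a3"] hit_le(1)[of "c1 + c2 + b3"] hit_le(1)[of "c1 + c2 + c3"]
  \<comment> \<open>By \<open>a\<close>, complementary choices from the first two blocks total b1 +
    c1 + b2 + c2 <= 1. The third block offers the pairs (b3, c3), (c3, b3), (a3, a3) of sum below 1
    if a3 < 1/2, and (a3, c3), (c3, a3), (b3, b3) if b3 < 1/2 <= a3. Three pairs for each of two
    complementary choices give six losses.\<close>
  consider "a3 < 1/2" | "1/2 \<le> a3" "b3 < 1/2" | "b3 = 1/2" "a3 = 1/2" "c3 = 0" using 3 by linarith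
  then show ?thesis
  proof cases
    case 1
    have "hit (b1 + b2 + b3) + hit (c1 + c2 + c3) \<le> 1" "hit (b1 + b2 + c3) + hit (c1 + c2 + b3) \<le> 1"
      "hit (b1 + b2 + a3) + hit (c1 + c2 + a3) \<le> 1"
      "hit (b1 + c2 + b3) + hit (c1 + b2 + c3) \<le> 1" "hit (b1 + c2 + c3) + hit (c1 + b2 + b3) \<le> 1"
      "hit (b1 + c2 + a3) + hit (c1 + b2 + a3) \<le> 1"
      using assms 1 by (auto intro!: hit_pair)
    then show ?thesis unfolding sum3_def prod.case using ub by linarith
  next
    case 2
    have "hit (b1 + b2 + a3) + hit (c1 + c2 + c3) \<le> 1" "hit (b1 + b2 + c3) + hit (c1 + c2 + a3) \<le> 1"
      "hit (b1 + b2 + b3) + hit (c1 + c2 + b3) \<le> 1"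
      "hit (b1 + c2 + a3) + hit (c1 + b2 + c3) \<le> 1" "hit (b1 + c2 + c3) + hit (c1 + b2 + a3) \<le> 1"
      "hit (b1 + c2 + b3) + hit (c1 + b2 + b3) \<le> 1"
      using assms 2 by (auto intro!: hit_pair)
    then show ?thesis unfolding sum3_def prod.case using ub by linarith
  next
    case 3
    have four: "hit (b1 + b2 + b3) + hit (c1 + c2 + c3) \<le> 1" "hit (b1 + b2 + c3) + hit (c1 + c2 + b3) \<le> 1"
      "hit (b1 + c2 + b3) + hit (c1 + b2 + c3) \<le> 1" "hit (b1 + c2 + c3) + hit (c1 + b2 + b3) \<le> 1"
      using assms 3 by (auto intro!: hit_pair)
    \<comment> \<open>For (1/2, 1/2, 0) only four losses arise as before. The remaining two come
      from c3 = 0: the totals 2 - b1 - c2 and 2 - c1 - b2 are below 2 because the middle entry of a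
      light block is positive.\<close>
    have "hit (c1 + a2 + c3) + hit (b1 + a2 + c3) + hit (a1 + c2 + c3) + hit (a1 + b2 + c3) \<le> 2"
    proof -
      have "hit (c1 + a2 + c3) + hit (a1 + b2 + c3) \<le> 1" "hit (b1 + a2 + c3) + hit (a1 + c2 + c3) \<le> 1"
        using assms 3 by (auto intro!: hit_pair)
      then show ?thesis by linarith
    qed
    then show ?thesis unfolding sum3_def prod.case using ub four by linarith
  qed
qed

text \<open>With \<open>y\<close> the ratio of uncovered to block mass, 27 is what a triple of blocks contributes
  in the clique and \<open>19 + 15 y + 3 y\<^sup>2\<close> is its contribution in the covering family.\<close>

definition cap :: "real \<Rightarrow> real" where
  "cap y = max 27 (19 + 15 * y + 3 * y\<^sup>2)"

text \<open>The branches of \<open>cap\<close> cross near y = 0.486, and 9/20 and 1/2 lie on either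
  side. The first three expressions bound triples with exactly two heavy blocks, with one, and with
  none but some pair sum reaching 1. The tightest is 21 + 12 y, about 26.83 at the crossing.\<close>

lemma cap_numeric:
  assumes "0 \<le> y"
  shows "15 + 11 * y + 2 * y\<^sup>2 \<le> cap y - 1/10" "17 + 10 * y + y\<^sup>2 \<le> cap y - 1/10" "21 + 12 * y \<le> cap y - 1/10"
    "y \<le> 9/20 \<Longrightarrow> 19 + 15 * y + 3 * y\<^sup>2 \<le> cap y - 1/10" "1/2 \<le> y \<Longrightarrow> 27 \<le> cap y - 1/10"
    "27 \<le> cap y" "19 + 15 * y + 3 * y\<^sup>2 \<le> cap y"
proof -
  have c: "27 \<le> cap y" "19 + 15 * y + 3 * y\<^sup>2 \<le> cap y" by (auto simp: cap_def)
  then show "27 \<le> cap y" "19 + 15 * y + 3 * y\<^sup>2 \<le> cap y" by auto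
  have s: "0 \<le> y\<^sup>2" by simp
  show "15 + 11 * y + 2 * y\<^sup>2 \<le> cap y - 1/10" using c(2) s assms by linarith
  show "17 + 10 * y + y\<^sup>2 \<le> cap y - 1/10" using c(2) s assms by linarith
  \<comment> \<open>Tangents of the square turn the estimates into linear ones; the tangent at
    49/100 is used just beyond the crossing.\<close>
  have lo: "y\<^sup>2 \<ge> 2 * t * y - t\<^sup>2" for t using zero_le_power2[of "y - t"] by (simp add: power2_diff algebra_simps)
  show "21 + 12 * y \<le> cap y - 1/10"
  proof (cases "y \<le> 49/100")
    case True then show ?thesis using c(1) by linarith
  next
    case False then show ?thesis using c(2) lo[of "49/100"] by (simp add: power2_eq_square)
  qed
  show "27 \<le> cap y - 1/10" if "1/2 \<le> y" using c(2) lo[of "1/2"] that by (simp add: power2_eq_square)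
  show "19 + 15 * y + 3 * y\<^sup>2 \<le> cap y - 1/10" if "y \<le> 9/20"
  proof -
    have "y\<^sup>2 \<le> (9/20)\<^sup>2" using that assms by (intro power_mono) auto
    then have "y\<^sup>2 \<le> 81/400" by (simp add: power2_eq_square)
    then show ?thesis using c(1) that by linarith
  qed
qed

text \<open>For a unit block this forces the weights 1, 0, 0 in some order.\<close>

definition heavy :: "block \<Rightarrow> bool" where
  "heavy A \<longleftrightarrow> count1 A \<noteq> 0"

lemma sorted_heavy:
  assumes "unit_block A" "heavy A"
  shows "sum3 h A = h 1 + h 0 + h 0"
proof -
  obtain a b c where s: "sorted_as A a b c" using sort_block[OF assms(1)] by blast
  have "1 \<le> a"
  proof (rule ccontr)
    assume "\<not> 1 \<le> a"
    then have "count1 A = 0" using s by (simp add: count1_def sorted_as_def)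
    then show False using assms by (simp add: heavy_def)
  qed
  then have "a = 1" "b = 0" "c = 0" using s by (auto simp: sorted_as_def)
  then show ?thesis using s by (simp add: sorted_as_def)
qed

lemma sorted_light:
  assumes "unit_block A" "\<not> heavy A"
  obtains a b c where "sorted_as A a b c" "a < 1"
proof -
  obtain a b c where s: "sorted_as A a b c" using sort_block[OF assms(1)] by blast
  have "a < 1"
  proof (rule ccontr)
    assume "\<not> a < 1"
    then have "count1 A \<ge> 1" using s by (simp add: count1_def sorted_as_def)
    then show False using assms by (simp add: heavy_def)
  qed
  then show ?thesis using that s by blast
qed

lemma sorted_asD:
  assumes "sorted_as A a b c"
  shows "0 \<le> c" "c \<le> b" "b \<le> a" "a + b + c = 1" "0 \<le> b" "0 \<le> a" "sum3 h A = h a + h b + h c"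
  using assms by (auto simp: sorted_as_def)

lemma count_swap:
  "count2 A B = count2 B A" "count3 A B C = count3 B A C" "count3 A B C = count3 A C B"
  by (cases A; cases B; cases C; simp add: count2_def count3_def sum3_def algebra_simps)+

lemma count_bounds_light:
  assumes "unit_block A" "\<not> heavy A" "unit_block B" "\<not> heavy B"
  shows "count2 A B \<le> 4" "0 \<le> count2 A B"
    and "unit_block C \<Longrightarrow> \<not> heavy C \<Longrightarrow> count2 A B \<noteq> 0 \<Longrightarrow> count3 A B C \<le> 21"
proof -
  obtain a1 b1 c1 where s1: "sorted_as A a1 b1 c1" "a1 < 1"
    using sorted_light[OF assms(1,2)] by blast
  note 1 = sorted_asD(1-3)[OF s1(1)] s1(2) sorted_asD(4,7)[OF s1(1)]
  obtain a2 b2 c2 where s2: "sorted_as B a2 b2 c2" "a2 < 1"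
    using sorted_light[OF assms(3,4)] by blast
  note 2 = sorted_asD(1-3)[OF s2(1)] s2(2) sorted_asD(4,7)[OF s2(1)]
  have c2: "count2 A B = hit (a1 + a2) + hit (a1 + b2) + hit (a1 + c2) + (hit (b1 + a2) + hit (b1 + b2) + hit (b1 + c2))
     + (hit (c1 + a2) + hit (c1 + b2) + hit (c1 + c2))"
    unfolding count2_def 1(6) 2(6) hit_def ..
  show "count2 A B \<le> 4" unfolding c2 by (rule count2_light_le[OF 1(1-5) 2(1-5)])
  show "0 \<le> count2 A B" unfolding c2 by (intro add_nonneg_nonneg hit_le)
  assume C: "unit_block C" "\<not> heavy C" and nz: "count2 A B \<noteq> 0"
  obtain a3 b3 c3 where s3: "sorted_as C a3 b3 c3" "a3 < 1"
    using sorted_light[OF C] by blast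
  note 3 = sorted_asD(1-3)[OF s3(1)] s3(2) sorted_asD(4,7)[OF s3(1)]
  have "1 \<le> a1 + a2"
  proof (rule ccontr)
    assume n: "\<not> 1 \<le> a1 + a2"
    have "count2 A B = 0" unfolding c2 using n 1 2 by (simp add: hit_0)
    then show False using nz by simp
  qed
  moreover have "count3 A B C = sum3 (\<lambda>x. sum3 (\<lambda>y. sum3 (\<lambda>z. hit (x + y + z)) (a3, b3, c3)) (a2, b2, c2)) (a1, b1, c1)"
    unfolding count3_def 1(6) 2(6) 3(6) hit_def by (simp only: sum3_def prod.case)
  ultimately show "count3 A B C \<le> 21" using count3_light_aux[OF 1(1-5) 2(1-5) 3(1-5)] by simp
qed

lemma sum3_le: "(\<And>x. h x \<le> k) \<Longrightarrow> sum3 h A \<le> 3 * k"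
proof -
  assume h: "\<And>x. h x \<le> k"
  obtain a b c where "A = (a, b, c)" by (cases A)
  then show ?thesis using h[of a] h[of b] h[of c] by (simp add: sum3_def)
qed

lemma count3_le: "count3 A B C \<le> 27"
proof -
  have "count3 A B C \<le> 3 * (3 * (3 * 1))"
    unfolding count3_def by (intro sum3_le) simp
  then show ?thesis by simp
qed

text \<open>The edges leaving the blocks, spread over triples of blocks: each uncovered coordinate
  is replaced by a free choice of block, and the factor \<open>y\<close>, uncovered mass over block
  mass, corrects for this.\<close>

definition gain :: "real \<Rightarrow> block \<Rightarrow> block \<Rightarrow> block \<Rightarrow> real" where
  "gain y A B C = y * (count2 A B + count2 A C + count2 B C) + y\<^sup>2 * (count1 A + count1 B + count1 C)"

lemma gain_swap: "gain y A B C = gain y B A C" "gain y A B C = gain y A C B"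
  by (simp_all add: gain_def count_swap(1) add_ac)

text \<open>All numbers come from the zeros of heavy blocks: 5 = 9 - 4, 19 = 27 - 8, 15 = 27 - 4 *
  3. With one heavy block its entry 1 yields all nine sums and each of its two zeros yields
  \<open>count2 B C\<close>.\<close>

lemma heavy_counts:
  assumes "unit_block A" "heavy A" "unit_block B"
  shows "count1 A = 1" "heavy B \<Longrightarrow> count2 A B = 5" "\<not> heavy B \<Longrightarrow> count2 A B = 3"
    "heavy B \<Longrightarrow> unit_block C \<Longrightarrow> heavy C \<Longrightarrow> count3 A B C = 19"
    "heavy B \<Longrightarrow> unit_block C \<Longrightarrow> \<not> heavy C \<Longrightarrow> count3 A B C = 15"
    "\<not> heavy B \<Longrightarrow> unit_block C \<Longrightarrow> \<not> heavy C \<Longrightarrow> count3 A B C = 9 + 2 * count2 B C"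
proof -
  note A = sorted_heavy[OF assms(1,2)]
  show "count1 A = 1" by (simp add: count1_def A)
  show "count2 A B = 5" if "heavy B"
    by (simp add: count2_def A sorted_heavy[OF assms(3) that])
  show "count2 A B = 3" if B: "\<not> heavy B"
  proof -
    obtain a b c where s: "sorted_as B a b c" "a < 1"
      using sorted_light[OF assms(3) B] by blast
    note h = sorted_asD(7)[OF s(1)]
    show ?thesis unfolding count2_def A h using s(2) sorted_asD(1-6)[OF s(1)] by simp
  qed
  show "count3 A B C = 19" if "heavy B" "unit_block C" "heavy C"
    by (simp add: count3_def A sorted_heavy[OF assms(3) that(1)] sorted_heavy[OF that(2,3)])
  show "count3 A B C = 15" if B: "heavy B" and C: "unit_block C" "\<not> heavy C"
  proof -
    obtain a b c where s: "sorted_as C a b c" "a < 1"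
      using sorted_light[OF C] by blast
    note h = sorted_asD(7)[OF s(1)]
    show ?thesis unfolding count3_def A sorted_heavy[OF assms(3) B] h using s(2) sorted_asD(1-6)[OF s(1)] by simp
  qed
  assume B: "\<not> heavy B" and C: "unit_block C" "\<not> heavy C"
  obtain a2 b2 c2 where s2: "sorted_as B a2 b2 c2" "a2 < 1"
    using sorted_light[OF assms(3) B] by blast
  note 2 = sorted_asD(1-3)[OF s2(1)] s2(2) sorted_asD(4,7)[OF s2(1)]
  obtain a3 b3 c3 where s3: "sorted_as C a3 b3 c3" "a3 < 1"
    using sorted_light[OF C] by blast
  note 3 = sorted_asD(1-3)[OF s3(1)] s3(2) sorted_asD(4,7)[OF s3(1)]
  have nn: "0 \<le> b2" "0 \<le> a2" "0 \<le> b3" "0 \<le> a3" using 2(1-5) 3(1-5) by linarith+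
  show "count3 A B C = 9 + 2 * count2 B C"
    using 2(1) 3(1) nn unfolding count3_def count2_def A 2(6) 3(6) by simp
qed

text \<open>\<open>t\<close> stands for the number of transversals actually present. A heavy block
  among \<open>A\<close> and \<open>B\<close> causes a loss in any case. With three light blocks,
  either some sum of two entries from different blocks reaches 1, which costs six transversals while
  \<open>gain\<close> is at most 12 y, or \<open>gain\<close> is 0.\<close>

lemma block_bound_light:
  assumes "unit_block A" "unit_block B" "unit_block C" "\<not> heavy C" "0 \<le> y" "t \<le> count3 A B C"
  shows "t + gain y A B C \<le> cap y" "t \<le> 26 \<or> 1/2 \<le> y \<Longrightarrow> t + gain y A B C \<le> cap y - 1/10"
proof -
  note cn = cap_numeric[OF assms(5)]
  have "t + gain y A B C \<le> cap y \<and> (t \<le> 26 \<or> 1/2 \<le> y \<longrightarrow> t + gain y A B C \<le> cap y - 1/10)"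
  proof (cases "heavy A \<or> heavy B")
    case True
    have key: "t + gain y A B C \<le> cap y - 1/10"
      if h: "unit_block A" "unit_block B" "heavy A" "t \<le> count3 A B C" for A B
    proof (cases "heavy B")
      case True
      have 1: "count1 A = 1" "count1 B = 1" "count1 C = 0" "count2 A B = 5" "count2 A C = 3" "count2 B C = 3" "count3 A B C = 15"
        using heavy_counts h assms True by (auto simp: heavy_def)
      have "t + gain y A B C \<le> 15 + 11 * y + 2 * y\<^sup>2"
        using h(4) unfolding gain_def 1 by (simp add: algebra_simps)
      then show ?thesis using cn(1) by linarith
    next
      case False
      have 1: "count1 A = 1" "count1 B = 0" "count1 C = 0" "count2 A B = 3" "count2 A C = 3" "count3 A B C = 9 + 2 * count2 B C"
        using heavy_counts h assms False by (auto simp: heavy_def)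
      have 2: "count2 B C \<le> 4" using count_bounds_light h False assms by blast
      then have "y * count2 B C \<le> y * 4" using assms(5) by (rule mult_left_mono)
      then have "t + gain y A B C \<le> 17 + 10 * y + y\<^sup>2"
        using h(4) 2 unfolding gain_def 1 by (simp add: algebra_simps)
      then show ?thesis using cn(2) by linarith
    qed
    have "t + gain y A B C \<le> cap y - 1/10"
    proof (cases "heavy A")
      case False
      then show ?thesis using True key[of B A] assms count_swap(2)[of B A] gain_swap(1)[of y A B] by auto
    qed (use key assms in blast)
    then show ?thesis by linarith
  next
    case False
    then have q: "count1 A = 0" "count1 B = 0" "count1 C = 0" using assms by (auto simp: heavy_def)
    have le: "0 \<le> count2 A B" "count2 A B \<le> 4" "0 \<le> count2 A C" "count2 A C \<le> 4" "0 \<le> count2 B C" "count2 B C \<le> 4"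
      using False assms count_bounds_light by blast+
    show ?thesis
    proof (cases "count2 A B = 0 \<and> count2 A C = 0 \<and> count2 B C = 0")
      case True
      then have "gain y A B C = 0" using q by (simp add: gain_def)
      then show ?thesis using assms(6) count3_le[of A B C] cn(5,6) by auto
    next
      case nz: False
      have "count3 A B C \<le> 21"
      proof -
        consider "count2 A B \<noteq> 0" | "count2 A C \<noteq> 0" | "count2 B C \<noteq> 0" using nz by blast
        then show ?thesis
        proof cases
          case 1 then show ?thesis using count_bounds_light(3)[of A B C] False assms by blast
        next
          case 2 then show ?thesis using count_bounds_light(3)[of A C B] False assms count_swap by metis
        next
          case 3 then show ?thesis using count_bounds_light(3)[of B C A] False assms count_swap by metis
        qed
      qed
      moreover have "y * (count2 A B + count2 A C + count2 B C) \<le> y * 12"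
        using assms(5) le by (intro mult_left_mono) auto
      then have "gain y A B C \<le> 12 * y" unfolding gain_def q by simp
      ultimately show ?thesis using assms(6) cn(3) by linarith
    qed
  qed
  then show "t + gain y A B C \<le> cap y" "t \<le> 26 \<or> 1/2 \<le> y \<Longrightarrow> t + gain y A B C \<le> cap y - 1/10" by auto
qed

lemma count3_permute:
  "count3 A B C = count3 C B A" "count3 A B C = count3 A C B"
  "gain y A B C = gain y C B A" "gain y A B C = gain y A C B"
  using count_swap gain_swap by metis+

text \<open>Unless all three blocks are heavy, a light block is permuted to the last place. Three
  heavy blocks give exactly the covering branch of \<open>cap\<close>, which is beaten by 27 for
  small \<open>y\<close>.\<close>

lemma block_bound:
  assumes u: "unit_block A" "unit_block B" "unit_block C" and "0 \<le> y" "t \<le> count3 A B C"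
  shows "t + gain y A B C \<le> cap y"
    and "\<not> (heavy A \<and> heavy B \<and> heavy C) \<Longrightarrow> t \<le> 26 \<or> 1/2 \<le> y \<Longrightarrow> t + gain y A B C \<le> cap y - 1/10"
    and "heavy A \<and> heavy B \<and> heavy C \<Longrightarrow> y \<le> 9/20 \<Longrightarrow> t + gain y A B C \<le> cap y - 1/10"
proof -
  note cn = cap_numeric[OF assms(4)]
  have H: "t + gain y A B C \<le> 19 + 15 * y + 3 * y\<^sup>2" if h: "heavy A \<and> heavy B \<and> heavy C"
  proof -
    have 1: "count1 A = 1" "count1 B = 1" "count1 C = 1" "count2 A B = 5" "count2 A C = 5" "count2 B C = 5" "count3 A B C = 19"
      using heavy_counts h u by auto
    show ?thesis using assms(5) unfolding gain_def 1 by (simp add: algebra_simps)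
  qed
  have L: "t + gain y A B C \<le> cap y \<and> (t \<le> 26 \<or> 1/2 \<le> y \<longrightarrow> t + gain y A B C \<le> cap y - 1/10)"
    if n: "\<not> (heavy A \<and> heavy B \<and> heavy C)"
  proof -
    consider "\<not> heavy C" | "\<not> heavy B" | "\<not> heavy A" using n by blast
    then show ?thesis
    proof cases
      case 1 then show ?thesis using block_bound_light[OF u(1,2,3)] assms by auto
    next
      case 2 then show ?thesis using block_bound_light[OF u(1,3,2), of y t] assms count3_permute(2,4) by auto
    next
      case 3 then show ?thesis using block_bound_light[OF u(3,2,1), of y t] assms count3_permute(1,3) by auto
    qed
  qed
  show "t + gain y A B C \<le> cap y" using H L cn(7) by fastforce
  show "t + gain y A B C \<le> cap y - 1/10" if "\<not> (heavy A \<and> heavy B \<and> heavy C)" "t \<le> 26 \<or> 1/2 \<le> y"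
    using L that by blast
  show "t + gain y A B C \<le> cap y - 1/10" if "heavy A \<and> heavy B \<and> heavy C" "y \<le> 9/20"
    using H that cn(4) by fastforce
qed

section \<open>Fractional matchings and covers\<close>

text \<open>A point \<open>p\<close> of the convex hull of the incidence vectors with least maximum coordinate \<open>v\<close> is an
  optimal fractional matching up to scaling. The weights are the normal of a hyperplane
  separating the hull from the orthant of vectors with all coordinates below \<open>v\<close>; since \<open>p\<close>
  lies on that hyperplane, complementary slackness holds.\<close>

lemma fractional_duality:
  fixes S :: "(real ^ 'k) set"
  assumes S: "finite S" "S \<noteq> {}" and nn: "\<And>x k. x \<in> S \<Longrightarrow> 0 \<le> x $ k" and pos: "\<And>x. x \<in> S \<Longrightarrow> (\<Sum>k\<in>UNIV. x $ k) = 3"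
  shows "\<exists>\<beta> w. (\<forall>x\<in>S. 0 \<le> \<beta> x) \<and> (\<forall>k. (\<Sum>x\<in>S. \<beta> x * x $ k) \<le> 1) \<and> (\<forall>k. 0 \<le> w $ k) \<and>
    (\<forall>x\<in>S. 1 \<le> w \<bullet> x) \<and> (\<forall>x\<in>S. 0 < \<beta> x \<longrightarrow> w \<bullet> x = 1) \<and>
    (\<forall>k. (\<Sum>x\<in>S. \<beta> x * x $ k) < 1 \<longrightarrow> w $ k = 0)"
proof -
  define P where "P = convex hull S"
  have P: "compact P" "P \<noteq> {}" "convex P" using S by (auto simp: P_def finite_imp_compact_convex_hull)
  have Pin: "(\<forall>k. 0 \<le> x $ k) \<and> (\<Sum>k\<in>UNIV. x $ k) = 3" if "x \<in> P" for x
  proof -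
    have "\<exists>u. (\<forall>x\<in>S. 0 \<le> u x) \<and> sum u S = 1 \<and> (\<Sum>x\<in>S. u x *\<^sub>R x) = x"
      using that unfolding P_def convex_hull_finite[OF S(1)] by simp
    then obtain u where u: "\<forall>x\<in>S. 0 \<le> u x" "sum u S = 1" "(\<Sum>x\<in>S. u x *\<^sub>R x) = x" by metis
    have c: "x $ k = (\<Sum>y\<in>S. u y * y $ k)" for k using u(3) by (auto simp: sum_component)
    have "(\<Sum>k\<in>UNIV. x $ k) = (\<Sum>y\<in>S. u y * (\<Sum>k\<in>UNIV. y $ k))"
      unfolding c sum_distrib_left by (rule sum.swap)
    also have "\<dots> = (\<Sum>y\<in>S. u y * 3)" by (intro sum.cong) (auto simp: pos)
    also have "\<dots> = 3" using u(2) by (simp flip: sum_distrib_right)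
    finally show ?thesis unfolding c using u(1) nn by (auto intro!: sum_nonneg)
  qed
  have "continuous_on P infnorm" by (rule continuous_on_subset[OF _ subset_UNIV]) (intro continuous_on_infnorm continuous_on_id)
  then obtain p where p: "p \<in> P" "\<And>q. q \<in> P \<Longrightarrow> infnorm p \<le> infnorm q"
    using continuous_attains_inf[OF P(1,2)] by blast
  define v where "v = infnorm p"
  have pv: "p $ k \<le> v" for k using component_le_infnorm_cart[of p k] unfolding v_def by linarith
  have "v \<noteq> 0"
  proof
    assume "v = 0"
    then have "p = 0" by (simp add: v_def infnorm_eq_0)
    then show False using Pin[OF p(1)] by simp
  qed
  then have v0: "0 < v" using infnorm_pos_le[of p] by (simp add: v_def)
  define Q where "Q = {q::real^'k. \<forall>k. q $ k < v}"
  have cQ: "convex Q"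
  proof -
    have "Q = (\<Inter>k. {q. q $ k < v})" by (auto simp: Q_def)
    moreover have "convex {q::real^'k. q $ k < v}" for k
      using convex_halfspace_lt[of "axis k 1 :: real ^ 'k" v] by (simp add: inner_axis' inner_real_def)
    ultimately show ?thesis by (simp add: convex_INT)
  qed
  have Q0: "0 \<in> Q" using v0 by (simp add: Q_def)
  have disj: "Q \<inter> P = {}"
  proof (rule ccontr)
    assume "Q \<inter> P \<noteq> {}"
    then obtain q where q: "q \<in> Q" "q \<in> P" by auto
    have "infnorm q < v" unfolding infnorm_Max
      using q Pin[OF q(2)] by (auto simp: Q_def Basis_vec_def inner_axis)
    then show False using p(2)[OF q(2)] by (simp add: v_def)
  qed
  obtain a b where ab: "a \<noteq> 0" "\<forall>x\<in>Q. a \<bullet> x \<le> b" "\<forall>x\<in>P. b \<le> a \<bullet> x"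
    using separating_hyperplane_sets[OF cQ P(3) _ P(2) disj] Q0 by blast
  \<comment> \<open>\<open>Q\<close> is unbounded in every negative coordinate direction, so a
    negative entry of the normal would make the functional unbounded above on
    \<open>Q\<close>.\<close>
  have a0: "0 \<le> a $ k" for k
  proof (rule ccontr)
    assume n: "\<not> 0 \<le> a $ k"
    define t where "t = (\<bar>b\<bar> + 1) / (a $ k)"
    have "t \<le> 0" using n by (simp add: t_def divide_nonneg_neg)
    then have "axis k t \<in> Q" using v0 by (auto simp: Q_def axis_def)
    then have "a \<bullet> axis k t \<le> b" using ab by blast
    then have "a $ k * t \<le> b" by (simp add: inner_axis)
    then show False using n by (simp add: t_def)
  qed
  define \<sigma> where "\<sigma> = (\<Sum>k\<in>UNIV. a $ k)"
  have \<sigma>0: "0 < \<sigma>"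
  proof -
    obtain k where "a $ k \<noteq> 0" using ab(1) by (auto simp: vec_eq_iff)
    then have "0 < a $ k" using a0[of k] by simp
    then show ?thesis unfolding \<sigma>_def using a0 by (intro sum_pos2[of UNIV k]) auto
  qed
  have bv: "v * \<sigma> \<le> b"
  proof (rule ccontr)
    assume n: "\<not> v * \<sigma> \<le> b"
    define e where "e = (v * \<sigma> - b) / (2 * \<sigma>)"
    have "0 < e" using n \<sigma>0 by (simp add: e_def)
    then have "(\<chi> k. v - e) \<in> Q" by (simp add: Q_def)
    then have "a \<bullet> (\<chi> k. v - e) \<le> b" using ab by blast
    moreover have "a \<bullet> (\<chi> k. v - e) = \<sigma> * (v - e)" by (simp add: inner_vec_def \<sigma>_def sum_distrib_right)
    moreover have "\<sigma> * e = (v * \<sigma> - b) / 2" using \<sigma>0 by (simp add: e_def)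
    moreover have "\<sigma> * (v - e) = v * \<sigma> - \<sigma> * e" by (simp add: algebra_simps)
    ultimately have "v * \<sigma> - (v * \<sigma> - b) / 2 \<le> b" by metis
    then show False using n by (simp add: field_simps)
  qed
  have ap: "a \<bullet> p \<le> v * \<sigma>"
    unfolding inner_vec_def \<sigma>_def sum_distrib_left using pv a0 by (auto intro!: sum_mono mult_left_mono simp: mult.commute[of v])
  have ap': "a \<bullet> p = v * \<sigma>" "b = v * \<sigma>" using ap ab(3) p(1) bv by force+
  have aS: "v * \<sigma> \<le> a \<bullet> x" if "x \<in> S" for x
    using ab(3) ap'(2) that hull_inc[of x S convex] by (auto simp: P_def)
  obtain u where u: "\<forall>x\<in>S. 0 \<le> u x" "sum u S = 1" "(\<Sum>x\<in>S. u x *\<^sub>R x) = p"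
    using p(1) unfolding P_def convex_hull_finite[OF S(1)] by auto
  have "(\<Sum>x\<in>S. u x * (a \<bullet> x - v * \<sigma>)) = a \<bullet> (\<Sum>x\<in>S. u x *\<^sub>R x) - sum u S * (v * \<sigma>)"
    by (simp add: inner_sum_right right_diff_distrib sum_subtractf sum_distrib_right)
  also have "\<dots> = 0" using u ap' by simp
  finally have "\<forall>x\<in>S. u x * (a \<bullet> x - v * \<sigma>) = 0"
    using sum_nonneg_eq_0_iff[OF S(1), of "\<lambda>x. u x * (a \<bullet> x - v * \<sigma>)"] u(1) aS by simp
  then have uS: "a \<bullet> x = v * \<sigma>" if "x \<in> S" "u x \<noteq> 0" for x using that by auto
  have "(\<Sum>k\<in>UNIV. a $ k * (v - p $ k)) = v * \<sigma> - a \<bullet> p"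
    by (simp add: inner_vec_def \<sigma>_def right_diff_distrib sum_subtractf sum_distrib_left mult.commute)
  then have "\<forall>k\<in>UNIV. a $ k * (v - p $ k) = 0"
    using sum_nonneg_eq_0_iff[of UNIV "\<lambda>k. a $ k * (v - p $ k)"] a0 pv ap' by simp
  then have slack: "a $ k = 0" if "p $ k < v" for k using that by force
  \<comment> \<open>Dividing by \<open>v\<close> brings the largest load to 1; dividing the normal
    by the level v \<sigma> of the hyperplane brings the weight of every matched vector to
    1.\<close>
  define \<beta> where "\<beta> = (\<lambda>x. u x / v)"
  define w where "w = (1 / (v * \<sigma>)) *\<^sub>R a"
  have load: "(\<Sum>x\<in>S. \<beta> x * x $ k) = p $ k / v" for k
    unfolding u(3)[symmetric] \<beta>_def by (simp add: sum_component sum_divide_distrib)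
  show ?thesis
  proof (intro exI[of _ \<beta>] exI[of _ w] conjI allI ballI impI)
    fix x assume x: "x \<in> S"
    show "0 \<le> \<beta> x" using u(1) v0 x by (simp add: \<beta>_def)
    show "1 \<le> w \<bullet> x" using aS[OF x] v0 \<sigma>0 by (simp add: w_def field_simps)
    show "w \<bullet> x = 1" if "0 < \<beta> x" using uS[OF x] that v0 \<sigma>0 by (simp add: w_def \<beta>_def zero_less_divide_iff)
  next
    fix k
    show "(\<Sum>x\<in>S. \<beta> x * x $ k) \<le> 1" unfolding load using pv[of k] v0 by simp
    show "0 \<le> w $ k" using a0[of k] v0 \<sigma>0 by (simp add: w_def)
    show "w $ k = 0" if "(\<Sum>x\<in>S. \<beta> x * x $ k) < 1"
      using slack[of k] that v0 unfolding load by (simp add: w_def)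
  qed
qed

text \<open>A triple may repeat a cell, which is then loaded with multiplicity. This keeps the
  coordinate sum of each incidence vector equal to 3.\<close>

definition load :: "(nat \<times> nat \<times> nat) set \<Rightarrow> (nat \<times> nat \<times> nat \<Rightarrow> real) \<Rightarrow> nat \<Rightarrow> real" where
  "load C \<beta> i = (\<Sum>e\<in>C. \<beta> e * sum3 (\<lambda>j. of_bool (j = i)) e)"

text \<open>Primal feasibility (fractional matching), dual feasibility (fractional cover) and both
  complementary slackness conditions; together they certify optimality.\<close>

definition optimal_pair :: "nat \<Rightarrow> (nat \<times> nat \<times> nat) set \<Rightarrow> (nat \<times> nat \<times> nat \<Rightarrow> real) \<Rightarrow> (nat \<Rightarrow> real) \<Rightarrow> bool" where
  "optimal_pair K C \<beta> w \<longleftrightarrow> (\<forall>e\<in>C. 0 \<le> \<beta> e) \<and> (\<forall>i<K. load C \<beta> i \<le> 1) \<and> (\<forall>i. 0 \<le> w i) \<and>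
    (\<forall>e\<in>C. 1 \<le> sum3 w e) \<and> (\<forall>e\<in>C. 0 < \<beta> e \<longrightarrow> sum3 w e = 1) \<and> (\<forall>i<K. load C \<beta> i < 1 \<longrightarrow> w i = 0)"

lemma sum_sum3: "(\<Sum>i\<in>I. g i * sum3 (\<lambda>j. h j i) e) = sum3 (\<lambda>j. \<Sum>i\<in>I. g i * h j i) e"
  by (cases e) (simp add: sum3_def algebra_simps sum.distrib)

lemma optimal_pair_exists:
  fixes C :: "(nat \<times> nat \<times> nat) set"
  assumes C: "C \<subseteq> {..<K} \<times> {..<K} \<times> {..<K}" "C \<noteq> {}" and K: "CARD('k::finite) = K"
  shows "\<exists>\<beta> w. optimal_pair K C \<beta> w"
proof -
  have fC: "finite C" using C finite_subset by blast
  obtain f where f: "bij_betw f (UNIV::'k set) {..<K}"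
    using ex_bij_betw_finite_nat[of "UNIV::'k set"] K by (auto simp: atLeast0LessThan)
  define V :: "nat \<times> nat \<times> nat \<Rightarrow> real ^ 'k" where "V = (\<lambda>e. \<chi> k. sum3 (\<lambda>j. of_bool (j = f k)) e)"
  have fl: "f k < K" for k using f by (auto simp: bij_betw_def)
  have ex1: "(\<Sum>k\<in>UNIV. g k * of_bool (i = f k)) = g (inv f i)" if "i < K" for g :: "'k \<Rightarrow> real" and i
  proof -
    have "i \<in> range f" using f that by (simp add: bij_betw_def)
    then obtain k where k: "i = f k" by blast
    have inj: "inj f" using f by (simp add: bij_betw_def)
    have "(\<Sum>k'\<in>UNIV. g k' * of_bool (i = f k')) = (\<Sum>k'\<in>UNIV. if k' = k then g k' else 0)"
      unfolding k using inj by (intro sum.cong) (auto simp: inj_eq)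
    then show ?thesis using inj by (simp add: k)
  qed
  have Vsum: "(\<Sum>k\<in>UNIV. g k * V e $ k) = sum3 (\<lambda>j. g (inv f j)) e" if "e \<in> C" for g e
  proof -
    have "(\<Sum>k\<in>UNIV. g k * V e $ k) = sum3 (\<lambda>j. \<Sum>k\<in>UNIV. g k * of_bool (j = f k)) e"
      unfolding V_def vec_lambda_beta by (rule sum_sum3)
    also have "\<dots> = sum3 (\<lambda>j. g (inv f j)) e"
    proof -
      obtain a b c where e: "e = (a, b, c)" by (cases e)
      then have "a < K" "b < K" "c < K" using that C(1) by auto
      then show ?thesis by (simp only: e sum3_def prod.case ex1)
    qed
    finally show ?thesis .
  qed
  define S where "S = V ` C"
  have S: "finite S" "S \<noteq> {}" using fC C by (auto simp: S_def)
  have nn: "0 \<le> x $ k" if "x \<in> S" for x k using that by (auto simp: S_def V_def sum3_def)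
  have pos: "(\<Sum>k\<in>UNIV. x $ k) = 3" if "x \<in> S" for x
    using that Vsum[of _ "\<lambda>_. 1"] by (auto simp: S_def sum3_def)
  obtain u w where uw: "\<forall>x\<in>S. 0 \<le> u x" "\<forall>k. (\<Sum>x\<in>S. u x * x $ k) \<le> 1" "\<forall>k. 0 \<le> w $ k"
    "\<forall>x\<in>S. 1 \<le> w \<bullet> x" "\<forall>x\<in>S. 0 < u x \<longrightarrow> w \<bullet> x = 1" "\<forall>k. (\<Sum>x\<in>S. u x * x $ k) < 1 \<longrightarrow> w $ k = 0"
    using fractional_duality[OF S nn pos] by blast
  \<comment> \<open>Permuted triples have the same incidence vector. The weight of a vector is
    placed on one chosen representative, the other triples get 0.\<close>
  define r where "r = inv_into C V"
  have r: "r x \<in> C" "V (r x) = x" if "x \<in> S" for x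
    using that by (auto simp: r_def S_def inv_into_into f_inv_into_f)
  define \<beta> where "\<beta> = (\<lambda>e. if e \<in> r ` S then u (V e) else 0)"
  define w' where "w' = (\<lambda>i. w $ inv f i)"
  have wV: "w \<bullet> V e = sum3 w' e" if "e \<in> C" for e
    unfolding inner_vec_def inner_real_def w'_def by (rule Vsum[OF that])
  have injr: "inj_on r S" using r by (metis inj_onI)
  have load: "load C \<beta> (f k) = (\<Sum>x\<in>S. u x * x $ k)" for k
  proof -
    have "load C \<beta> (f k) = (\<Sum>e\<in>C. \<beta> e * V e $ k)" by (simp add: load_def V_def)
    also have "\<dots> = (\<Sum>e\<in>r ` S. \<beta> e * V e $ k)"
      using r(1) fC by (intro sum.mono_neutral_right) (auto simp: \<beta>_def)
    also have "\<dots> = (\<Sum>x\<in>S. u x * x $ k)"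
      using injr r(2) by (simp add: sum.reindex \<beta>_def)
    finally show ?thesis .
  qed
  have sur: "\<exists>k. i = f k" if "i < K" for i
  proof -
    have "i \<in> range f" using f that by (simp add: bij_betw_def)
    then show ?thesis by blast
  qed
  have "optimal_pair K C \<beta> w'" unfolding optimal_pair_def
  proof (intro conjI ballI allI impI)
    fix e assume e: "e \<in> C"
    have VS: "V e \<in> S" using e by (simp add: S_def)
    show "0 \<le> \<beta> e" using uw(1) VS by (simp add: \<beta>_def)
    show "1 \<le> sum3 w' e" using uw(4) VS wV[OF e] by auto
    show "sum3 w' e = 1" if "0 < \<beta> e" using uw(5) VS wV[OF e] that by (auto simp: \<beta>_def split: if_splits)
  next
    fix i
    show "0 \<le> w' i" using uw(3) by (simp add: w'_def)
    assume i: "i < K"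
    obtain k where k: "i = f k" using sur[OF i] by blast
    show "load C \<beta> i \<le> 1" using uw(2) load k by simp
    have "inv f i = k" using f k by (simp add: bij_betw_def)
    then show "w' i = 0" if "load C \<beta> i < 1" using uw(6) load k that by (simp add: w'_def)
  qed
  then show ?thesis by blast
qed

section \<open>Counting edges by blocks\<close>

definition weights :: "(nat \<Rightarrow> real) \<Rightarrow> nat \<times> nat \<times> nat \<Rightarrow> block" where
  "weights w e = (case e of (i, j, l) \<Rightarrow> (w i, w j, w l))"

lemma sum3_weights: "sum3 h (weights w e) = sum3 (\<lambda>i. h (w i)) e"
  by (cases e) (simp add: weights_def sum3_def)

definition transversals :: "(nat \<times> nat \<times> nat) set \<Rightarrow> nat \<times> nat \<times> nat \<Rightarrow> nat \<times> nat \<times> nat \<Rightarrow> nat \<times> nat \<times> nat \<Rightarrow> real" where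
  "transversals D a b c = sum3 (\<lambda>i. sum3 (\<lambda>j. sum3 (\<lambda>l. of_bool ((i, j, l) \<in> D)) c) b) a"

lemma sum3_mono: "(\<And>i. h i \<le> g i) \<Longrightarrow> sum3 h e \<le> sum3 g e"
  by (cases e) (auto simp: sum3_def intro!: add_mono)

lemma sum3_scale: "sum3 (\<lambda>i. c * h i) e = c * sum3 h e"
  by (cases e) (simp add: sum3_def algebra_simps)

lemma sum3_add: "sum3 (\<lambda>i. h i + g i) e = sum3 h e + sum3 g e"
  by (cases e) (simp add: sum3_def)

lemma sum3_sum: "sum3 (\<lambda>i. \<Sum>x\<in>X. h i x) e = (\<Sum>x\<in>X. sum3 (\<lambda>i. h i x) e)"
  by (cases e) (simp add: sum3_def sum.distrib)

text \<open>Each cell has mass 1, of which \<open>load C \<beta> i\<close> belongs to blocks and the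
  rest is uncovered. \<open>in_blocks\<close> and \<open>off_blocks\<close> integrate over the two
  parts, so that sums over cells split exactly.\<close>

definition in_blocks :: "(nat \<times> nat \<times> nat) set \<Rightarrow> (nat \<times> nat \<times> nat \<Rightarrow> real) \<Rightarrow> (nat \<Rightarrow> real) \<Rightarrow> real" where
  "in_blocks C \<beta> h = (\<Sum>e\<in>C. \<beta> e * sum3 h e)"

definition off_blocks :: "nat \<Rightarrow> (nat \<times> nat \<times> nat) set \<Rightarrow> (nat \<times> nat \<times> nat \<Rightarrow> real) \<Rightarrow> (nat \<Rightarrow> real) \<Rightarrow> real" where
  "off_blocks K C \<beta> h = (\<Sum>i<K. (1 - load C \<beta> i) * h i)"

lemma sum_split_blocks:
  assumes "C \<subseteq> {..<K} \<times> {..<K} \<times> {..<K}"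
  shows "(\<Sum>i<K. h i) = in_blocks C \<beta> h + off_blocks K C \<beta> h"
proof -
  have "(\<Sum>i<K. load C \<beta> i * h i) = (\<Sum>e\<in>C. \<beta> e * (\<Sum>i<K. h i * sum3 (\<lambda>j. of_bool (j = i)) e))"
    unfolding load_def sum_distrib_right sum_distrib_left by (subst sum.swap) (simp add: mult_ac)
  also have "\<dots> = in_blocks C \<beta> h" unfolding in_blocks_def
  proof (rule sum.cong[OF refl])
    fix e assume "e \<in> C"
    then obtain a b c where e: "e = (a, b, c)" "a < K" "b < K" "c < K" using assms by (cases e) auto
    have "(\<Sum>i<K. h i * of_bool (x = i)) = h x" if "x < K" for x
    proof -
      have "(\<Sum>i<K. h i * of_bool (x = i)) = (\<Sum>i<K. if i = x then h i else 0)" by (intro sum.cong) auto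
      then show ?thesis using that by simp
    qed
    then show "\<beta> e * (\<Sum>i<K. h i * sum3 (\<lambda>j. of_bool (j = i)) e) = \<beta> e * sum3 h e"
      unfolding sum_sum3 by (simp only: e sum3_def prod.case)
  qed
  finally show ?thesis
    unfolding off_blocks_def by (simp add: left_diff_distrib sum_subtractf)
qed

locale optimal_blocks =
  fixes K :: nat and C :: "(nat \<times> nat \<times> nat) set" and \<beta> :: "nat \<times> nat \<times> nat \<Rightarrow> real" and w :: "nat \<Rightarrow> real"
  assumes C: "C \<subseteq> {..<K} \<times> {..<K} \<times> {..<K}" "C \<noteq> {}" and opt: "optimal_pair K C \<beta> w"
begin

abbreviation "SB \<equiv> in_blocks C \<beta>"
abbreviation "SO \<equiv> off_blocks K C \<beta>"
text \<open>The value of the fractional matching; \<open>Out\<close> is the mass it leaves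
  uncovered, as \<open>SO_1\<close> confirms.\<close>

definition "B = (\<Sum>e\<in>C. \<beta> e)"
definition "Out = real K - 3 * B"

lemma fC: "finite C" using C finite_subset by blast
lemma \<beta>_nonneg: "e \<in> C \<Longrightarrow> 0 \<le> \<beta> e" using opt by (simp add: optimal_pair_def)
lemma load_le: "i < K \<Longrightarrow> load C \<beta> i \<le> 1" using opt by (simp add: optimal_pair_def)
lemma w_nonneg: "0 \<le> w i" using opt by (simp add: optimal_pair_def)
lemma off_w: "i < K \<Longrightarrow> load C \<beta> i < 1 \<Longrightarrow> w i = 0" using opt by (simp add: optimal_pair_def)
lemma C_w: "e \<in> C \<Longrightarrow> 1 \<le> sum3 w e" using opt by (simp add: optimal_pair_def)

lemma unit_weights: "e \<in> C \<Longrightarrow> 0 < \<beta> e \<Longrightarrow> unit_block (weights w e)"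
  using opt by (cases e) (auto simp: optimal_pair_def weights_def unit_block_def sum3_def)

lemma SB_mono: "(\<And>i. h i \<le> g i) \<Longrightarrow> SB h \<le> SB g"
  unfolding in_blocks_def by (intro sum_mono mult_left_mono sum3_mono \<beta>_nonneg)

lemma SO_mono: "(\<And>i. h i \<le> g i) \<Longrightarrow> SO h \<le> SO g"
  unfolding off_blocks_def using load_le by (intro sum_mono mult_left_mono) auto

lemma SB_add: "SB (\<lambda>i. h i + g i) = SB h + SB g"
  by (simp add: in_blocks_def sum3_add distrib_left sum.distrib)

lemma SO_add: "SO (\<lambda>i. h i + g i) = SO h + SO g"
  by (simp add: off_blocks_def distrib_left sum.distrib)

lemma SB_scale: "SB (\<lambda>i. c * h i) = c * SB h"
  by (simp add: in_blocks_def sum3_scale sum_distrib_left mult_ac)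

lemma SO_scale: "SO (\<lambda>i. c * h i) = c * SO h"
  by (simp add: off_blocks_def sum_distrib_left mult_ac)

lemma SB_1: "SB (\<lambda>_. 1) = 3 * B"
  by (simp add: in_blocks_def B_def sum3_def flip: sum_distrib_right)

lemma SO_1: "SO (\<lambda>_. 1) = Out"
  using sum_split_blocks[OF C(1), of "\<lambda>_. 1" \<beta>] SB_1 by (simp add: Out_def)

text \<open>Complementary slackness: a cell with uncovered mass has weight 0.\<close>

lemma SO_hit: "SO (\<lambda>i. hit (c + w i)) = Out * hit c"
proof -
  have "SO (\<lambda>i. hit (c + w i)) = SO (\<lambda>i. hit c * 1)"
    unfolding off_blocks_def
  proof (rule sum.cong[OF refl])
    fix i assume "i \<in> {..<K}"
    then have "load C \<beta> i = 1 \<or> w i = 0" using load_le[of i] off_w[of i] by force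
    then show "(1 - load C \<beta> i) * hit (c + w i) = (1 - load C \<beta> i) * (hit c * 1)" by auto
  qed
  also have "\<dots> = hit c * Out" by (simp only: SO_scale SO_1)
  finally show ?thesis by simp
qed

lemma SO_hits: "SO (\<lambda>i. hit (w i)) = Out * hit 0" "SO (\<lambda>i. hit (w i + c)) = Out * hit c"
  "SO (\<lambda>i. hit (w i + c + d)) = Out * hit (c + d)" "SO (\<lambda>i. hit (c + w i + d)) = Out * hit (c + d)"
  using SO_hit[of 0] SO_hit[of c] SO_hit[of "c + d"] by (simp_all add: add_ac)

lemma SO_SB_swap: "SO (\<lambda>i. SB (h i)) = SB (\<lambda>j. SO (\<lambda>i. h i j))"
  unfolding off_blocks_def in_blocks_def sum3_sum sum_distrib_left sum3_scale
  by (subst sum.swap) (simp add: mult_ac)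

lemma Out_nonneg: "0 \<le> Out"
  unfolding SO_1[symmetric] off_blocks_def using load_le by (intro sum_nonneg) auto

text \<open>The cover gives weight at least 1 to some triple, hence positive weight to some cell,
  and such a cell is saturated by the matching.\<close>

lemma B_pos: "0 < B"
proof -
  obtain e where e: "e \<in> C" using C by auto
  obtain a b c where abc: "e = (a, b, c)" by (cases e)
  have "1 \<le> w a + w b + w c" using C_w[OF e] by (simp add: abc sum3_def)
  then have "0 < w a \<or> 0 < w b \<or> 0 < w c" by linarith
  moreover have "a < K" "b < K" "c < K" using e abc C(1) by auto
  ultimately obtain i where i: "i < K" "0 < w i" by blast
  then have l: "load C \<beta> i = 1" using off_w[of i] load_le[of i] by force
  have "load C \<beta> i \<le> (\<Sum>e\<in>C. \<beta> e * 3)" unfolding load_def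
  proof (intro sum_mono mult_left_mono \<beta>_nonneg)
    show "sum3 (\<lambda>j. of_bool (j = i)) e \<le> 3" for e :: "nat \<times> nat \<times> nat"
      by (cases e) (simp add: sum3_def)
  qed
  then show ?thesis using l by (simp add: B_def flip: sum_distrib_right)
qed

lemma SB_hit: "SB (\<lambda>i. hit (w i)) = (\<Sum>e\<in>C. \<beta> e * count1 (weights w e))"
  by (simp add: in_blocks_def count1_def sum3_weights hit_def)

lemma SB_SB_hit: "SB (\<lambda>i. SB (\<lambda>j. hit (w i + w j))) = (\<Sum>e\<in>C. \<Sum>f\<in>C. \<beta> e * \<beta> f * count2 (weights w e) (weights w f))"
  unfolding in_blocks_def count2_def sum3_weights hit_def sum3_sum sum_distrib_left sum3_scale
  by (simp add: mult_ac)

lemma SB_SB_SB: "SB (\<lambda>i. SB (\<lambda>j. SB (\<lambda>l. of_bool ((i, j, l) \<in> D))))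
  = (\<Sum>e\<in>C. \<Sum>f\<in>C. \<Sum>g\<in>C. \<beta> e * \<beta> f * \<beta> g * transversals D e f g)"
  unfolding in_blocks_def transversals_def sum3_sum sum_distrib_left sum3_scale
  by (simp add: mult_ac)

lemma transversals_le:
  assumes "\<And>i j l. (i, j, l) \<in> D \<Longrightarrow> 1 \<le> w i + w j + w l"
  shows "transversals D e f g \<le> count3 (weights w e) (weights w f) (weights w g)"
  unfolding transversals_def count3_def sum3_weights
  by (intro sum3_mono) (use assms in auto)

text \<open>Each of the three coordinates is split into its block part and its uncovered part, and
  the resulting eight terms are rewritten as one sum over triples of blocks.\<close>

lemma card_le_blocks:
  assumes D: "D \<subseteq> {..<K} \<times> {..<K} \<times> {..<K}" and wD: "\<And>i j l. (i, j, l) \<in> D \<Longrightarrow> 1 \<le> w i + w j + w l"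
  shows "real (card D) \<le> (\<Sum>e\<in>C. \<Sum>f\<in>C. \<Sum>g\<in>C. \<beta> e * \<beta> f * \<beta> g *
    (transversals D e f g + gain (Out / B) (weights w e) (weights w f) (weights w g)))"
proof -
  let ?f = "\<lambda>i j l. of_bool ((i, j, l) \<in> D) :: real"
  let ?G = "\<lambda>i j l. hit (w i + w j + w l)"
  have fG: "?f i j l \<le> ?G i j l" for i j l using wD by (auto simp: hit_def)
  note split = sum_split_blocks[OF C(1), where \<beta> = \<beta>]
  have "real (card D) = (\<Sum>x\<in>{..<K} \<times> {..<K} \<times> {..<K}. of_bool (x \<in> D))"
    using D by (simp add: Int_absorb1)
  also have "\<dots> = (\<Sum>i<K. \<Sum>j<K. \<Sum>l<K. ?f i j l)"
    unfolding sum.cartesian_product by (intro sum.cong refl) (simp add: case_prod_unfold)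
  also have "\<dots> = SB (\<lambda>i. SB (\<lambda>j. SB (?f i j))) + SB (\<lambda>i. SB (\<lambda>j. SO (?f i j)))
      + (SB (\<lambda>i. SO (\<lambda>j. SB (?f i j))) + SB (\<lambda>i. SO (\<lambda>j. SO (?f i j))))
      + (SO (\<lambda>i. SB (\<lambda>j. SB (?f i j))) + SO (\<lambda>i. SB (\<lambda>j. SO (?f i j)))
      + (SO (\<lambda>i. SO (\<lambda>j. SB (?f i j))) + SO (\<lambda>i. SO (\<lambda>j. SO (?f i j)))))"
    unfolding split SB_add SO_add by simp
  \<comment> \<open>Only terms with an uncovered coordinate are relaxed to the weight condition. The
    first keeps the membership in \<open>D\<close>, so that missing transversals remain
    visible.\<close>
  also have "\<dots> \<le> SB (\<lambda>i. SB (\<lambda>j. SB (?f i j))) + SB (\<lambda>i. SB (\<lambda>j. SO (?G i j)))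
      + (SB (\<lambda>i. SO (\<lambda>j. SB (?G i j))) + SB (\<lambda>i. SO (\<lambda>j. SO (?G i j))))
      + (SO (\<lambda>i. SB (\<lambda>j. SB (?G i j))) + SO (\<lambda>i. SB (\<lambda>j. SO (?G i j)))
      + (SO (\<lambda>i. SO (\<lambda>j. SB (?G i j))) + SO (\<lambda>i. SO (\<lambda>j. SO (?G i j)))))"
    by (intro add_mono order_refl SB_mono SO_mono fG)
  also have "\<dots> = SB (\<lambda>i. SB (\<lambda>j. SB (?f i j)))
      + 3 * Out * SB (\<lambda>i. SB (\<lambda>j. hit (w i + w j))) + 3 * Out\<^sup>2 * SB (\<lambda>i. hit (w i))"
    by (simp only: SO_SB_swap SO_hit SO_hits SB_scale SO_scale) (simp add: hit_def power2_eq_square algebra_simps)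
  finally have main: "real (card D) \<le> SB (\<lambda>i. SB (\<lambda>j. SB (?f i j)))
      + 3 * Out * SB (\<lambda>i. SB (\<lambda>j. hit (w i + w j))) + 3 * Out\<^sup>2 * SB (\<lambda>i. hit (w i))" .
  \<comment> \<open>Homogenisation: sums over one or two blocks become sums over three by factors
    \<open>B\<close>, and \<open>Out\<close> is written as (\<open>Out / B\<close>) times
    \<open>B\<close>.\<close>
  have tail: "3 * Out * SB (\<lambda>i. SB (\<lambda>j. hit (w i + w j))) + 3 * Out\<^sup>2 * SB (\<lambda>i. hit (w i))
    = (\<Sum>e\<in>C. \<Sum>f\<in>C. \<Sum>g\<in>C. \<beta> e * \<beta> f * \<beta> g * gain (Out / B) (weights w e) (weights w f) (weights w g))"
  proof -
    define y where "y = Out / B"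
    define q where "q = (\<lambda>e f. count2 (weights w e) (weights w f))"
    define c where "c = (\<lambda>e. count1 (weights w e))"
    define Q2 where "Q2 = (\<Sum>e\<in>C. \<Sum>f\<in>C. \<beta> e * \<beta> f * q e f)"
    define Q1 where "Q1 = (\<Sum>e\<in>C. \<beta> e * c e)"
    have B: "(\<Sum>e\<in>C. \<beta> e) = B" by (simp add: B_def)
    have nest: "(\<Sum>e\<in>C. \<Sum>f\<in>C. \<Sum>g\<in>C. \<beta> e * \<beta> f * \<beta> g * h e f g)
        = (\<Sum>e\<in>C. \<beta> e * (\<Sum>f\<in>C. \<beta> f * (\<Sum>g\<in>C. \<beta> g * h e f g)))" for h
      by (simp add: sum_distrib_left mult.assoc)
    have Q2: "Q2 = (\<Sum>e\<in>C. \<beta> e * (\<Sum>f\<in>C. \<beta> f * q e f))"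
      by (simp add: Q2_def sum_distrib_left mult.assoc)
    have const: "(\<Sum>g\<in>C. \<beta> g * x) = x * B" for x
      unfolding B_def sum_distrib_left by (simp add: mult.commute)
    have pull: "(\<Sum>e\<in>C. \<beta> e * (h e * x)) = (\<Sum>e\<in>C. \<beta> e * h e) * x" for h x
      by (simp add: sum_distrib_right mult.assoc)
    have g: "gain y (weights w e) (weights w f) (weights w g)
       = y * q e f + (y * q e g + (y * q f g + (y\<^sup>2 * c e + (y\<^sup>2 * c f + y\<^sup>2 * c g))))" for e f g
      by (simp add: gain_def q_def c_def algebra_simps)
    have "(\<Sum>e\<in>C. \<Sum>f\<in>C. \<Sum>g\<in>C. \<beta> e * \<beta> f * \<beta> g * gain y (weights w e) (weights w f) (weights w g))
      = y * (Q2 * B) + (y * (Q2 * B) + (y * (Q2 * B) + (y\<^sup>2 * (Q1 * B * B) + (y\<^sup>2 * (Q1 * B * B) + y\<^sup>2 * (Q1 * B * B)))))"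
    proof -
      have scale: "(\<Sum>e\<in>C. \<Sum>f\<in>C. \<Sum>g\<in>C. \<beta> e * \<beta> f * \<beta> g * (x * h e f g))
        = x * (\<Sum>e\<in>C. \<Sum>f\<in>C. \<Sum>g\<in>C. \<beta> e * \<beta> f * \<beta> g * h e f g)" for x h
        by (simp add: sum_distrib_left mult_ac)
      have "(\<Sum>e\<in>C. \<Sum>f\<in>C. \<Sum>g\<in>C. \<beta> e * \<beta> f * \<beta> g * q e f) = Q2 * B"
        unfolding nest const pull Q2 ..
      moreover have "(\<Sum>e\<in>C. \<Sum>f\<in>C. \<Sum>g\<in>C. \<beta> e * \<beta> f * \<beta> g * q e g) = Q2 * B"
        unfolding nest const pull Q2 ..
      moreover have "(\<Sum>e\<in>C. \<Sum>f\<in>C. \<Sum>g\<in>C. \<beta> e * \<beta> f * \<beta> g * q f g) = Q2 * B"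
        unfolding nest const pull Q2 ..
      moreover have "(\<Sum>e\<in>C. \<Sum>f\<in>C. \<Sum>g\<in>C. \<beta> e * \<beta> f * \<beta> g * c e) = Q1 * B * B"
        unfolding nest const pull Q1_def ..
      moreover have "(\<Sum>e\<in>C. \<Sum>f\<in>C. \<Sum>g\<in>C. \<beta> e * \<beta> f * \<beta> g * c f) = Q1 * B * B"
        unfolding nest const pull Q1_def ..
      moreover have "(\<Sum>e\<in>C. \<Sum>f\<in>C. \<Sum>g\<in>C. \<beta> e * \<beta> f * \<beta> g * c g) = Q1 * B * B"
        unfolding nest const pull Q1_def ..
      ultimately show ?thesis unfolding g distrib_left sum.distrib scale by simp
    qed
    also have "\<dots> = 3 * (y * B) * Q2 + 3 * (y * B)\<^sup>2 * Q1"
      by (simp add: power2_eq_square algebra_simps)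
    also have "y * B = Out" using B_pos by (simp add: y_def)
    finally show ?thesis unfolding SB_SB_hit SB_hit y_def Q2_def Q1_def q_def c_def by simp
  qed
  show ?thesis using main tail unfolding SB_SB_SB
    by (simp add: distrib_left sum.distrib)
qed

end

section \<open>Cells\<close>

definition cell :: "nat \<Rightarrow> nat \<Rightarrow> nat set" where
  "cell L i = {i * L..<Suc i * L}"

text \<open>Triples are ordered and cells may coincide, so degenerate choices of vertices have to be
  excluded by the cardinality condition; (i, i, i) is included when every triple inside cell
  \<open>i\<close> is an edge.\<close>

definition full_cells :: "nat \<Rightarrow> nat \<Rightarrow> nat set set \<Rightarrow> (nat \<times> nat \<times> nat) set" where
  "full_cells K L E = {(i, j, l). i < K \<and> j < K \<and> l < K \<and>
    (\<forall>x\<in>cell L i. \<forall>y\<in>cell L j. \<forall>z\<in>cell L l. card {x, y, z} = 3 \<longrightarrow> {x, y, z} \<in> E)}"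

lemma card_cell [simp]: "card (cell L i) = L" "finite (cell L i)"
  by (auto simp: cell_def)

lemma cell_less: "x' \<in> cell L i' \<Longrightarrow> x \<in> cell L i \<Longrightarrow> i' < i \<Longrightarrow> x' < x"
proof -
  assume a: "x' \<in> cell L i'" "x \<in> cell L i" "i' < i"
  then have "Suc i' * L \<le> i * L" by (intro mult_right_mono) auto
  then show ?thesis using a by (simp add: cell_def)
qed

lemma cell_disjoint: "x \<in> cell L i \<Longrightarrow> x \<in> cell L j \<Longrightarrow> i = j"
  using cell_less[of x L i x j] cell_less[of x L j x i] by (metis less_irrefl linorder_less_linear)

lemma in_cell_div: "0 < L \<Longrightarrow> x \<in> cell L (x div L)"
  using dividend_less_div_times[of L x] by (simp add: cell_def)

definition ordered_edges :: "nat set set \<Rightarrow> (nat \<times> nat \<times> nat) set" where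
  "ordered_edges E = {(x, y, z). card {x, y, z} = 3 \<and> {x, y, z} \<in> E}"

lemma card_ordered_edges:
  assumes "finite V" "E \<subseteq> triples V"
  shows "finite (ordered_edges E)" "card (ordered_edges E) = 6 * card E"
proof -
  have fE: "finite E" using assms finite_subset finite_triples by blast
  let ?O = "\<lambda>e. {(x, y, z). {x, y, z} = e}"
  have O: "finite (?O e) \<and> card (?O e) = 6" if ce: "card e = 3" for e :: "nat set"
  proof -
    obtain a b c where e: "e = {a, b, c}" "a \<noteq> b" "a \<noteq> c" "b \<noteq> c" using ce unfolding card_3_iff by blast
    have "?O e = {(a, b, c), (a, c, b), (b, a, c), (b, c, a), (c, a, b), (c, b, a)}"
    proof (intro equalityI subsetI)
      fix t assume "t \<in> ?O e"
      then obtain x y z where t: "t = (x, y, z)" "{x, y, z} = {a, b, c}" using e by (cases t) auto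
      have "x \<in> {a, b, c}" "y \<in> {a, b, c}" "z \<in> {a, b, c}" using t(2) by blast+
      moreover have "a \<in> {x, y, z}" "b \<in> {x, y, z}" "c \<in> {x, y, z}" using t(2) by blast+
      ultimately show "t \<in> {(a, b, c), (a, c, b), (b, a, c), (b, c, a), (c, a, b), (c, b, a)}"
        using t(1) e(2-4) by auto
    qed (use e in auto)
    then show ?thesis using e by simp
  qed
  have c3: "card e = 3" if "e \<in> E" for e using assms(2) that by (auto simp: triples_def)
  have eq: "ordered_edges E = (\<Union>e\<in>E. ?O e)"
    using c3 by (auto simp: ordered_edges_def)
  show "finite (ordered_edges E)" unfolding eq using fE O c3 by blast
  have "card (\<Union>e\<in>E. ?O e) = (\<Sum>e\<in>E. card (?O e))"
    using fE O c3 by (intro card_UN_disjoint) blast+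
  also have "\<dots> = (\<Sum>e\<in>E. 6)" using O c3 by (intro sum.cong) auto
  finally show "card (ordered_edges E) = 6 * card E" using eq by simp
qed

lemma full_cells_sub: "full_cells K L E \<subseteq> {..<K} \<times> {..<K} \<times> {..<K}"
  by (auto simp: full_cells_def)

text \<open>If a box of cells contains an edge, stability fills every box that is strictly lower in all
  three coordinates. So each diagonal contains at most one partially filled box.\<close>

lemma card_le_full_cells:
  assumes st: "stable {..<n} E" and E: "E \<subseteq> triples {..<n}" and L: "0 < L" "K * L \<le> n"
  shows "6 * card E \<le> (card (full_cells K L E) + 3 * K\<^sup>2) * L ^ 3 + 3 * (n - K * L) * n\<^sup>2"
proof -
  define N where "N = (\<lambda>i j l. i < K \<and> j < K \<and> l < K \<and> (\<exists>x\<in>cell L i. \<exists>y\<in>cell L j. \<exists>z\<in>cell L l. (x, y, z) \<in> ordered_edges E))"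
  define X where "X = {(i, j, l). N i j l} - full_cells K L E"
  have below: "(i, j, l) \<in> full_cells K L E" if "N i' j' l'" "i < i'" "j < j'" "l < l'" for i j l i' j' l'
  proof -
    obtain x y z where xyz: "x \<in> cell L i'" "y \<in> cell L j'" "z \<in> cell L l'" "card {x, y, z} = 3" "{x, y, z} \<in> E" "i' < K" "j' < K" "l' < K"
      using \<open>N i' j' l'\<close> by (auto simp: N_def ordered_edges_def)
    have "{x', y', z'} \<in> E" if "x' \<in> cell L i" "y' \<in> cell L j" "z' \<in> cell L l" "card {x', y', z'} = 3" for x' y' z'
      using stable_dominated[OF st E xyz(5,4), of x' y' z'] that xyz(1-3) \<open>i < i'\<close> \<open>j < j'\<close> \<open>l < l'\<close>
        cell_less less_imp_le by metis
    then show ?thesis using that xyz(6-8) by (auto simp: full_cells_def)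
  qed
  \<comment> \<open>Slides a box down its diagonal until some coordinate is 0. There are at most 3
    \<open>K\<close>^2 such end points, and by \<open>below\<close> no two partly filled boxes share
    one.\<close>
  define \<phi> where "\<phi> = (\<lambda>(i, j, l :: nat). let m = min i (min j l) in (i - m, j - m, l - m))"
  have inj: "inj_on \<phi> X"
  proof (rule inj_onI)
    fix p q assume pq: "p \<in> X" "q \<in> X" "\<phi> p = \<phi> q"
    obtain i j l i' j' l' where ijl: "p = (i, j, l)" "q = (i', j', l')" by (cases p, cases q)
    have X: "(i, j, l) \<in> X" "(i', j', l') \<in> X" and eq: "\<phi> (i, j, l) = \<phi> (i', j', l')"
      using pq ijl by auto
    define m m' where "m = min i (min j l)" and "m' = min i' (min j' l')"
    have le: "m \<le> i" "m \<le> j" "m \<le> l" "m' \<le> i'" "m' \<le> j'" "m' \<le> l'" by (auto simp: m_def m'_def)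
    have e: "i - m = i' - m'" "j - m = j' - m'" "l - m = l' - m'"
      using eq by (auto simp: \<phi>_def m_def m'_def Let_def)
    have "\<not> m < m'"
    proof
      assume "m < m'"
      then have "i < i'" "j < j'" "l < l'" using e le by linarith+
      then show False using below[of i' j' l' i j l] X by (auto simp: X_def)
    qed
    moreover have "\<not> m' < m"
    proof
      assume "m' < m"
      then have "i' < i" "j' < j" "l' < l" using e le by linarith+
      then show False using below[of i j l i' j' l'] X by (auto simp: X_def)
    qed
    ultimately have "m = m'" by linarith
    then have "i = i'" "j = j'" "l = l'" using e le by linarith+
    then show "p = q" using ijl by simp
  qed
  let ?Z = "{0} \<times> {..<K} \<times> {..<K} \<union> ({..<K} \<times> {0} \<times> {..<K} \<union> {..<K} \<times> {..<K} \<times> {0})"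
  have img: "\<phi> ` X \<subseteq> ?Z"
  proof
    fix t assume "t \<in> \<phi> ` X"
    then obtain i j l where t: "t = \<phi> (i, j, l)" "(i, j, l) \<in> X" by auto
    then have K: "i < K" "j < K" "l < K" by (auto simp: X_def N_def)
    define m where "m = min i (min j l)"
    have "t = (i - m, j - m, l - m)" using t by (simp add: \<phi>_def m_def Let_def)
    moreover have "m = i \<or> m = j \<or> m = l" by (auto simp: m_def min_def)
    ultimately show "t \<in> ?Z" using K by auto
  qed
  have "card X = card (\<phi> ` X)" using inj by (simp add: card_image)
  also have "\<dots> \<le> card ?Z" using img by (intro card_mono) auto
  also have "\<dots> \<le> card ({0::nat} \<times> {..<K} \<times> {..<K}) + (card ({..<K} \<times> {0::nat} \<times> {..<K}) + card ({..<K} \<times> {..<K} \<times> {0::nat}))"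
    by (meson add_left_mono card_Un_le le_trans)
  also have "\<dots> = 3 * K\<^sup>2" by (simp add: card_cartesian_product power2_eq_square)
  finally have cX: "card X \<le> 3 * K\<^sup>2" .
  let ?F = "full_cells K L E"
  let ?box = "\<lambda>(i, j, l). cell L i \<times> cell L j \<times> cell L l"
  have fF: "finite ?F" by (rule finite_subset[OF full_cells_sub]) simp
  have fX: "finite X" by (rule finite_subset[of _ "{..<K} \<times> {..<K} \<times> {..<K}"]) (auto simp: X_def N_def)
  \<comment> \<open>The vertices beyond the last cell; ordered edges using one of them are bounded
    trivially.\<close>
  let ?R = "{K * L..<n}"
  let ?big = "?R \<times> {..<n} \<times> {..<n} \<union> ({..<n} \<times> ?R \<times> {..<n} \<union> {..<n} \<times> {..<n} \<times> ?R)"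
  have "ordered_edges E \<subseteq> (\<Union>c\<in>?F \<union> X. ?box c) \<union> ?big"
  proof
    fix t assume t: "t \<in> ordered_edges E"
    obtain x y z where xyz: "t = (x, y, z)" by (cases t)
    have n: "x < n" "y < n" "z < n" using t E by (auto simp: xyz ordered_edges_def triples_def)
    show "t \<in> (\<Union>c\<in>?F \<union> X. ?box c) \<union> ?big"
    proof (cases "x < K * L \<and> y < K * L \<and> z < K * L")
      case True
      have "v div L < K" if "v < K * L" for v using that L by (simp add: less_mult_imp_div_less)
      then have "N (x div L) (y div L) (z div L)"
        unfolding N_def using True t xyz in_cell_div[OF L(1)] by blast
      then have "(x div L, y div L, z div L) \<in> ?F \<union> X" by (auto simp: X_def)
      moreover have "t \<in> ?box (x div L, y div L, z div L)" using in_cell_div[OF L(1)] by (simp add: xyz)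
      ultimately show ?thesis by blast
    next
      case False
      then show ?thesis using n by (auto simp: xyz)
    qed
  qed
  then have "card (ordered_edges E) \<le> card ((\<Union>c\<in>?F \<union> X. ?box c) \<union> ?big)"
    by (rule card_mono[rotated]) (use fF fX in auto)
  also have "\<dots> \<le> card (\<Union>c\<in>?F \<union> X. ?box c) + card ?big" by (rule card_Un_le)
  also have "card (\<Union>c\<in>?F \<union> X. ?box c) \<le> (\<Sum>c\<in>?F \<union> X. card (?box c))"
    using fF fX by (intro card_UN_le) simp
  also have "\<dots> = (\<Sum>c\<in>?F \<union> X. L ^ 3)"
    by (intro sum.cong) (auto simp: card_cartesian_product power3_eq_cube)
  also have "\<dots> \<le> (card ?F + 3 * K\<^sup>2) * L ^ 3"
    using card_Un_le[of ?F X] cX by (simp add: mult_right_mono) 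
  also have "card ?big \<le> card (?R \<times> {..<n} \<times> {..<n}) + (card ({..<n} \<times> ?R \<times> {..<n}) + card ({..<n} \<times> {..<n} \<times> ?R))"
    by (meson add_left_mono card_Un_le le_trans)
  also have "\<dots> = 3 * (n - K * L) * n\<^sup>2" by (simp add: card_cartesian_product power2_eq_square)
  finally show ?thesis using card_ordered_edges(2)[OF finite_lessThan E] by simp
qed

definition coord :: "nat \<times> nat \<times> nat \<Rightarrow> nat \<Rightarrow> nat" where
  "coord e c = (case e of (i, j, l) \<Rightarrow> if c = 0 then i else if c = 1 then j else l)"

text \<open>Round \<beta> e * L down to a number of copies of \<open>e\<close>. Since loads are at
  most 1, the copies use each cell at most \<open>L\<close> times and can be realised by distinct
  vertices. Rounding loses at most one edge for each of at most K^3 triples.\<close>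

lemma matching_from_weights:
  assumes E: "E \<subseteq> triples {..<n}" and nu: "nu_le E s"
    and opt: "optimal_pair K (full_cells K L E) \<beta> w"
  shows "(\<Sum>e\<in>full_cells K L E. \<beta> e) * real L \<le> real s + real K ^ 3"
proof -
  let ?C = "full_cells K L E"
  have fC: "finite ?C" by (rule finite_subset[OF full_cells_sub]) simp
  have \<beta>0: "0 \<le> \<beta> e" if "e \<in> ?C" for e using opt that by (simp add: optimal_pair_def)
  define m where "m = (\<lambda>e. nat \<lfloor>\<beta> e * L\<rfloor>)"
  have m: "real (m e) \<le> \<beta> e * L" "\<beta> e * L - 1 \<le> real (m e)" if "e \<in> ?C" for e
    using \<beta>0[OF that] by (auto simp: m_def of_nat_nat)
  \<comment> \<open>A slot (e, c, r) is the coordinate \<open>c\<close> of copy \<open>r\<close> of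
    triple \<open>e\<close>; \<open>Sl i\<close> collects the slots that demand a vertex of cell
    \<open>i\<close>.\<close>
  define Sl where "Sl = (\<lambda>i. {(e, c, r). e \<in> ?C \<and> c < 3 \<and> r < m e \<and> coord e c = i})"
  have Sl_eq: "Sl i = (SIGMA e:?C. {c. c < 3 \<and> coord e c = i} \<times> {..<m e})" for i
    by (auto simp: Sl_def)
  have cnt: "real (card {c. c < 3 \<and> coord e c = i}) = sum3 (\<lambda>j. of_bool (j = i)) e" for e i
  proof -
    have "{c. c < 3 \<and> coord e c = i} = {c \<in> {0, 1, 2::nat}. coord e c = i}" by auto
    moreover have "real (card {c \<in> {0, 1, 2::nat}. coord e c = i}) = (\<Sum>c\<in>{0, 1, 2::nat}. of_bool (coord e c = i))"
      by (simp add: Int_def)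
    ultimately show ?thesis by (cases e) (simp add: coord_def sum3_def)
  qed
  have fSl: "finite (Sl i)" for i unfolding Sl_eq using fC by auto
  have cSl: "card (Sl i) \<le> L" if "i < K" for i
  proof -
    have "real (card (Sl i)) = (\<Sum>e\<in>?C. real (m e) * sum3 (\<lambda>j. of_bool (j = i)) e)"
      unfolding Sl_eq using fC by (simp add: card_SigmaI card_cartesian_product cnt mult.commute)
    also have "\<dots> \<le> (\<Sum>e\<in>?C. (\<beta> e * L) * sum3 (\<lambda>j. of_bool (j = i)) e)"
    proof (intro sum_mono mult_right_mono m)
      show "0 \<le> sum3 (\<lambda>j. of_bool (j = i)) e" for e :: "nat \<times> nat \<times> nat" by (cases e) (simp add: sum3_def)
    qed
    also have "\<dots> = load ?C \<beta> i * L" by (simp add: load_def sum_distrib_left mult_ac)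
    also have "\<dots> \<le> 1 * real L" using opt that by (intro mult_right_mono) (auto simp: optimal_pair_def)
    finally show ?thesis by simp
  qed
  have "\<forall>i. \<exists>f. i < K \<longrightarrow> inj_on f (Sl i) \<and> f ` Sl i \<subseteq> cell L i"
  proof (intro allI)
    fix i
    show "\<exists>f. i < K \<longrightarrow> inj_on f (Sl i) \<and> f ` Sl i \<subseteq> cell L i"
    proof (cases "i < K")
      case True
      then have "card (Sl i) \<le> card (cell L i)" using cSl by simp
      then show ?thesis using card_le_inj[OF fSl] card_cell(2) by metis
    qed simp
  qed
  then obtain f where f: "\<And>i. i < K \<Longrightarrow> inj_on (f i) (Sl i)" "\<And>i. i < K \<Longrightarrow> f i ` Sl i \<subseteq> cell L i"
    by metis
  define g where "g = (\<lambda>e c r. f (coord e c) (e, c, r))"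
  have cK: "coord e c < K" if "e \<in> ?C" for e c using that full_cells_sub by (cases e) (force simp: coord_def)
  have gcell: "g e c r \<in> cell L (coord e c)" if "e \<in> ?C" "c < 3" "r < m e" for e c r
    using f(2)[OF cK[OF that(1)]] that by (force simp: g_def Sl_def)
  have ginj: "e = e' \<and> c = c' \<and> r = r'" if "g e c r = g e' c' r'" "e \<in> ?C" "c < 3" "r < m e" "e' \<in> ?C" "c' < 3" "r' < m e'" for e c r e' c' r'
  proof -
    have same: "coord e c = coord e' c'" using gcell[OF that(2-4)] gcell[OF that(5-7)] that(1) cell_disjoint by metis
    have "(e, c, r) \<in> Sl (coord e c)" "(e', c', r') \<in> Sl (coord e c)" using that same by (auto simp: Sl_def)
    then have "(e, c, r) = (e', c', r')"
      using f(1)[OF cK[OF that(2)]] that(1) same by (metis g_def inj_onD)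
    then show ?thesis by simp
  qed
  define ed where "ed = (\<lambda>(e, r). {g e 0 r, g e 1 r, g e 2 r})"
  define I where "I = (SIGMA e:?C. {..<m e})"
  have edE: "ed (e, r) \<in> E" if "e \<in> ?C" "r < m e" for e r
  proof -
    have ne: "g e c r \<noteq> g e c' r" if "c < 3" "c' < 3" "c \<noteq> c'" for c c'
      using ginj[of e c r e c' r] that \<open>e \<in> ?C\<close> \<open>r < m e\<close> by blast
    have "card {g e 0 r, g e 1 r, g e 2 r} = 3" using ne[of 0 1] ne[of 0 2] ne[of 1 2] by simp
    moreover obtain i j l where e: "e = (i, j, l)" by (cases e)
    moreover have "g e 0 r \<in> cell L i" "g e 1 r \<in> cell L j" "g e 2 r \<in> cell L l"
      using gcell[OF that(1) _ that(2), of 0] gcell[OF that(1) _ that(2), of 1] gcell[OF that(1) _ that(2), of 2]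
      by (auto simp: e coord_def)
    ultimately show ?thesis using that(1) unfolding ed_def by (auto simp: full_cells_def)
  qed
  have disj: "ed p \<inter> ed q = {}" if pq: "p \<in> I" "q \<in> I" "p \<noteq> q" for p q
  proof (rule ccontr)
    assume "ed p \<inter> ed q \<noteq> {}"
    then obtain v where v: "v \<in> ed p" "v \<in> ed q" by blast
    obtain e r e' r' where er: "p = (e, r)" "q = (e', r')" by (cases p, cases q)
    have ex: "\<exists>c<3. v = g e c r" if "v \<in> ed (e, r)" for e r
    proof -
      have "v = g e 0 r \<or> v = g e 1 r \<or> v = g e 2 r" using that by (simp add: ed_def)
      moreover have "0 < (3::nat)" "1 < (3::nat)" "2 < (3::nat)" by auto
      ultimately show ?thesis by blast
    qed
    obtain c c' where "c < 3" "v = g e c r" "c' < 3" "v = g e' c' r'" using ex v er by blast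
    moreover have "e \<in> ?C" "r < m e" "e' \<in> ?C" "r' < m e'" using pq(1,2) er by (auto simp: I_def)
    ultimately have "e = e' \<and> r = r'" using ginj[of e c r e' c' r'] by simp
    then show False using pq(3) er by simp
  qed
  have mat: "is_matching E (ed ` I)" unfolding is_matching_def
    using edE disj by (auto simp: I_def) blast+
  have "inj_on ed I"
  proof (rule inj_onI, rule ccontr)
    fix p q assume "p \<in> I" "q \<in> I" "ed p = ed q" "p \<noteq> q"
    then have "ed p = {}" using disj by blast
    then show False by (cases p) (simp add: ed_def)
  qed
  then have "card (ed ` I) = (\<Sum>e\<in>?C. m e)" using fC by (simp add: card_image I_def)
  then have "(\<Sum>e\<in>?C. m e) \<le> s" using nu_leD[OF nu mat] by simp
  then have "(\<Sum>e\<in>?C. real (m e)) \<le> real s" by (metis of_nat_le_iff of_nat_sum)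
  moreover have "(\<Sum>e\<in>?C. \<beta> e * L - 1) \<le> (\<Sum>e\<in>?C. real (m e))" by (intro sum_mono m)
  moreover have "(\<Sum>e\<in>?C. \<beta> e * L - 1) = (\<Sum>e\<in>?C. \<beta> e) * L - card ?C"
    by (simp add: sum_subtractf sum_distrib_right)
  moreover have "card ?C \<le> card ({..<K} \<times> {..<K} \<times> {..<K})" using full_cells_sub by (intro card_mono) auto
  then have "real (card ?C) \<le> real K ^ 3" by (simp add: card_cartesian_product power3_eq_cube flip: of_nat_mult)
  ultimately show ?thesis by linarith
qed

section \<open>Stability for block weights\<close>

context optimal_blocks
begin

definition "ratio = Out / B"
definition "big e \<longleftrightarrow> heavy (weights w e)"
definition "mass P = (\<Sum>e\<in>C. \<Sum>f\<in>C. \<Sum>g\<in>C. \<beta> e * \<beta> f * \<beta> g * of_bool (P e f g))"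
text \<open>The situations in which \<open>block_bound\<close> improves by 1/10, with
  \<open>t\<close> the number of transversals in \<open>C\<close>.\<close>

definition "defect e f g \<longleftrightarrow>
  (if big e \<and> big f \<and> big g then ratio \<le> 9/20 else transversals C e f g \<le> 26 \<or> 1/2 \<le> ratio)"
definition "big_mass = (\<Sum>e\<in>C. \<beta> e * of_bool (big e))"

lemma ratio_nonneg: "0 \<le> ratio"
  using Out_nonneg B_pos by (simp add: ratio_def)

lemma C_sum: "(i, j, l) \<in> C \<Longrightarrow> 1 \<le> w i + w j + w l"
  using C_w[of "(i, j, l)"] by (simp add: sum3_def)

lemma prod3: "(\<Sum>e\<in>C. \<Sum>f\<in>C. \<Sum>g\<in>C. \<beta> e * \<beta> f * \<beta> g * (h1 e * h2 f * h3 g))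
   = (\<Sum>e\<in>C. \<beta> e * h1 e) * (\<Sum>f\<in>C. \<beta> f * h2 f) * (\<Sum>g\<in>C. \<beta> g * h3 g)"
proof -
  have "(\<Sum>e\<in>C. \<Sum>f\<in>C. \<Sum>g\<in>C. \<beta> e * \<beta> f * \<beta> g * (h1 e * h2 f * h3 g))
    = (\<Sum>e\<in>C. (\<beta> e * h1 e) * (\<Sum>f\<in>C. (\<beta> f * h2 f) * (\<Sum>g\<in>C. \<beta> g * h3 g)))"
    by (simp add: sum_distrib_left mult_ac)
  then show ?thesis unfolding sum_distrib_right[symmetric] by (simp only: mult.assoc)
qed

lemma const3: "(\<Sum>e\<in>C. \<Sum>f\<in>C. \<Sum>g\<in>C. \<beta> e * \<beta> f * \<beta> g * x) = B ^ 3 * x"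
proof -
  have "(\<Sum>e\<in>C. \<Sum>f\<in>C. \<Sum>g\<in>C. \<beta> e * \<beta> f * \<beta> g * (x * 1 * 1)) = (\<Sum>e\<in>C. \<beta> e * x) * (\<Sum>e\<in>C. \<beta> e * 1) * (\<Sum>e\<in>C. \<beta> e * 1)"
    by (rule prod3)
  also have "(\<Sum>e\<in>C. \<beta> e * x) = B * x" by (simp add: B_def sum_distrib_right)
  finally show ?thesis by (simp add: B_def power3_eq_cube)
qed

lemma mass_mono:
  assumes "\<And>e f g. \<lbrakk>e \<in> C; f \<in> C; g \<in> C; P e f g\<rbrakk> \<Longrightarrow> Q e f g"
  shows "mass P \<le> mass Q"
  unfolding mass_def
proof (intro sum_mono mult_left_mono)
  fix e f g assume "e \<in> C" "f \<in> C" "g \<in> C"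
  then show "(of_bool (P e f g) :: real) \<le> of_bool (Q e f g)" "0 \<le> \<beta> e * \<beta> f * \<beta> g"
    using assms \<beta>_nonneg by auto
qed

text \<open>Only a positive \<beta> guarantees that the weights of a triple sum to 1; triples of
  weight 0 are separated because both sides vanish there.\<close>

lemma card_le_blockwise:
  assumes "D \<subseteq> {..<K} \<times> {..<K} \<times> {..<K}" and wD: "\<And>i j l. (i, j, l) \<in> D \<Longrightarrow> 1 \<le> w i + w j + w l"
    and x: "\<And>e f g. \<lbrakk>unit_block (weights w e); unit_block (weights w f); unit_block (weights w g);
        transversals D e f g \<le> count3 (weights w e) (weights w f) (weights w g)\<rbrakk> \<Longrightarrow>
      transversals D e f g + gain ratio (weights w e) (weights w f) (weights w g) \<le> x e f g"
  shows "real (card D) \<le> (\<Sum>e\<in>C. \<Sum>f\<in>C. \<Sum>g\<in>C. \<beta> e * \<beta> f * \<beta> g * x e f g)"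
proof -
  have "real (card D) \<le> (\<Sum>e\<in>C. \<Sum>f\<in>C. \<Sum>g\<in>C. \<beta> e * \<beta> f * \<beta> g *
      (transversals D e f g + gain ratio (weights w e) (weights w f) (weights w g)))"
    unfolding ratio_def by (rule card_le_blocks[OF assms(1) wD])
  also have "\<dots> \<le> (\<Sum>e\<in>C. \<Sum>f\<in>C. \<Sum>g\<in>C. \<beta> e * \<beta> f * \<beta> g * x e f g)"
  proof (intro sum_mono)
    fix e f g assume efg: "e \<in> C" "f \<in> C" "g \<in> C"
    show "\<beta> e * \<beta> f * \<beta> g * (transversals D e f g + gain ratio (weights w e) (weights w f) (weights w g))
      \<le> \<beta> e * \<beta> f * \<beta> g * x e f g"
    proof (cases "\<beta> e = 0 \<or> \<beta> f = 0 \<or> \<beta> g = 0")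
      case False
      then have p: "0 < \<beta> e" "0 < \<beta> f" "0 < \<beta> g" using \<beta>_nonneg[OF efg(1)] \<beta>_nonneg[OF efg(2)] \<beta>_nonneg[OF efg(3)] by auto
      then show ?thesis
        using x[OF unit_weights[OF efg(1)] unit_weights[OF efg(2)] unit_weights[OF efg(3)] transversals_le[OF wD]]
        by (intro mult_left_mono) auto
    qed auto
  qed
  finally show ?thesis .
qed

lemma card_C_le: "real (card C) \<le> B ^ 3 * cap ratio - mass defect / 10"
proof -
  have "real (card C) \<le> (\<Sum>e\<in>C. \<Sum>f\<in>C. \<Sum>g\<in>C. \<beta> e * \<beta> f * \<beta> g * (cap ratio - of_bool (defect e f g) / 10))"
  proof (rule card_le_blockwise[OF C(1) C_sum])
    fix e f g assume u: "unit_block (weights w e)" "unit_block (weights w f)" "unit_block (weights w g)"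
      and t: "transversals C e f g \<le> count3 (weights w e) (weights w f) (weights w g)"
    note b = block_bound[OF u ratio_nonneg t]
    show "transversals C e f g + gain ratio (weights w e) (weights w f) (weights w g) \<le> cap ratio - of_bool (defect e f g) / 10"
    proof (cases "defect e f g")
      case True
      then show ?thesis using b(2,3) by (auto simp: defect_def big_def split: if_splits)
    qed (use b(1) in simp)
  qed
  also have "\<dots> = B ^ 3 * cap ratio - mass defect / 10"
    by (simp add: right_diff_distrib sum_subtractf const3 mass_def sum_divide_distrib)
  finally show ?thesis .
qed

text \<open>The same upper bound holds for all triples of cells of weight at least 1, a superset of
  \<open>C\<close>. Hence \<open>C\<close> is nearly all of that set, which
  \<open>blocks_structure\<close> exploits in the covering case.\<close>

lemma card_weighted_le:
  "real (card {(i, j, l). i < K \<and> j < K \<and> l < K \<and> 1 \<le> w i + w j + w l}) \<le> B ^ 3 * cap ratio"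
  unfolding const3[symmetric] by (rule card_le_blockwise) (auto intro: block_bound(1) ratio_nonneg)

lemma big_mass_bounds: "0 \<le> big_mass" "big_mass \<le> B"
  unfolding big_mass_def B_def using \<beta>_nonneg by (auto intro!: sum_nonneg sum_mono)

lemma small_mass: "(\<Sum>e\<in>C. \<beta> e * of_bool (\<not> big e)) = B - big_mass"
proof -
  have "(\<Sum>e\<in>C. \<beta> e * of_bool (\<not> big e)) + big_mass = B"
    unfolding big_mass_def B_def sum.distrib[symmetric] by (intro sum.cong) auto
  then show ?thesis by simp
qed

lemma mass_big: "mass (\<lambda>e f g. big e \<and> big f \<and> big g) = big_mass ^ 3"
proof -
  have "mass (\<lambda>e f g. big e \<and> big f \<and> big g)
    = (\<Sum>e\<in>C. \<Sum>f\<in>C. \<Sum>g\<in>C. \<beta> e * \<beta> f * \<beta> g * (of_bool (big e) * of_bool (big f) * of_bool (big g)))"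
    unfolding mass_def by (intro sum.cong refl) auto
  also have "\<dots> = big_mass ^ 3" unfolding prod3 by (simp add: big_mass_def power3_eq_cube)
  finally show ?thesis .
qed

lemma mass_small: "mass (\<lambda>e f g. \<not> big e \<and> \<not> big f \<and> \<not> big g) = (B - big_mass) ^ 3"
proof -
  have "mass (\<lambda>e f g. \<not> big e \<and> \<not> big f \<and> \<not> big g)
    = (\<Sum>e\<in>C. \<Sum>f\<in>C. \<Sum>g\<in>C. \<beta> e * \<beta> f * \<beta> g * (of_bool (\<not> big e) * of_bool (\<not> big f) * of_bool (\<not> big g)))"
    unfolding mass_def by (intro sum.cong refl) auto
  also have "\<dots> = (B - big_mass) ^ 3" unfolding prod3 small_mass by (simp add: power3_eq_cube)
  finally show ?thesis .
qed

lemma mass_add: "(\<And>e f g. \<not> (P e f g \<and> Q e f g)) \<Longrightarrow> mass (\<lambda>e f g. P e f g \<or> Q e f g) = mass P + mass Q"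
  unfolding mass_def sum.distrib[symmetric] by (intro sum.cong refl) (auto simp: algebra_simps)

lemma mass_True: "mass (\<lambda>_ _ _. True) = B ^ 3"
  using const3[of 1] by (simp add: mass_def)

text \<open>By \<open>heavy_counts\<close>, two heavy blocks and a light one leave 15 sums, one
  heavy block and two light ones at most 9 + 2 * 4.\<close>

lemma mixed_defect:
  assumes "e \<in> C" "f \<in> C" "g \<in> C" "0 < \<beta> e" "0 < \<beta> f" "0 < \<beta> g"
    and "\<not> (big e \<and> big f \<and> big g)" "\<not> (\<not> big e \<and> \<not> big f \<and> \<not> big g)"
  shows "transversals C e f g \<le> 26"
proof -
  let ?W = "weights w"
  have u: "unit_block (?W e)" "unit_block (?W f)" "unit_block (?W g)" using unit_weights assms by auto
  have le: "count3 A B C \<le> 26" if h: "unit_block A" "unit_block B" "unit_block C" "heavy A" for A B C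
  proof -
    consider "heavy B" "heavy C" | "heavy B" "\<not> heavy C" | "\<not> heavy B" "heavy C" | "\<not> heavy B" "\<not> heavy C" by blast
    then show ?thesis
    proof cases
      case 3
      then show ?thesis using heavy_counts(5)[OF h(1,4,3), of B] h count3_permute(2)[of A B C] by simp
    next
      case 4
      then show ?thesis using heavy_counts(6)[OF h(1,4,2), of C] h count_bounds_light(1)[of B C] by simp
    qed (use heavy_counts(4,5)[OF h(1,4,2), of C] h in auto)
  qed
  have "heavy (?W e) \<or> heavy (?W f) \<or> heavy (?W g)" using assms(8) by (auto simp: big_def)
  then have "count3 (?W e) (?W f) (?W g) \<le> 26"
    using le[OF u(1,2,3)] le[OF u(2,1,3)] le[OF u(3,2,1)] count_swap(2) count3_permute(1) by metis
  then show ?thesis using transversals_le[of C e f g, OF C_sum] by linarith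
qed

text \<open>With q = \<open>big_mass / B\<close> the left side is 3 q (1 - q) B^3, the mass of mixed
  triples of blocks. Few defects thus force q to be near 0 or near 1.\<close>

lemma mass_defect_ge_mixed: "B ^ 3 - big_mass ^ 3 - (B - big_mass) ^ 3 \<le> mass defect"
proof -
  let ?m = "\<lambda>e f g. \<not> (big e \<and> big f \<and> big g) \<and> \<not> (\<not> big e \<and> \<not> big f \<and> \<not> big g)"
  have "mass (\<lambda>_ _ _. True) = mass (\<lambda>e f g. ?m e f g \<or> ((big e \<and> big f \<and> big g) \<or> (\<not> big e \<and> \<not> big f \<and> \<not> big g)))"
    unfolding mass_def by (intro sum.cong refl) auto
  also have "\<dots> = mass ?m + (big_mass ^ 3 + (B - big_mass) ^ 3)"
    by (subst mass_add, blast, subst mass_add) (auto simp: mass_big mass_small)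
  finally have "B ^ 3 - big_mass ^ 3 - (B - big_mass) ^ 3 = mass ?m" using mass_True by simp
  also have "\<dots> \<le> mass defect" unfolding mass_def
  proof (intro sum_mono)
    fix e f g assume efg: "e \<in> C" "f \<in> C" "g \<in> C"
    show "\<beta> e * \<beta> f * \<beta> g * of_bool (?m e f g) \<le> \<beta> e * \<beta> f * \<beta> g * of_bool (defect e f g)"
    proof (cases "\<beta> e = 0 \<or> \<beta> f = 0 \<or> \<beta> g = 0")
      case False
      then have p: "0 < \<beta> e" "0 < \<beta> f" "0 < \<beta> g" using \<beta>_nonneg[OF efg(1)] \<beta>_nonneg[OF efg(2)] \<beta>_nonneg[OF efg(3)] by auto
      have "?m e f g \<Longrightarrow> defect e f g" using mixed_defect[OF efg p] by (auto simp: defect_def)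
      then show ?thesis using p by (intro mult_left_mono) auto
    qed auto
  qed
  finally show ?thesis .
qed

lemma transversals_miss:
  assumes "i \<in> {coord e 0, coord e 1, coord e 2}" "j \<in> {coord f 0, coord f 1, coord f 2}"
    "l \<in> {coord g 0, coord g 1, coord g 2}" "(i, j, l) \<notin> D"
  shows "transversals D e f g \<le> 26"
proof -
  obtain e0 e1 e2 f0 f1 f2 g0 g1 g2 where efg: "e = (e0, e1, e2)" "f = (f0, f1, f2)" "g = (g0, g1, g2)"
    by (cases e, cases f, cases g)
  define h where "h = (\<lambda>i j l. of_bool ((i, j, l) \<in> D) :: real)"
  have h1: "h i j l \<le> 1" for i j l by (simp add: h_def)
  have s1: "sum3 (h i j) g \<le> 3" for i j using sum3_le[of "h i j" 1 g] h1 by simp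
  have s2: "sum3 (\<lambda>j. sum3 (h i j) g) f \<le> 9" for i using sum3_le[of "\<lambda>j. sum3 (h i j) g" 3 f] s1 by simp
  have z: "h i j l = 0" using assms(4) by (simp add: h_def)
  have t1: "sum3 (h i j) g \<le> 2"
    using assms(3) z h1[of i j g0] h1[of i j g1] h1[of i j g2] by (auto simp: efg sum3_def coord_def)
  have t2: "sum3 (\<lambda>j. sum3 (h i j) g) f \<le> 8"
    using assms(2) t1 s1[of i f0] s1[of i f1] s1[of i f2] by (auto simp: efg(2) sum3_def[of _ "(f0, f1, f2)"] coord_def)
  have "sum3 (\<lambda>i. sum3 (\<lambda>j. sum3 (h i j) g) f) e \<le> 26"
    using assms(1) t2 s2[of e0] s2[of e1] s2[of e2] by (auto simp: efg(1) sum3_def[of _ "(e0, e1, e2)"] coord_def)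
  then show ?thesis by (simp add: transversals_def h_def)
qed

text \<open>The blocks have total mass 3 B on the cells, of which the cells below \<open>k\<close>
  carry at most \<open>k\<close>; a block entirely below \<open>k\<close> takes 3 of this per unit
  of weight.\<close>

lemma high_block_mass:
  "B - real k / 3 \<le> (\<Sum>e\<in>C. \<beta> e * of_bool (\<exists>i\<in>{coord e 0, coord e 1, coord e 2}. k \<le> i))"
proof -
  have "3 * B = (\<Sum>e\<in>C. \<beta> e * 3)" by (simp add: B_def sum_distrib_right[symmetric])
  also have "\<dots> = (\<Sum>e\<in>C. \<beta> e * sum3 (\<lambda>i. of_bool (i < k)) e) + (\<Sum>e\<in>C. \<beta> e * sum3 (\<lambda>i. of_bool (k \<le> i)) e)"
    unfolding sum.distrib[symmetric] distrib_left[symmetric] sum3_add[symmetric]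
    by (intro sum.cong refl) (auto simp: sum3_def split: prod.splits)
  also have "(\<Sum>e\<in>C. \<beta> e * sum3 (\<lambda>i. of_bool (i < k)) e) \<le> real k"
  proof -
    have "SB (\<lambda>i. of_bool (i < k)) + SO (\<lambda>i. of_bool (i < k)) = (\<Sum>i<K. of_bool (i < k))"
      using sum_split_blocks[OF C(1)] by simp
    moreover have "0 \<le> SO (\<lambda>i. of_bool (i < k))"
      unfolding off_blocks_def using load_le by (intro sum_nonneg) auto
    moreover have "(\<Sum>i<K. of_bool (i < k) :: real) \<le> real k"
    proof -
      have "(\<Sum>i<K. of_bool (i < k) :: real) = real (card ({..<K} \<inter> {i. i < k}))" by simp
      also have "card ({..<K} \<inter> {i. i < k}) \<le> card {..<k}" by (intro card_mono) auto
      finally show ?thesis by simp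
    qed
    ultimately show ?thesis by (simp add: in_blocks_def)
  qed
  also have "(\<Sum>e\<in>C. \<beta> e * sum3 (\<lambda>i. of_bool (k \<le> i)) e)
     \<le> (\<Sum>e\<in>C. \<beta> e * (3 * of_bool (\<exists>i\<in>{coord e 0, coord e 1, coord e 2}. k \<le> i)))"
  proof (intro sum_mono mult_left_mono \<beta>_nonneg)
    show "sum3 (\<lambda>i. of_bool (k \<le> i)) e \<le> 3 * of_bool (\<exists>i\<in>{coord e 0, coord e 1, coord e 2}. k \<le> i)"
      for e :: "nat \<times> nat \<times> nat"
      by (cases e) (auto simp: sum3_def coord_def)
  qed
  also have "\<dots> = 3 * (\<Sum>e\<in>C. \<beta> e * of_bool (\<exists>i\<in>{coord e 0, coord e 1, coord e 2}. k \<le> i))"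
    by (simp add: sum_distrib_left mult_ac)
  finally show ?thesis by simp
qed

text \<open>A heavy block contains a cell of weight at least 1, and each such cell carries load at
  most 1.\<close>

lemma big_mass_le_card: "big_mass \<le> real (card {i. i < K \<and> 1 \<le> w i})"
proof -
  have "big_mass \<le> SB (\<lambda>i. of_bool (1 \<le> w i))" unfolding big_mass_def in_blocks_def
  proof (intro sum_mono mult_left_mono \<beta>_nonneg)
    show "of_bool (big e) \<le> sum3 (\<lambda>i. of_bool (1 \<le> w i)) e" for e
      by (cases e) (auto simp: big_def heavy_def count1_def weights_def sum3_def)
  qed
  also have "\<dots> \<le> SB (\<lambda>i. of_bool (1 \<le> w i)) + SO (\<lambda>i. of_bool (1 \<le> w i))"
    unfolding off_blocks_def using load_le by (auto intro!: sum_nonneg)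
  also have "\<dots> = (\<Sum>i<K. of_bool (1 \<le> w i))" using sum_split_blocks[OF C(1)] by simp
  also have "\<dots> = real (card {i. i < K \<and> 1 \<le> w i})" by (simp add: Int_def)
  finally show ?thesis .
qed

text \<open>Almost all block mass is light or almost all is heavy. The first alternative is the
  clique, the second the covering family; in each a high triple of cells must be full, since its
  absence would cost too many triples.\<close>

lemma blocks_structure:
  assumes lower: "B ^ 3 * cap ratio - B ^ 3 / 10 ^ 9 \<le> real (card C)"
    and i0: "real i0 \<le> 3 * (199/200 * B)" and i1: "real i1 \<le> 199/200 * B" and j1: "real j1 \<le> 199/200 * real K"
  shows "(ratio < 1/2 \<and> (\<exists>(i, j, l)\<in>C. i0 \<le> i \<and> i0 \<le> j \<and> i0 \<le> l)) \<or>
         (9/20 < ratio \<and> (\<exists>(i, j, l)\<in>C. i1 \<le> i \<and> j1 \<le> j \<and> j1 \<le> l))"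
proof -
  define q where "q = big_mass / B"
  have q: "0 \<le> q" "q \<le> 1" "big_mass = q * B" using big_mass_bounds B_pos by (auto simp: q_def)
  have B3: "0 < B ^ 3" using B_pos by simp
  \<comment> \<open>The error 10^-9 divided by the loss 1/10 per defect.\<close>
  have md: "mass defect \<le> B ^ 3 / 10 ^ 8" using card_C_le lower by simp
  have "B ^ 3 - (q * B) ^ 3 - (B - q * B) ^ 3 = B ^ 3 * (3 * q * (1 - q))"
    by (simp add: power3_eq_cube algebra_simps)
  then have "B ^ 3 * (3 * q * (1 - q)) \<le> B ^ 3 * (1 / 10 ^ 8)"
    using mass_defect_ge_mixed md q(3) by simp
  then have mix: "3 * q * (1 - q) \<le> 1 / 10 ^ 8" using B3 by (simp only: mult_le_cancel_left_pos)
  show ?thesis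
  proof (cases "q \<le> 1/2")
    case True
    have "q * (1/2) \<le> q * (1 - q)" using True q by (intro mult_left_mono) auto
    then have qs: "q \<le> 1 / 10 ^ 8" using mix by simp
    have "q ^ 3 \<le> q ^ 1" using q by (intro power_decreasing) auto
    then have q3: "q ^ 3 \<le> 1 / 10 ^ 8" using qs by simp
    have r: "ratio < 1/2"
    proof (rule ccontr)
      assume "\<not> ratio < 1/2"
      then have "mass (\<lambda>e f g. \<not> big e \<and> \<not> big f \<and> \<not> big g) \<le> mass defect"
        by (intro mass_mono) (auto simp: defect_def)
      then have "(B - q * B) ^ 3 \<le> B ^ 3 / 10 ^ 8" using md mass_small q(3) by simp
      then have "B ^ 3 * (1 - q) ^ 3 \<le> B ^ 3 * (1 / 10 ^ 8)"
        by (simp add: power_mult_distrib[symmetric] algebra_simps)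
      then have "(1 - q) ^ 3 \<le> 1 / 10 ^ 8" using B3 by (simp only: mult_le_cancel_left_pos)
      moreover have "(1/2) ^ 3 \<le> (1 - q) ^ 3" using True by (intro power_mono) auto
      ultimately show False by (simp add: power3_eq_cube)
    qed
    \<comment> \<open>Without such a triple, any three blocks that each have a cell at or above
      \<open>i0\<close> miss a transversal. Their mass is at least (B/200)^3, which exceeds the at
      most 2 B^3 / 10^8 available for defects and heavy triples.\<close>
    moreover have "\<exists>(i, j, l)\<in>C. i0 \<le> i \<and> i0 \<le> j \<and> i0 \<le> l"
    proof (rule ccontr)
      assume no: "\<not> ?thesis"
      let ?T = "\<lambda>e. \<exists>i\<in>{coord e 0, coord e 1, coord e 2}. i0 \<le> i"
      define \<tau> where "\<tau> = (\<Sum>e\<in>C. \<beta> e * of_bool (?T e))"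
      have "B - real i0 / 3 \<le> \<tau>" unfolding \<tau>_def by (rule high_block_mass)
      then have "B / 200 \<le> \<tau>" using i0 by simp
      then have "(B / 200) ^ 3 \<le> \<tau> ^ 3" using B_pos by (intro power_mono) auto
      also have "\<tau> ^ 3 = mass (\<lambda>e f g. ?T e \<and> ?T f \<and> ?T g)"
      proof -
        have "mass (\<lambda>e f g. ?T e \<and> ?T f \<and> ?T g)
          = (\<Sum>e\<in>C. \<Sum>f\<in>C. \<Sum>g\<in>C. \<beta> e * \<beta> f * \<beta> g * (of_bool (?T e) * of_bool (?T f) * of_bool (?T g)))"
          unfolding mass_def by (intro sum.cong refl) (simp only: of_bool_conj mult.assoc)
        also have "\<dots> = \<tau> ^ 3" unfolding prod3 by (simp add: \<tau>_def power3_eq_cube)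
        finally show ?thesis by simp
      qed
      also have "\<dots> \<le> mass (\<lambda>e f g. (defect e f g \<and> \<not> (big e \<and> big f \<and> big g)) \<or> (big e \<and> big f \<and> big g))"
      proof (rule mass_mono)
        fix e f g assume T: "?T e \<and> ?T f \<and> ?T g"
        then obtain i j l where ijl: "i \<in> {coord e 0, coord e 1, coord e 2}" "j \<in> {coord f 0, coord f 1, coord f 2}"
          "l \<in> {coord g 0, coord g 1, coord g 2}" "i0 \<le> i" "i0 \<le> j" "i0 \<le> l" by meson
        then have "(i, j, l) \<notin> C" using no by blast
        then have "transversals C e f g \<le> 26" using transversals_miss ijl by blast
        then show "(defect e f g \<and> \<not> (big e \<and> big f \<and> big g)) \<or> (big e \<and> big f \<and> big g)"
          by (auto simp: defect_def)
      qed
      also have "\<dots> = mass (\<lambda>e f g. defect e f g \<and> \<not> (big e \<and> big f \<and> big g)) + mass (\<lambda>e f g. big e \<and> big f \<and> big g)"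
        by (rule mass_add) blast
      also have "mass (\<lambda>e f g. defect e f g \<and> \<not> (big e \<and> big f \<and> big g)) \<le> mass defect"
        by (rule mass_mono) blast
      also have "mass (\<lambda>e f g. big e \<and> big f \<and> big g) = B ^ 3 * q ^ 3"
        using mass_big q(3) by (simp add: power_mult_distrib)
      finally have "(B / 200) ^ 3 \<le> B ^ 3 / 10 ^ 8 + B ^ 3 * q ^ 3" using md by simp
      then have "B ^ 3 * (1 / 200 ^ 3) \<le> B ^ 3 * (1 / 10 ^ 8 + q ^ 3)"
        by (simp add: power_divide algebra_simps)
      then have "1 / 200 ^ 3 \<le> 1 / 10 ^ 8 + q ^ 3" using B3 by (simp only: mult_le_cancel_left_pos)
      then have "1 / 200 ^ 3 \<le> (1 / 10 ^ 8 + 1 / 10 ^ 8 :: real)" using q3 by linarith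
      then show False by simp
    qed
    ultimately show ?thesis by blast
  next
    case False
    have "(1/2) * (1 - q) \<le> q * (1 - q)" using False q by (intro mult_right_mono) auto
    then have qs: "1 - q \<le> 1 / 10 ^ 8" using mix by simp
    have r: "9/20 < ratio"
    proof (rule ccontr)
      assume "\<not> 9/20 < ratio"
      then have "mass (\<lambda>e f g. big e \<and> big f \<and> big g) \<le> mass defect"
        by (intro mass_mono) (auto simp: defect_def)
      then have "B ^ 3 * q ^ 3 \<le> B ^ 3 * (1 / 10 ^ 8)" using md mass_big q(3) by (simp add: power_mult_distrib mult.commute)
      then have "q ^ 3 \<le> 1 / 10 ^ 8" using B3 by (simp only: mult_le_cancel_left_pos)
      moreover have "(1/2) ^ 3 \<le> q ^ 3" using False by (intro power_mono) auto
      ultimately show False by (simp add: power3_eq_cube)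
    qed
    \<comment> \<open>Otherwise the box \<open>X\<close> of cells of weight 1 from \<open>i1\<close>
      on, times pairs of cells from \<open>j1\<close> on, is disjoint from \<open>C\<close>,
      although its triples have weight at least 1. Adding it to \<open>C\<close> would violate
      \<open>card_weighted_le\<close>.\<close>
    moreover have "\<exists>(i, j, l)\<in>C. i1 \<le> i \<and> j1 \<le> j \<and> j1 \<le> l"
    proof (rule ccontr)
      assume no: "\<not> ?thesis"
      let ?G = "{(i, j, l). i < K \<and> j < K \<and> l < K \<and> 1 \<le> w i + w j + w l}"
      define A where "A = {i. i < K \<and> 1 \<le> w i}"
      define X where "X = (A - {..<i1}) \<times> {j1..<K} \<times> {j1..<K}"
      have fG: "finite ?G" by (rule finite_subset[of _ "{..<K} \<times> {..<K} \<times> {..<K}"]) auto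
      have CX: "C \<inter> X = {}" using no by (auto simp: X_def)
      have XG: "X \<subseteq> ?G"
      proof
        fix t assume t: "t \<in> X"
        obtain i j l where "t = (i, j, l)" by (cases t)
        then show "t \<in> ?G" using t w_nonneg[of j] w_nonneg[of l] by (auto simp: X_def A_def)
      qed
      have CG: "C \<subseteq> ?G" using C_sum C(1) by auto
      have fA: "finite A" by (simp add: A_def)
      have "card C + card X = card (C \<union> X)" using CX fC fA by (intro card_Un_disjoint[symmetric]) (auto simp: X_def)
      also have "\<dots> \<le> card ?G" using fG CG XG by (intro card_mono) auto
      finally have "real (card C) + real (card X) \<le> real (card ?G)" by linarith
      then have cX: "real (card X) \<le> B ^ 3 / 10 ^ 9" using card_weighted_le lower by linarith
      have "q * B \<le> real (card A)" using big_mass_le_card q(3) by (simp add: A_def)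
      moreover have "card A - i1 \<le> card (A - {..<i1})" using diff_card_le_card_Diff[of "{..<i1}" A] by simp
      ultimately have "q * B - real i1 \<le> real (card (A - {..<i1}))" by linarith
      moreover have "(1 - 1 / 10 ^ 8) * B \<le> q * B" using qs B_pos by (intro mult_right_mono) auto
      ultimately have a: "B / 400 \<le> real (card (A - {..<i1}))" using i1 by simp
      have K3: "3 * B \<le> real K" using Out_nonneg by (simp add: Out_def)
      have b: "B / 100 \<le> real (card {j1..<K})" using j1 K3 by simp
      have "B / 400 * (B / 100 * (B / 100)) \<le> real (card (A - {..<i1})) * (real (card {j1..<K}) * real (card {j1..<K}))"
        using a b B_pos by (intro mult_mono) auto
      also have "\<dots> = real (card X)" by (simp add: X_def card_cartesian_product)
      finally have "B ^ 3 * (1 / 4000000) \<le> B ^ 3 * (1 / 10 ^ 9)" using cX by (simp add: power3_eq_cube)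
      then have "(1 / 4000000 :: real) \<le> 1 / 10 ^ 9" using B3 by (simp only: mult_le_cancel_left_pos)
      then show False by simp
    qed
    ultimately show ?thesis by blast
  qed
qed

text \<open>In cells, the two branches are the ordered triples of a clique on 3 B cells and those
  meeting a set of B cells.\<close>

lemma cap_ratio: "B ^ 3 * cap ratio = max (27 * B ^ 3) (real K ^ 3 - (real K - B) ^ 3)"
proof -
  have "B * ratio = Out" using B_pos by (simp add: ratio_def)
  have "B ^ 3 * (19 + 15 * ratio + 3 * ratio\<^sup>2) = 19 * B ^ 3 + 15 * B\<^sup>2 * (B * ratio) + 3 * B * (B * ratio)\<^sup>2"
    by (simp add: power3_eq_cube power2_eq_square algebra_simps)
  also have "\<dots> = real K ^ 3 - (real K - B) ^ 3"
    unfolding \<open>B * ratio = Out\<close> Out_def by (simp add: power3_eq_cube power2_eq_square algebra_simps)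
  finally show ?thesis using B_pos by (simp add: cap_def max_mult_distrib_left)
qed

end

section \<open>The dichotomy\<close>

lemma six_choose_three: "6 * real (m choose 3) = real m * (real m - 1) * (real m - 2)"
proof (induction m)
  case (Suc m)
  have "2 * real (m choose 2) = real m * (real m - 1)"
  proof (cases m)
    case (Suc r)
    have "2 * (m choose 2) = m * (m - 1)" by (rule two_times_choose_two)
    then have "real (2 * (m choose 2)) = real (m * (m - 1))" by (rule arg_cong)
    then show ?thesis using Suc by (simp add: algebra_simps)
  qed simp
  moreover have "Suc m choose 3 = (m choose 2) + (m choose 3)" by (simp add: numeral_3_eq_3 numeral_2_eq_2)
  ultimately show ?case using Suc by (simp add: algebra_simps)
qed simp

section \<open>Asymptotics of the two candidates and numerical estimates\<close>

lemma six_cl_ge: "27 * real s ^ 3 \<le> 6 * real (cl s)"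
  unfolding cl_def six_choose_three by (simp add: power3_eq_cube algebra_simps)

lemma six_cov_ge:
  assumes "s \<le> n"
  shows "real n ^ 3 - (real n - real s) ^ 3 - 3 * (real n)\<^sup>2 \<le> 6 * real (cov n s)"
proof -
  have "(n - s choose 3) \<le> (n choose 3)" by (rule binomial_right_mono) simp
  then have "6 * real (cov n s) = 6 * real (n choose 3) - 6 * real (n - s choose 3)"
    by (simp add: cov_def of_nat_diff)
  also have "\<dots> = real n * (real n - 1) * (real n - 2) - (real n - real s) * (real n - real s - 1) * (real n - real s - 2)"
    unfolding six_choose_three using assms by (simp add: of_nat_diff)
  also have "\<dots> = real n ^ 3 - (real n - real s) ^ 3 - 3 * (real n)\<^sup>2 + 3 * (real n - real s)\<^sup>2 + 2 * real s"
    by (simp add: power3_eq_cube power2_eq_square algebra_simps)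
  finally show ?thesis using zero_le_power2[of "real n - real s"] by linarith
qed

lemma cube_diff_mono:
  fixes b V N :: real
  assumes "0 \<le> b" "b \<le> V" "V \<le> N"
  shows "V ^ 3 - (V - b) ^ 3 \<le> N ^ 3 - (N - b) ^ 3"
proof -
  have "N ^ 3 - (N - b) ^ 3 - (V ^ 3 - (V - b) ^ 3) = 3 * (b * ((N - V) * (N + V - b)))"
    by (simp add: power3_eq_cube algebra_simps)
  moreover have "0 \<le> (N - V) * (N + V - b)" using assms by (intro mult_nonneg_nonneg) auto
  then have "0 \<le> b * ((N - V) * (N + V - b))" by (rule mult_nonneg_nonneg[OF assms(1)])
  ultimately show ?thesis by linarith
qed

text \<open>Here \<open>S\<close>, \<open>N\<close>, \<open>V\<close>, \<open>b\<close> and \<open>T\<close> stand for \<open>s\<close>, \<open>n\<close>, the number of vertices in cells, the total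
  block weight and the number of ordered triples in full cells.\<close>

lemma numeric_core:
  fixes S N V b T :: real
  assumes S: "0 < S" and N: "3 * S \<le> N" "N \<le> 30 * S" and V: "V \<le> N" and b: "0 \<le> b" "3 * b \<le> V" "b \<le> S + S / 10 ^ 15"
    and T1: "27 * S ^ 3 - S ^ 3 / 10 ^ 11 \<le> T" and T2: "N ^ 3 - (N - S) ^ 3 - S ^ 3 / 10 ^ 11 \<le> T"
    and T: "T \<le> max (27 * b ^ 3) (V ^ 3 - (V - b) ^ 3)"
  shows "996 / 1000 * S \<le> b"
    and "max (27 * b ^ 3) (V ^ 3 - (V - b) ^ 3) - b ^ 3 / 10 ^ 9 \<le> T"
proof -
  have S3: "0 < S ^ 3" using S by simp
  have mono: "V ^ 3 - (V - b) ^ 3 \<le> N ^ 3 - (N - b) ^ 3" using b V by (intro cube_diff_mono) auto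
  \<comment> \<open>If \<open>b\<close> were smaller, both terms of the maximum would fall short of
    their values at \<open>S\<close> by at least S^3 / 100, far above the allowed error. The value
    996/1000 is used later through 199/200 * 996/1000 > 99/100.\<close>
  show lo: "996 / 1000 * S \<le> b"
  proof (rule ccontr)
    assume "\<not> ?thesis"
    then have bs: "b \<le> 996 / 1000 * S" by simp
    have "b ^ 3 \<le> (996 / 1000 * S) ^ 3" using bs b by (intro power_mono) auto
    also have "\<dots> = (996 / 1000) ^ 3 * S ^ 3" by (rule power_mult_distrib)
    also have "\<dots> \<le> 99 / 100 * S ^ 3" using S3 by (intro mult_right_mono) (auto simp: power3_eq_cube)
    finally have 1: "27 * b ^ 3 < T" using T1 S3 by (simp del: zero_less_power_eq_numeral)
    have "(N - 996 / 1000 * S) ^ 3 \<le> (N - b) ^ 3" using bs N S by (intro power_mono) auto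
    moreover have "(N - S) ^ 3 + S ^ 3 / 100 \<le> (N - 996 / 1000 * S) ^ 3"
    proof -
      define X where "X = N - S"
      have X: "2 * S \<le> X" using N by (simp add: X_def)
      have "(X + 4 / 1000 * S) ^ 3 = X ^ 3 + 12 / 1000 * (X\<^sup>2 * S) + 48 / 1000000 * (X * S\<^sup>2) + 64 / 1000000000 * S ^ 3"
        by (simp add: power3_eq_cube power2_eq_square field_simps)
      moreover have "(2 * S)\<^sup>2 * S \<le> X\<^sup>2 * S" using X S by (intro mult_right_mono power_mono) auto
      moreover have "(2 * S)\<^sup>2 * S = 4 * S ^ 3" by (simp add: power3_eq_cube power2_eq_square)
      moreover have "0 \<le> X * S\<^sup>2" using X S by (intro mult_nonneg_nonneg) auto
      ultimately have "X ^ 3 + S ^ 3 / 100 \<le> (X + 4 / 1000 * S) ^ 3" using S3 by linarith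
      then show ?thesis by (simp add: X_def)
    qed
    ultimately have "V ^ 3 - (V - b) ^ 3 < T" using mono T2 S3 by (simp del: zero_less_power_eq_numeral)
    then show False using 1 T by simp
  qed
  have "b ^ 3 \<le> (S + S / 10 ^ 15) ^ 3" using b by (intro power_mono) auto
  also have "\<dots> = (1 + 1 / 10 ^ 15) ^ 3 * S ^ 3" by (simp add: power_mult_distrib[symmetric] algebra_simps)
  also have "\<dots> \<le> (1 + 1 / 10 ^ 14) * S ^ 3" using S3 by (intro mult_right_mono) (auto simp: power3_eq_cube)
  finally have up1: "27 * b ^ 3 \<le> 27 * S ^ 3 + S ^ 3 / 10 ^ 11" using S3 by (simp del: zero_less_power_eq_numeral)
  \<comment> \<open>The excess of \<open>b\<close> over \<open>S\<close> changes the cube by at most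
    3 (29 S)^2 S / 10^15; here N <= 30 S enters.\<close>
  have "(N - S - S / 10 ^ 15) ^ 3 \<le> (N - b) ^ 3" using b N S by (intro power_mono) auto
  moreover have "(N - S) ^ 3 - S ^ 3 / 10 ^ 11 \<le> (N - S - S / 10 ^ 15) ^ 3"
  proof -
    define X d where "X = N - S" and "d = S / 10 ^ 15"
    have X: "0 \<le> X" "X \<le> 29 * S" using N S by (auto simp: X_def)
    have d: "0 \<le> d" "d \<le> X" using S N by (auto simp: d_def X_def)
    have "(X - d) ^ 3 = X ^ 3 - 3 * (X\<^sup>2 * d) + d\<^sup>2 * (3 * X - d)"
      by (simp add: power3_eq_cube power2_eq_square algebra_simps)
    moreover have "0 \<le> d\<^sup>2 * (3 * X - d)" using d by (intro mult_nonneg_nonneg) auto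
    moreover have "X\<^sup>2 * d \<le> (29 * S)\<^sup>2 * d" using X d by (intro mult_right_mono power_mono) auto
    moreover have "(29 * S)\<^sup>2 * d = 841 / 1000000000000000 * S ^ 3" by (simp add: d_def power3_eq_cube power2_eq_square)
    ultimately have "X ^ 3 - S ^ 3 / 100000000000 \<le> (X - d) ^ 3" using S3 by linarith
    then have "X ^ 3 - S ^ 3 / 10 ^ 11 \<le> (X - d) ^ 3" by simp
    then show ?thesis by (simp add: X_def d_def)
  qed
  ultimately have up2: "V ^ 3 - (V - b) ^ 3 \<le> N ^ 3 - (N - S) ^ 3 + S ^ 3 / 10 ^ 11" using mono by linarith
  have "(996 / 1000 * S) ^ 3 \<le> b ^ 3" using lo S by (intro power_mono) auto
  then have "(996 / 1000) ^ 3 * S ^ 3 \<le> b ^ 3" by (simp only: power_mult_distrib)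
  moreover have "1 / 2 * S ^ 3 \<le> (996 / 1000) ^ 3 * S ^ 3" using S3 by (intro mult_right_mono) (auto simp: power3_eq_cube)
  ultimately have b3: "1 / 2 * S ^ 3 \<le> b ^ 3" by linarith
  have "2 * (S ^ 3 / 10 ^ 11) \<le> b ^ 3 / 10 ^ 9" using b3 S3 by (simp del: zero_less_power_eq_numeral)
  then show "max (27 * b ^ 3) (V ^ 3 - (V - b) ^ 3) - b ^ 3 / 10 ^ 9 \<le> T"
    using up1 up2 T1 T2 by linarith
qed

text \<open>The offsets 0, 1, 2 give different residues modulo \<open>L\<close>, so the vertices are
  distinct even if cells coincide.\<close>

lemma full_cell_edge:
  assumes "(i, j, l) \<in> full_cells K L E" "3 \<le> L"
  shows "{i * L, j * L + 1, l * L + 2} \<in> E" "card {i * L, j * L + 1, l * L + 2} = 3"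
proof -
  have m: "i * L mod L = 0" "(j * L + 1) mod L = 1" "(l * L + 2) mod L = 2"
    using assms(2) by (simp_all only: mod_mult_self3 mod_mult_self2_is_0) simp_all
  have "(0::nat) \<noteq> 1" "(0::nat) \<noteq> 2" "(1::nat) \<noteq> 2" by auto
  then have "i * L \<noteq> j * L + 1" "i * L \<noteq> l * L + 2" "j * L + 1 \<noteq> l * L + 2"
    by (metis m(1,2), metis m(1,3), metis m(2,3))
  then show c: "card {i * L, j * L + 1, l * L + 2} = 3" by simp
  have "i * L \<in> cell L i" "j * L + 1 \<in> cell L j" "l * L + 2 \<in> cell L l" using assms(2) by (auto simp: cell_def)
  then show "{i * L, j * L + 1, l * L + 2} \<in> E" using assms(1) c unfolding full_cells_def by blast
qed

lemma structure_dichotomy: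
  fixes n s :: nat
  assumes st: "stable {..<n} E" and E: "E \<subseteq> triples {..<n}" and nu: "nu_le E s"
    and n: "3 * s + 2 \<le> n" "n \<le> 30 * s" and s: "10 ^ 69 \<le> s"
    and large: "cov n s \<le> card E" "cl s \<le> card E"
    and K: "CARD('k::finite) = 10 ^ 18"
  shows "(100 * n \<le> 352 * s \<and> (\<exists>x y z. 3 * s + 2 - 3 * s div 100 \<le> x \<and> 3 * s + 2 - 3 * s div 100 \<le> y \<and>
        3 * s + 2 - 3 * s div 100 \<le> z \<and> card {x, y, z} = 3 \<and> {x, y, z} \<in> E)) \<or>
    (343 * s \<le> 100 * n \<and> (\<exists>x y z. s - s div 100 \<le> x \<and> n - n div 100 \<le> y \<and> n - n div 100 \<le> z \<and>
        card {x, y, z} = 3 \<and> {x, y, z} \<in> E))"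
proof -
  \<comment> \<open>As k L <= n <= 30 s, partly filled boxes account for at most 3 k^2 L^3 <= 81000
    s^3 / 10^18 ordered triples, fewer than s^3 / 10^12. The rounding loss k^3 = 10^54 is at most s
    / 10^15 because s >= 10^69.\<close>
  define k :: nat where "k = 10 ^ 18"
  define L where "L = n div k"
  define C where "C = full_cells k L E"
  define S N where "S = real s" and "N = real n"
  have k0: "0 < k" by (simp add: k_def)
  have kr: "real k = 10 ^ 18" by (simp add: k_def)
  have S69: "10 ^ 69 \<le> S" using s unfolding S_def by (metis of_nat_le_iff of_nat_numeral of_nat_power)
  then have S0: "0 < S" by (rule less_le_trans[rotated]) simp
  have N: "3 * S \<le> N" "N \<le> 30 * S" using n by (auto simp: S_def N_def)
  have L3: "3 \<le> L"
  proof -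
    have "3 * k \<le> 10 ^ 69" by (simp add: k_def)
    then have "3 * k \<le> n" using s n by linarith
    then show ?thesis unfolding L_def using k0 by (simp add: less_eq_div_iff_mult_less_eq)
  qed
  define V where "V = real k * real L"
  have kL: "k * L \<le> n" "n < k * L + k"
    using k0 by (auto simp: L_def) (metis add.commute dividend_less_times_div)
  have V: "V \<le> N" "N < V + real k"
  proof -
    have "real (k * L) \<le> real n" "real n < real (k * L + k)" using kL by (auto simp only: of_nat_le_iff of_nat_less_iff)
    then show "V \<le> N" "N < V + real k" by (auto simp: V_def N_def)
  qed
  have Lr: "real L \<le> S / 10 ^ 16"
  proof -
    have "10 ^ 18 * real L \<le> 30 * S" using V N by (simp add: V_def kr)
    then show ?thesis using S0 by simp
  qed
  have small: "real k \<le> S / 10 ^ 30" "real k ^ 3 \<le> S / 10 ^ 15" "3 \<le> S / 10 ^ 60" using S69 by (simp_all add: kr)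
  define T where "T = real (card C) * real L ^ 3"
  have "6 * card E \<le> (card C + 3 * k\<^sup>2) * L ^ 3 + 3 * (n - k * L) * n\<^sup>2"
    unfolding C_def using L3 kL by (intro card_le_full_cells[OF st E]) auto
  also have "\<dots> \<le> (card C + 3 * k\<^sup>2) * L ^ 3 + 3 * k * n\<^sup>2" using kL by (intro add_left_mono mult_right_mono) auto
  finally have "real (6 * card E) \<le> real ((card C + 3 * k\<^sup>2) * L ^ 3 + 3 * k * n\<^sup>2)" by (rule of_nat_mono)
  then have E6: "6 * real (card E) \<le> T + 3 * ((real k)\<^sup>2 * real L ^ 3) + 3 * (real k * N\<^sup>2)"
    by (simp add: T_def N_def algebra_simps)
  have S3: "0 < S ^ 3" using S0 by simp
  have N2: "N\<^sup>2 \<le> 900 * S\<^sup>2"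
  proof -
    have "N\<^sup>2 \<le> (30 * S)\<^sup>2" using N S0 by (intro power_mono) auto
    then show ?thesis by (simp add: power_mult_distrib)
  qed
  have e1: "3 * ((real k)\<^sup>2 * real L ^ 3) \<le> S ^ 3 / 10 ^ 12"
  proof -
    have "V ^ 3 \<le> (30 * S) ^ 3" using V N by (intro power_mono) (auto simp: V_def)
    then have "real k * ((real k)\<^sup>2 * real L ^ 3) \<le> 27000 * S ^ 3" by (simp add: V_def power_mult_distrib power3_eq_cube power2_eq_square mult_ac)
    then show ?thesis using S3 by (simp add: kr del: zero_less_power_eq_numeral)
  qed
  have e2: "3 * (real k * N\<^sup>2) \<le> S ^ 3 / 10 ^ 12"
  proof -
    have "real k * N\<^sup>2 \<le> (S / 10 ^ 30) * (900 * S\<^sup>2)" using small N2 by (intro mult_mono) auto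
    also have "\<dots> = 900 / 10 ^ 30 * S ^ 3" by (simp add: power3_eq_cube power2_eq_square)
    finally show ?thesis using S3 by (simp del: zero_less_power_eq_numeral)
  qed
  have e3: "3 * N\<^sup>2 \<le> S ^ 3 / 10 ^ 12"
  proof -
    have "1 * N\<^sup>2 \<le> real k * N\<^sup>2" by (intro mult_right_mono) (auto simp: kr)
    then show ?thesis using e2 by linarith
  qed
  have T1: "27 * S ^ 3 - S ^ 3 / 10 ^ 11 \<le> T"
  proof -
    have "27 * S ^ 3 \<le> 6 * real (card E)" using six_cl_ge[of s] large(2) by (simp add: S_def)
    then show ?thesis using E6 e1 e2 S3 by (simp del: zero_less_power_eq_numeral)
  qed
  have T2: "N ^ 3 - (N - S) ^ 3 - S ^ 3 / 10 ^ 11 \<le> T"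
  proof -
    have "N ^ 3 - (N - S) ^ 3 - 3 * N\<^sup>2 \<le> 6 * real (card E)"
      using six_cov_ge[of s n] n large(1) by (simp add: S_def N_def)
    then show ?thesis using E6 e1 e2 e3 S3 by (simp del: zero_less_power_eq_numeral)
  qed
  have "C \<noteq> {}"
  proof
    assume "C = {}"
    then have "T = 0" by (simp add: T_def)
    then show False using T1 S0 by simp
  qed
  moreover have Csub: "C \<subseteq> {..<k} \<times> {..<k} \<times> {..<k}" unfolding C_def by (rule full_cells_sub)
  ultimately obtain \<beta> w where opt: "optimal_pair k C \<beta> w"
    using optimal_pair_exists[where 'k = 'k, of C k] K k_def by auto
  interpret optimal_blocks k C \<beta> w
    using Csub \<open>C \<noteq> {}\<close> opt by unfold_locales
  define b where "b = B * real L"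
  have Lp: "0 < real L" using L3 by simp
  have b: "0 \<le> b" "3 * b \<le> V" "b \<le> S + S / 10 ^ 15"
  proof -
    show "0 \<le> b" using B_pos by (simp add: b_def)
    have "(3 * B) * real L \<le> real k * real L" using Out_nonneg by (intro mult_right_mono) (auto simp: Out_def)
    then show "3 * b \<le> V" by (simp add: b_def V_def)
    have "b \<le> S + real k ^ 3"
      using matching_from_weights[OF E nu opt[unfolded C_def]]
      unfolding b_def B_def S_def C_def[symmetric] .
    then show "b \<le> S + S / 10 ^ 15" using small by linarith
  qed
  have scale: "(B ^ 3 * cap ratio) * real L ^ 3 = max (27 * b ^ 3) (V ^ 3 - (V - b) ^ 3)"
  proof -
    have "V - b = (real k - B) * real L" by (simp add: V_def b_def algebra_simps)
    then have "(V - b) ^ 3 = (real k - B) ^ 3 * real L ^ 3" by (simp only: power_mult_distrib)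
    moreover have "V ^ 3 = real k ^ 3 * real L ^ 3" unfolding V_def by (rule power_mult_distrib)
    ultimately have "(real k ^ 3 - (real k - B) ^ 3) * real L ^ 3 = V ^ 3 - (V - b) ^ 3"
      by (simp only: left_diff_distrib)
    moreover have "(27 * B ^ 3) * real L ^ 3 = 27 * b ^ 3" by (simp add: b_def power_mult_distrib)
    ultimately show ?thesis unfolding cap_ratio by (simp add: max_mult_distrib_right)
  qed
  have "0 \<le> mass defect" unfolding mass_def using \<beta>_nonneg by (intro sum_nonneg) auto
  then have "real (card C) \<le> B ^ 3 * cap ratio" using card_C_le by linarith
  then have "T \<le> (B ^ 3 * cap ratio) * real L ^ 3" unfolding T_def by (intro mult_right_mono) auto
  then have T: "T \<le> max (27 * b ^ 3) (V ^ 3 - (V - b) ^ 3)" unfolding scale .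
  note core = numeric_core[OF S0 N V(1) b T1 T2 T]
  have "(B ^ 3 * cap ratio - B ^ 3 / 10 ^ 9) * real L ^ 3 \<le> real (card C) * real L ^ 3"
  proof -
    have "(B ^ 3 / 10 ^ 9) * real L ^ 3 = b ^ 3 / 10 ^ 9" by (simp add: b_def power_mult_distrib)
    then show ?thesis using core(2) unfolding left_diff_distrib scale T_def by simp
  qed
  then have lower: "B ^ 3 * cap ratio - B ^ 3 / 10 ^ 9 \<le> real (card C)"
    using Lp by (simp only: mult_le_cancel_right_pos zero_less_power)
  \<comment> \<open>Thresholds about one percent below the full sizes. For each of them
    \<open>x div L + 1\<close> is the first cell that lies entirely above \<open>x\<close>, and the
    slack between 99/100 and 199/200 pays for this and for the deviation of \<open>b\<close> from
    \<open>S\<close>.\<close>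
  define a t m where "a = 3 * s + 2 - 3 * s div 100" and "t = s - s div 100" and "m = n - n div 100"
  have scaled: "real (x div L + 1) \<le> y" if "real x + real L \<le> y * real L" for x y
  proof -
    have "real (x div L + 1) * real L = real (x div L * L) + real L" by (simp add: algebra_simps)
    also have "\<dots> \<le> real x + real L" by (simp only: add_le_cancel_right of_nat_le_iff div_times_less_eq_dividend)
    finally have "real (x div L + 1) * real L \<le> y * real L" using that by linarith
    then show ?thesis using Lp by (simp only: mult_le_cancel_right_pos)
  qed
  have above: "x \<le> i * L" if "x div L + 1 \<le> i" for x i
  proof -
    have "x < (x div L + 1) * L" using dividend_less_div_times[of L x] L3 by simp
    also have "\<dots> \<le> i * L" using that by (intro mult_right_mono) auto
    finally show ?thesis by simp
  qed
  have i0: "real (a div L + 1) \<le> 3 * (199/200 * B)"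
  proof (rule scaled)
    have "100 * a \<le> 297 * s + 300" unfolding a_def by linarith
    then have "real (100 * a) \<le> real (297 * s + 300)" by (rule of_nat_mono)
    then have "100 * real a \<le> 297 * S + 300" by (simp add: S_def)
    then have "real a + real L \<le> 597 / 200 * b" using core(1) Lr small(3) S0 by simp
    then show "real a + real L \<le> 3 * (199/200 * B) * real L" by (simp add: b_def)
  qed
  have i1: "real (t div L + 1) \<le> 199/200 * B"
  proof (rule scaled)
    have "100 * t \<le> 99 * s + 100" unfolding t_def by linarith
    then have "real (100 * t) \<le> real (99 * s + 100)" by (rule of_nat_mono)
    then have "100 * real t \<le> 99 * S + 100" by (simp add: S_def)
    then have "real t + real L \<le> 199 / 200 * b" using core(1) Lr small(3) S0 by simp
    then show "real t + real L \<le> 199/200 * B * real L" by (simp add: b_def)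
  qed
  have j1: "real (m div L + 1) \<le> 199/200 * real k"
  proof (rule scaled)
    have "100 * m \<le> 99 * n + 100" unfolding m_def by linarith
    then have "real (100 * m) \<le> real (99 * n + 100)" by (rule of_nat_mono)
    then have "100 * real m \<le> 99 * N + 100" by (simp add: N_def)
    then have "real m + real L \<le> 199 / 200 * V" using V Lr small N S0 by simp
    then show "real m + real L \<le> 199/200 * real k * real L" by (simp add: V_def)
  qed
  have Out: "ratio * B = real k - 3 * B" using B_pos by (simp add: ratio_def Out_def)
  from blocks_structure[OF lower i0 i1 j1] show ?thesis
  proof (elim disjE conjE)
    assume r: "ratio < 1/2" and ex: "\<exists>(i, j, l)\<in>C. a div L + 1 \<le> i \<and> a div L + 1 \<le> j \<and> a div L + 1 \<le> l"
    obtain i j l where ijl: "(i, j, l) \<in> full_cells k L E" "a div L + 1 \<le> i" "a div L + 1 \<le> j" "a div L + 1 \<le> l"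
      using ex by (auto simp: C_def)
    have "ratio * B \<le> 1/2 * B" using r B_pos by (intro mult_right_mono) auto
    then have "real k \<le> 7/2 * B" using Out by linarith
    then have "real k * real L \<le> 7/2 * B * real L" by (intro mult_right_mono) auto
    then have "V \<le> 7/2 * b" by (simp add: V_def b_def)
    \<comment> \<open>3.52 instead of 3.5 leaves room for N < V + k and for the excess of
      \<open>b\<close> over \<open>S\<close>.\<close>
    then have "100 * N \<le> 352 * S" using V b(3) small S0 by simp
    then have "100 * n \<le> 352 * s" unfolding N_def S_def by (metis of_nat_le_iff of_nat_mult of_nat_numeral)
    moreover have "a \<le> i * L" "a \<le> j * L + 1" "a \<le> l * L + 2" using above ijl(2-4) trans_le_add1 by blast+
    ultimately show ?thesis using full_cell_edge[OF ijl(1) L3] unfolding a_def by blast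
  next
    assume r: "9/20 < ratio" and ex: "\<exists>(i, j, l)\<in>C. t div L + 1 \<le> i \<and> m div L + 1 \<le> j \<and> m div L + 1 \<le> l"
    obtain i j l where ijl: "(i, j, l) \<in> full_cells k L E" "t div L + 1 \<le> i" "m div L + 1 \<le> j" "m div L + 1 \<le> l"
      using ex by (auto simp: C_def)
    have "9/20 * B \<le> ratio * B" using r B_pos by (intro mult_right_mono) auto
    then have "69/20 * B \<le> real k" using Out by linarith
    then have "69/20 * B * real L \<le> real k * real L" by (intro mult_right_mono) auto
    then have "69/20 * b \<le> V" by (simp add: V_def b_def)
    \<comment> \<open>Uses 69/20 * 996/1000 = 3.4362.\<close>
    then have "343 * S \<le> 100 * N" using V core(1) S0 by simp
    then have "343 * s \<le> 100 * n" unfolding N_def S_def by (metis of_nat_le_iff of_nat_mult of_nat_numeral)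
    moreover have "t \<le> i * L" "m \<le> j * L + 1" "m \<le> l * L + 2" using above ijl(2-4) trans_le_add1 by blast+
    ultimately show ?thesis using full_cell_edge[OF ijl(1) L3] unfolding t_def m_def by blast
  qed
qed

lemma stable_bound:
  fixes n s :: nat
  assumes sn: "3 * s + 3 \<le> n" and E: "E \<subseteq> triples {..<n}" and nu: "nu_le E s" and st: "stable {..<n} E"
    and n: "10 ^ 71 \<le> n" and K: "CARD('k::finite) = 10 ^ 18"
  shows "card E \<le> max (cov n s) (cl s) \<and> (card E = max (cov n s) (cl s) \<longrightarrow> extremal {..<n} s E)"
proof -
  have star: "extremal {..<n} s (star {..<n} {..<s})"
    unfolding extremal_def using sn by (intro disjI1 exI[of _ "{..<s}"]) auto
  have from_star: ?thesis if "card E \<le> cov n s \<and> (card E = cov n s \<longrightarrow> E = star {..<n} {..<s})"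
    using that star by (auto simp: max_def)
  consider "30 * s \<le> n" | "n < 30 * s" "card E < max (cov n s) (cl s)" | "n < 30 * s" "max (cov n s) (cl s) \<le> card E"
    by linarith
  then show ?thesis
  proof cases
    case 1
    then show ?thesis
      using erdos_sparse[of 0 n E s] st E nu by (intro from_star) (simp add: atLeast0LessThan)
  next
    case 3
    \<comment> \<open>From 10^71 <= n < 30 s.\<close>
    have s: "10 ^ 69 \<le> s" using n 3(1) by simp
    have "1000000 \<le> (10::nat) ^ 69" by simp
    then have s100: "1000000 \<le> s" using s by (rule order_trans)
    let ?near_cl = "\<exists>x y z. 3 * s + 2 - 3 * s div 100 \<le> x \<and> 3 * s + 2 - 3 * s div 100 \<le> y \<and>
        3 * s + 2 - 3 * s div 100 \<le> z \<and> card {x, y, z} = 3 \<and> {x, y, z} \<in> E"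
    let ?near_star = "\<exists>x y z. s - s div 100 \<le> x \<and> n - n div 100 \<le> y \<and> n - n div 100 \<le> z \<and>
        card {x, y, z} = 3 \<and> {x, y, z} \<in> E"
    have "(100 * n \<le> 352 * s \<and> ?near_cl) \<or> (343 * s \<le> 100 * n \<and> ?near_star)"
      using structure_dichotomy[OF st E nu _ _ s _ _ K] 3 sn by simp
    then show ?thesis
    proof (elim disjE conjE)
      assume n352: "100 * n \<le> 352 * s" and ?near_cl
      then obtain x y z where xyz: "3 * s + 2 - 3 * s div 100 \<le> x" "3 * s + 2 - 3 * s div 100 \<le> y"
        "3 * s + 2 - 3 * s div 100 \<le> z" "card {x, y, z} = 3" "{x, y, z} \<in> E" by blast
      define d w where "d = 3 * s div 100" and "w = 3 * s + 2 - d"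
      have W: "triples {..<w} \<subseteq> E"
      proof
        fix e assume e: "e \<in> triples {..<w}"
        then obtain p q r where pqr: "e = {p, q, r}" by (auto simp: triples_def card_3_iff)
        have "p \<le> x" "q \<le> y" "r \<le> z" using e xyz(1-3) by (auto simp: pqr triples_def w_def d_def)
        moreover have "card {p, q, r} = 3" using e by (simp add: pqr triples_def)
        ultimately show "e \<in> E" unfolding pqr using stable_dominated[OF st E xyz(5,4)] by blast
      qed
      have d: "100 * d \<le> 3 * s" by (simp add: d_def)
      have wd: "w + d = 3 * s + 2" "2 * d + 2 \<le> w" using d s100 by (auto simp: w_def)
      \<comment> \<open>The complete part is at least 2.91 s after the removal, so it has more than
        4.2 s^2 pairs, against at most 2 * 0.52 * 3.52 s^2 < 3.7 s^2 on the left. This is what the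
        bound n <= 3.52 s is for.\<close>
      have num: "2 * ((n - (3 * s + 2)) * n) < (w - 2 * d) choose 2"
      proof -
        define u where "u = w - 2 * d"
        have "100 * u \<ge> 291 * s + 200" using d wd by (simp add: u_def)
        then have u: "291 * s \<le> 100 * (u - 1)" "291 * s \<le> 100 * u" by auto
        have "(291 * s) * (291 * s) \<le> (100 * u) * (100 * (u - 1))" by (rule mult_le_mono[OF u(2,1)])
        then have "84681 * (s * s) \<le> 10000 * (u * (u - 1))" by simp
        then have u2: "84681 * (s * s) \<le> 20000 * (u choose 2)" using two_times_choose_two[of u] by simp
        have "100 * (n - (3 * s + 2)) \<le> 52 * s" using n352 by simp
        then have "(100 * (n - (3 * s + 2))) * (100 * n) \<le> (52 * s) * (352 * s)" using n352 by (rule mult_le_mono)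
        then have "10000 * ((n - (3 * s + 2)) * n) \<le> 18304 * (s * s)" by simp
        moreover have "0 < s * s" using s100 by simp
        ultimately show ?thesis using u2 unfolding u_def by linarith
      qed
      have "card E \<le> cl s \<and> (card E = cl s \<longrightarrow> E = triples {..<3 * s + 2})"
        using near_complete[OF st E nu W wd _ num] sn by simp
      moreover have "extremal {..<n} s (triples {..<3 * s + 2})"
        unfolding extremal_def using sn s100 by (intro disjI2 conjI exI[of _ "{..<3 * s + 2}"]) auto
      ultimately show ?thesis by (auto simp: max_def)
    next
      assume n343: "343 * s \<le> 100 * n" and ?near_star
      then obtain x y z where xyz: "s - s div 100 \<le> x" "n - n div 100 \<le> y" "n - n div 100 \<le> z"
        "card {x, y, z} = 3" "{x, y, z} \<in> E" by blast
      show ?thesis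
      proof (rule from_star, rule near_star[OF st E nu])
        show "s - s div 100 \<le> s" "n - n div 100 \<le> n" by auto
        \<comment> \<open>n >= 3.43 s leaves 0.99 n >= 3.39 s, enough room for a matching of size s
          + 1 on the first vertices.\<close>
        have "99 * n \<le> 100 * (n - n div 100)" by linarith
        then show "3 * s + 3 \<le> n - n div 100" using n343 s100 by linarith
        have "100 * (s - (s - s div 100)) \<le> s" by linarith
        then show "30 * (s - (s - s div 100)) \<le> n - (s - s div 100)" using sn by linarith
        fix p q r assume "p < s - s div 100" "q < n - n div 100" "r < n - n div 100" "card {p, q, r} = 3"
        then show "{p, q, r} \<in> E" using stable_dominated[OF st E xyz(5,4), of p q r] xyz(1-3) by auto
      qed
    qed
  qed simp
qed

theorem theorem1:
  shows "\<exists>n0::nat. \<forall>n s::nat. n \<ge> n0 \<and> 1 \<le> s \<and> 3 * s \<le> n - 2 \<longrightarrow>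
     mu_max 3 n s = max ((n choose 3) - ((n - s) choose 3)) ((3 * s + 2) choose 3) \<and>
     M_fam 3 n s \<subseteq> Cov_fam 3 n s \<union> Cl_fam 3 n s"
proof (intro exI[of _ "10 ^ 71"] allI impI)
  fix n s :: nat assume a: "10 ^ 71 \<le> n \<and> 1 \<le> s \<and> 3 * s \<le> n - 2"
  have "(10::nat) ^ 1 \<le> 10 ^ 71" by (rule power_increasing) auto
  then have n10: "10 \<le> n" using a by simp
  \<comment> \<open>The duality lives in a Euclidean space with one coordinate per cell, so the
    number of cells has to be the cardinality of a type; a numeral type provides it.\<close>
  have K: "CARD(1000000000000000000) = 10 ^ 18" by simp
  have "mu_max 3 n s = max (cov n s) (cl s) \<and> M_fam 3 n s \<subseteq> Cov_fam 3 n s \<union> Cl_fam 3 n s"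
  proof (rule theorem_from_bound)
    show "3 * s + 2 \<le> n" "1 \<le> s" using a n10 by auto
    fix E assume "3 * s + 3 \<le> n" "E \<subseteq> triples {..<n}" "nu_le E s" "stable {..<n} E"
    then show "card E \<le> max (cov n s) (cl s) \<and> (card E = max (cov n s) (cl s) \<longrightarrow> extremal {..<n} s E)"
      using a K by (intro stable_bound[where 'k = 1000000000000000000]) auto
  qed (rule n10)
  then show "mu_max 3 n s = max ((n choose 3) - ((n - s) choose 3)) ((3 * s + 2) choose 3) \<and>
     M_fam 3 n s \<subseteq> Cov_fam 3 n s \<union> Cl_fam 3 n s"
    by (simp add: cov_def cl_def)
qed

end
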